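(* Over $\mathbb{C}$, there exists a polarized endomorphism $g:\mathbf{F}_1\to\mathbf{F}_1$ such that $$\Phi_{\mathbf{F}_1,g}(t)=(1+t)^3,$$ although $\mathbf{F}_1\not\simeq\mathbf{P}^2$. In particular, the equality $\Phi_{X,f}(t)=(1+t)^{\dim X+1}$ does not characterize projective space when the underlying variety $X$ is allowed to vary.
   Context: $\mathbf{F}_1$ is the first Hirzebruch surface, i.e. the blow-up of $\mathbf{P}^2$ at a point. An endomorphism $g:X\to X$ of a projective variety is polarized if $g^*H\sim qH$ for some ample Cartier divisor $H$ and some integer $q>1$. A subvariety $V\subseteq X$ is totally-periodic (for $f:X\to X$) if $(f^b)^{-1}(V)=V$ set-theoretically for some integer $b\geq 1$; for $1\leq r\leq \dim X$, $T_{\infty}^r(X,f)$ denotes the set of totally-periodic integral closed subvarieties of $X$ of codimension $r$. For an $n$-dimensional projective variety $X$ and a finite surjective endomorphism $f:X\to X$ such that $T_{\infty}^r(X,f)$ is finite for every $1\leq r\leq n$, the totally-periodic polynomial is $$ \Phi_{X,f}(t):=1+\sum_{r=1}^n|T_{\infty}^r(X,f)|\,t^r+t^{n+1}. $$ *)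

theory Defs
  imports "HOL-Analysis.Analysis" "HOL-Computational_Algebra.Polynomial"
    "HOL-Library.Extended_Nat"
begin

text \<open>
  Varieties over the complex numbers are treated classically: a variety is its set of closed
  points with the Zariski topology and the sheaf of regular complex-valued functions.
  The predicate \<^term>\<open>reg X U f\<close> below is only meaningful for open \<^term>\<open>U\<close>, and it
  depends only on the values of \<^term>\<open>f\<close> on \<^term>\<open>U\<close>.
\<close>

record 'a fspace =
  zar :: "'a topology"
  reg :: "'a set \<Rightarrow> ('a \<Rightarrow> complex) \<Rightarrow> bool"

abbreviation pts :: "'a fspace \<Rightarrow> 'a set" where
  "pts X \<equiv> topspace (zar X)"

definition preim :: "'a fspace \<Rightarrow> ('a \<Rightarrow> 'b) \<Rightarrow> 'b set \<Rightarrow> 'a set" where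
  "preim X \<phi> V = {p \<in> pts X. \<phi> p \<in> V}"

definition morphism :: "'a fspace \<Rightarrow> 'b fspace \<Rightarrow> ('a \<Rightarrow> 'b) \<Rightarrow> bool" where
  "morphism X Y \<phi> \<longleftrightarrow> continuous_map (zar X) (zar Y) \<phi> \<and>
     (\<forall>V f. openin (zar Y) V \<and> reg Y V f \<longrightarrow> reg X (preim X \<phi> V) (f \<circ> \<phi>))"

definition isomorphism :: "'a fspace \<Rightarrow> 'b fspace \<Rightarrow> ('a \<Rightarrow> 'b) \<Rightarrow> bool" where
  "isomorphism X Y \<phi> \<longleftrightarrow> morphism X Y \<phi> \<and>
     (\<exists>\<psi>. morphism Y X \<psi> \<and> (\<forall>p\<in>pts X. \<psi> (\<phi> p) = p) \<and> (\<forall>q\<in>pts Y. \<phi> (\<psi> q) = q))"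

definition isomorphic :: "'a fspace \<Rightarrow> 'b fspace \<Rightarrow> bool" where
  "isomorphic X Y \<longleftrightarrow> (\<exists>\<phi>. isomorphism X Y \<phi>)"

text \<open>Open or (reduced) closed subspaces: regular functions are locally restrictions.\<close>

definition subspace_of :: "'a fspace \<Rightarrow> 'a set \<Rightarrow> 'a fspace" where
  "subspace_of X Z =
     \<lparr>zar = subtopology (zar X) Z,
      reg = (\<lambda>U f. \<forall>p\<in>U. \<exists>W h. openin (zar X) W \<and> p \<in> W \<and> reg X W h \<and>
                      (\<forall>q\<in>W \<inter> U. f q = h q))\<rparr>"

definition closed_immersion :: "'a fspace \<Rightarrow> 'b fspace \<Rightarrow> ('a \<Rightarrow> 'b) \<Rightarrow> bool" where
  "closed_immersion X Y \<phi> \<longleftrightarrow>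
     closedin (zar Y) (\<phi> ` pts X) \<and> isomorphism X (subspace_of Y (\<phi> ` pts X)) \<phi>"


section \<open>Affine space, projective space and the first Hirzebruch surface\<close>

text \<open>
  The complex algebra of functions generated by a set of functions. Over the (infinite) field of
  complex numbers, polynomials are identified with the polynomial functions they induce.
\<close>

inductive_set gen_algebra :: "('v \<Rightarrow> complex) set \<Rightarrow> ('v \<Rightarrow> complex) set"
  for B :: "('v \<Rightarrow> complex) set" where
  const: "(\<lambda>_. c) \<in> gen_algebra B"
| gen: "b \<in> B \<Longrightarrow> b \<in> gen_algebra B"
| add: "F \<in> gen_algebra B \<Longrightarrow> G \<in> gen_algebra B \<Longrightarrow> (\<lambda>v. F v + G v) \<in> gen_algebra B"
| mult: "F \<in> gen_algebra B \<Longrightarrow> G \<in> gen_algebra B \<Longrightarrow> (\<lambda>v. F v * G v) \<in> gen_algebra B"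

text \<open>
  Let every point \<^term>\<open>p\<close> of \<^term>\<open>P\<close> have a nonempty set \<^term>\<open>crd p\<close> of possible coordinate
  vectors, and let \<^term>\<open>\<H>\<close> be a family of sets of polynomial functions (the homogeneous pieces
  of each degree), so that the vanishing of a member of a piece, and the ratio of two members of
  the same piece, do not depend on the choice of coordinates. The principal open sets form a basis
  of the Zariski topology; regular functions are locally quotients of two members of one piece.
\<close>

definition principal_open :: "'a set \<Rightarrow> ('a \<Rightarrow> 'v set) \<Rightarrow> ('v \<Rightarrow> complex) \<Rightarrow> 'a set" where
  "principal_open P crd F = {p \<in> P. \<forall>v\<in>crd p. F v \<noteq> 0}"

definition zariski_topology ::
    "'a set \<Rightarrow> ('a \<Rightarrow> 'v set) \<Rightarrow> ('v \<Rightarrow> complex) set set \<Rightarrow> 'a topology" where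
  "zariski_topology P crd \<H> = topology_generated_by {principal_open P crd F | F. F \<in> \<Union>\<H>}"

definition zariski_space ::
    "'a set \<Rightarrow> ('a \<Rightarrow> 'v set) \<Rightarrow> ('v \<Rightarrow> complex) set set \<Rightarrow> 'a fspace" where
  "zariski_space P crd \<H> =
     \<lparr>zar = zariski_topology P crd \<H>,
      reg = (\<lambda>U f. \<forall>p\<in>U. \<exists>W. openin (zariski_topology P crd \<H>) W \<and> p \<in> W \<and> W \<subseteq> U \<and>
               (\<exists>H\<in>\<H>. \<exists>F\<in>H. \<exists>G\<in>H. \<forall>q\<in>W. \<forall>v\<in>crd q. G v \<noteq> 0 \<and> f q = F v / G v))\<rparr>"

type_synonym cvec = "nat \<Rightarrow> complex"
type_synonym ppoint = "cvec set"

definition cspace :: "nat \<Rightarrow> cvec set" where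
  "cspace n = {x. \<forall>i\<ge>n. x i = 0}"

definition polys :: "nat \<Rightarrow> (cvec \<Rightarrow> complex) set" where
  "polys n = gen_algebra {(\<lambda>x. x i) | i. i < n}"

definition affine_space :: "nat \<Rightarrow> cvec fspace" where
  "affine_space n = zariski_space (cspace n) (\<lambda>x. {x}) {polys n}"

text \<open>Forms of degree \<^term>\<open>d\<close> in \<^term>\<open>n\<close> variables.\<close>

definition forms :: "nat \<Rightarrow> nat \<Rightarrow> (cvec \<Rightarrow> complex) set" where
  "forms n d = {F \<in> polys n. \<forall>c x. F (\<lambda>i. c * x i) = c ^ d * F x}"

text \<open>A point of projective space is the set of all its vectors of homogeneous coordinates.\<close>

definition proj_point :: "cvec \<Rightarrow> ppoint" where
  "proj_point x = {(\<lambda>i. c * x i) | c. c \<noteq> 0}"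

definition proj_points :: "nat \<Rightarrow> ppoint set" where
  "proj_points n = proj_point ` (cspace (n + 1) - {\<lambda>_. 0})"

definition proj_space :: "nat \<Rightarrow> ppoint fspace" where
  "proj_space n = zariski_space (proj_points n) (\<lambda>p. p) (range (forms (n + 1)))"

definition biforms :: "nat \<Rightarrow> nat \<Rightarrow> nat \<Rightarrow> nat \<Rightarrow> (cvec \<times> cvec \<Rightarrow> complex) set" where
  "biforms m n d e =
     {F \<in> gen_algebra ({(\<lambda>(x, y). x i) | i. i < m} \<union> {(\<lambda>(x, y). y j) | j. j < n}).
        \<forall>a b x y. F ((\<lambda>i. a * x i), (\<lambda>j. b * y j)) = a ^ d * b ^ e * F (x, y)}"

text \<open>The product of two projective spaces (its topology is not the product topology).\<close>

definition biproj_space :: "nat \<Rightarrow> nat \<Rightarrow> (ppoint \<times> ppoint) fspace" where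
  "biproj_space m n = zariski_space (proj_points m \<times> proj_points n) (\<lambda>(p, q). p \<times> q)
     {biforms (m + 1) (n + 1) d e | d e. True}"

text \<open>
  The blow-up of the projective plane at \<open>[0:0:1]\<close>: the pairs \<open>([x0:x1:x2], [y0:y1])\<close> with
  \<open>x0 y1 = x1 y0\<close>. The exceptional curve is the fibre of the first projection over \<open>[0:0:1]\<close>.
\<close>

definition F1 :: "(ppoint \<times> ppoint) fspace" where
  "F1 = subspace_of (biproj_space 2 1)
     {(p, q) \<in> proj_points 2 \<times> proj_points 1. \<forall>x\<in>p. \<forall>y\<in>q. x 0 * y 1 = x 1 * y 0}"


section \<open>Integral closed subvarieties, dimension and codimension\<close>

definition irreducible_closed :: "'a fspace \<Rightarrow> 'a set \<Rightarrow> bool" where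
  "irreducible_closed X Z \<longleftrightarrow> closedin (zar X) Z \<and> Z \<noteq> {} \<and>
     (\<forall>A B. closedin (zar X) A \<and> closedin (zar X) B \<and> Z = A \<union> B \<longrightarrow> Z = A \<or> Z = B)"

definition irreducible_chain :: "'a fspace \<Rightarrow> nat \<Rightarrow> (nat \<Rightarrow> 'a set) \<Rightarrow> bool" where
  "irreducible_chain X n Z \<longleftrightarrow>
     (\<forall>i\<le>n. irreducible_closed X (Z i)) \<and> (\<forall>i<n. Z i \<subset> Z (Suc i))"

definition krull_dim :: "'a fspace \<Rightarrow> enat" where
  "krull_dim X = Sup {enat n | n Z. irreducible_chain X n Z}"

definition codimension :: "'a fspace \<Rightarrow> 'a set \<Rightarrow> enat" where
  "codimension X V = Sup {enat n | n Z. irreducible_chain X n Z \<and> Z 0 = V}"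

definition projective_variety :: "'a fspace \<Rightarrow> bool" where
  "projective_variety X \<longleftrightarrow>
     irreducible_closed X (pts X) \<and> (\<exists>N \<phi>. closed_immersion X (proj_space N) \<phi>)"

text \<open>The dimension as a natural number; projective varieties have finite Krull dimension.\<close>

definition var_dim :: "'a fspace \<Rightarrow> nat" where
  "var_dim X = the_enat (krull_dim X)"


section \<open>Finite morphisms\<close>

definition affine_fspace :: "'a fspace \<Rightarrow> bool" where
  "affine_fspace X \<longleftrightarrow> (\<exists>n \<phi>. closed_immersion X (affine_space n) \<phi>)"

definition finite_morphism :: "'a fspace \<Rightarrow> 'b fspace \<Rightarrow> ('a \<Rightarrow> 'b) \<Rightarrow> bool" where
  "finite_morphism X Y \<phi> \<longleftrightarrow> morphism X Y \<phi> \<and>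
     (\<forall>y\<in>pts Y. \<exists>V. openin (zar Y) V \<and> y \<in> V \<and>
        affine_fspace (subspace_of Y V) \<and> affine_fspace (subspace_of X (preim X \<phi> V)) \<and>
        (\<exists>B. finite B \<and> (\<forall>b\<in>B. reg X (preim X \<phi> V) b) \<and>
           (\<forall>f. reg X (preim X \<phi> V) f \<longrightarrow>
              (\<exists>c. (\<forall>b\<in>B. reg Y V (c b)) \<and>
                   (\<forall>x\<in>preim X \<phi> V. f x = (\<Sum>b\<in>B. c b (\<phi> x) * b x))))))"

definition finite_surjective_endo :: "'a fspace \<Rightarrow> ('a \<Rightarrow> 'a) \<Rightarrow> bool" where
  "finite_surjective_endo X f \<longleftrightarrow> finite_morphism X X f \<and> f ` pts X = pts X"


section \<open>Cartier divisors and polarized endomorphisms\<close>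

text \<open>
  A rational function on an irreducible \<^term>\<open>X\<close> is given by a nonempty open set and a regular
  function on it; it is nonzero in the function field iff this function is not identically zero.
\<close>

type_synonym 'a ratfun = "'a set \<times> ('a \<Rightarrow> complex)"

definition nonzero_rational :: "'a fspace \<Rightarrow> 'a ratfun \<Rightarrow> bool" where
  "nonzero_rational X r \<longleftrightarrow>
     openin (zar X) (fst r) \<and> reg X (fst r) (snd r) \<and> (\<exists>p\<in>fst r. snd r p \<noteq> 0)"

definition rat_mult :: "'a ratfun \<Rightarrow> 'a ratfun \<Rightarrow> 'a ratfun" where
  "rat_mult r s = (fst r \<inter> fst s, \<lambda>p. snd r p * snd s p)"

definition rat_power :: "'a ratfun \<Rightarrow> nat \<Rightarrow> 'a ratfun" where
  "rat_power r m = (fst r, \<lambda>p. snd r p ^ m)"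

text \<open>The quotient of \<^term>\<open>r\<close> by \<^term>\<open>s\<close> is an invertible regular function on \<^term>\<open>U\<close>.\<close>

definition unit_ratio :: "'a fspace \<Rightarrow> 'a set \<Rightarrow> 'a ratfun \<Rightarrow> 'a ratfun \<Rightarrow> bool" where
  "unit_ratio X U r s \<longleftrightarrow>
     (\<exists>u. reg X U u \<and> (\<forall>p\<in>U. u p \<noteq> 0) \<and>
          (\<forall>p\<in>U \<inter> fst r \<inter> fst s. snd r p = u p * snd s p))"

text \<open>Cartier divisors are given by systems of pairs of an open set and a local equation on it.\<close>

type_synonym 'a cartier_data = "('a set \<times> 'a ratfun) set"

definition cartier_divisor :: "'a fspace \<Rightarrow> 'a cartier_data \<Rightarrow> bool" where
  "cartier_divisor X D \<longleftrightarrow>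
     (\<forall>(U, r)\<in>D. openin (zar X) U \<and> nonzero_rational X r) \<and>
     (\<Union>(U, r)\<in>D. U) = pts X \<and>
     (\<forall>(U, r)\<in>D. \<forall>(V, s)\<in>D. unit_ratio X (U \<inter> V) r s)"

definition div_multiple :: "nat \<Rightarrow> 'a cartier_data \<Rightarrow> 'a cartier_data" where
  "div_multiple m D = (\<lambda>(U, r). (U, rat_power r m)) ` D"

definition linearly_equivalent ::
    "'a fspace \<Rightarrow> 'a cartier_data \<Rightarrow> 'a cartier_data \<Rightarrow> bool" where
  "linearly_equivalent X D E \<longleftrightarrow>
     (\<exists>t. nonzero_rational X t \<and>
        (\<forall>(U, r)\<in>D. \<forall>(V, s)\<in>E. unit_ratio X (U \<inter> V) (rat_mult t r) s))"

text \<open>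
  The pullback of a Cartier divisor is defined when no local equation pulls back to zero, for
  instance along a surjective morphism.
\<close>

definition div_pullback :: "'a fspace \<Rightarrow> ('a \<Rightarrow> 'b) \<Rightarrow> 'b cartier_data \<Rightarrow> 'a cartier_data" where
  "div_pullback X \<phi> D =
     (\<lambda>(U, r). (preim X \<phi> U, (preim X \<phi> (fst r), snd r \<circ> \<phi>))) ` D"

text \<open>
  The hyperplane \<open>L = 0\<close>, with local equation \<open>L / x_j\<close> on the chart where \<open>x_j\<close> does not vanish.
\<close>

definition coord_chart :: "nat \<Rightarrow> nat \<Rightarrow> ppoint set" where
  "coord_chart N j = principal_open (proj_points N) (\<lambda>p. p) (\<lambda>x. x j)"

definition hyperplane :: "nat \<Rightarrow> (cvec \<Rightarrow> complex) \<Rightarrow> ppoint cartier_data" where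
  "hyperplane N L =
     {(coord_chart N j, (coord_chart N j, \<lambda>p. let x = (SOME x. x \<in> p) in L x / x j)) | j. j \<le> N}"

text \<open>
  \<^term>\<open>D\<close> is very ample if the associated line bundle is the pullback of the twisting sheaf along
  a closed immersion into projective space, i.e. if \<^term>\<open>D\<close> is linearly equivalent to the
  pullback of a hyperplane not containing the image. A chart that misses the image contributes
  the empty open set, on which \<^const>\<open>unit_ratio\<close> is vacuous.
\<close>

definition very_ample :: "'a fspace \<Rightarrow> 'a cartier_data \<Rightarrow> bool" where
  "very_ample X D \<longleftrightarrow>
     (\<exists>N \<phi> L. closed_immersion X (proj_space N) \<phi> \<and> L \<in> forms (N + 1) 1 \<and>
        (\<exists>p\<in>pts X. \<forall>x\<in>\<phi> p. L x \<noteq> 0) \<and>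
        linearly_equivalent X D (div_pullback X \<phi> (hyperplane N L)))"

definition ample :: "'a fspace \<Rightarrow> 'a cartier_data \<Rightarrow> bool" where
  "ample X D \<longleftrightarrow> (\<exists>m\<ge>1. very_ample X (div_multiple m D))"

text \<open>
  Surjectivity holds automatically for polarized endomorphisms of projective varieties; it is
  demanded here so that \<^const>\<open>div_pullback\<close> is legitimate for every Cartier divisor.
\<close>

definition polarized_endo :: "'a fspace \<Rightarrow> ('a \<Rightarrow> 'a) \<Rightarrow> bool" where
  "polarized_endo X g \<longleftrightarrow> morphism X X g \<and> g ` pts X = pts X \<and>
     (\<exists>H q. cartier_divisor X H \<and> ample X H \<and> q > 1 \<and>
        linearly_equivalent X (div_pullback X g H) (div_multiple q H))"


section \<open>The totally-periodic polynomial\<close>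

definition totally_periodic :: "'a fspace \<Rightarrow> ('a \<Rightarrow> 'a) \<Rightarrow> 'a set \<Rightarrow> bool" where
  "totally_periodic X f V \<longleftrightarrow> (\<exists>b\<ge>1. preim X (f ^^ b) V = V)"

definition tot_per_set :: "'a fspace \<Rightarrow> ('a \<Rightarrow> 'a) \<Rightarrow> nat \<Rightarrow> 'a set set" where
  "tot_per_set X f r =
     {V. irreducible_closed X V \<and> codimension X V = enat r \<and> totally_periodic X f V}"

text \<open>The standing assumptions under which the totally-periodic polynomial is defined.\<close>

definition has_tot_per_poly :: "'a fspace \<Rightarrow> ('a \<Rightarrow> 'a) \<Rightarrow> bool" where
  "has_tot_per_poly X f \<longleftrightarrow> projective_variety X \<and> finite_surjective_endo X f \<and>
     (\<forall>r\<in>{1..var_dim X}. finite (tot_per_set X f r))"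

definition tot_per_poly :: "'a fspace \<Rightarrow> ('a \<Rightarrow> 'a) \<Rightarrow> int poly" where
  "tot_per_poly X f =
     1 + (\<Sum>r = 1..var_dim X. monom (int (card (tot_per_set X f r))) r)
       + monom 1 (var_dim X + 1)"

end

theory Submission
  imports Defs "HOL-Computational_Algebra.Polynomial_Factorial"
    "HOL-Computational_Algebra.Field_as_Ring" "HOL-Computational_Algebra.Fundamental_Theorem_Algebra"
begin

text \<open>
  The plane endomorphism \<open>(x0, x1, x2) \<mapsto> (x0^2, x1^2, x2^2 + x0^2)\<close> has the point \<open>[0:0:1]\<close> as its own full
  preimage, so it lifts to an endomorphism \<open>gF1\<close> of the blow-up, with \<open>[y0:y1] \<mapsto> [y0^2:y1^2]\<close> on the base.
  In Cox coordinates, where \<open>x = (a h, b h, s)\<close> and \<open>y = (a, b)\<close>, it is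
  \<open>(a, b, h, s) \<mapsto> (a^2, b^2, h^2, s^2 + a^2 h^2)\<close>. Three curves are their own preimages: the exceptional curve
  \<open>h = 0\<close> and the fibres \<open>a = 0\<close> and \<open>b = 0\<close>. The points in which these curves meet are two totally invariant
  points, and the point \<open>a = s = 0\<close> is a third one, because \<open>gF1\<close> is squaring on the fibre \<open>a = 0\<close>. On the
  fibre \<open>b = 0\<close> it is \<open>z \<mapsto> z^2 + 1\<close>, which has no totally periodic point besides infinity. The three curves and
  three points account for \<open>(1 + t)^3\<close>.
  
  There are no others, because a totally periodic set is stable under the symmetries of all iterates
  (\<open>totally_periodic_saturated\<close>). Multiplying \<open>b\<close> by roots of unity of 2-power order spreads a point out
  densely over a section \<open>s = c a h\<close> (\<open>saturated_contains_section\<close>), so a further totally periodic curve would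
  be such a section; the symmetry \<open>s \<mapsto> - s\<close> forces \<open>c = 0\<close>, and the orbit of 0 under \<open>z \<mapsto> z^2 + 1\<close> does not
  return (\<open>section_not_periodic\<close>). Points are treated in the same way (\<open>tot_per_points\<close>). These arguments
  rest on the surface having dimension two (\<open>chain_le_2\<close>): a longer chain of irreducible closed
  sets would yield three algebraically independent functions of two variables.
  
  The endomorphism is finite since it is \<open>(u, v) \<mapsto> (u^2, v^2)\<close> between suitable affine planes
  (\<open>preim_chart\<close>, \<open>gF1_finite\<close>); that regular functions on these are polynomials comes from
  unique factorization (\<open>regular_affine_plane\<close>). It is polarized by the hyperplane class of the Segre embedding,
  which it pulls back to its double (\<open>gF1_pullback\<close>).
  
  Finally the surface is not the plane (\<open>F1_not_plane\<close>): otherwise its ruling would be given by two plane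
  forms of degree \<open>d\<close> without common zero, and composing with the exceptional curve, which is a section of
  the ruling, shows \<open>d = 1\<close>. Two lines in the plane meet, however.
\<close>

section \<open>Polynomial functions\<close>

lemma gen_algebra_uminus: "F \<in> gen_algebra B \<Longrightarrow> (\<lambda>v. - F v) \<in> gen_algebra B"
  using gen_algebra.mult[OF gen_algebra.const[of "-1"]] by fastforce

lemma gen_algebra_diff:
  "F \<in> gen_algebra B \<Longrightarrow> G \<in> gen_algebra B \<Longrightarrow> (\<lambda>v. F v - G v) \<in> gen_algebra B"
  using gen_algebra.add[OF _ gen_algebra_uminus] by fastforce

lemma gen_algebra_power: "F \<in> gen_algebra B \<Longrightarrow> (\<lambda>v. F v ^ n) \<in> gen_algebra B"
proof (induction n)
  case 0 then show ?case using gen_algebra.const[of 1] by simp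
next
  case (Suc n) then show ?case using gen_algebra.mult[of F B "\<lambda>v. F v ^ n"] by simp
qed

lemma gen_algebra_sum:
  "(\<And>i. i \<in> I \<Longrightarrow> F i \<in> gen_algebra B) \<Longrightarrow> (\<lambda>v. \<Sum>i\<in>I. F i v) \<in> gen_algebra B"
proof (induction I rule: infinite_finite_induct)
  case (insert i I)
  then show ?case using gen_algebra.add[of "F i" B "\<lambda>v. \<Sum>i\<in>I. F i v"] by simp
qed (use gen_algebra.const[of 0] in simp_all)

lemma gen_algebra_comp:
  assumes "F \<in> gen_algebra B" "\<And>b. b \<in> B \<Longrightarrow> (\<lambda>w. b (\<Phi> w)) \<in> gen_algebra B'"
  shows "(\<lambda>w. F (\<Phi> w)) \<in> gen_algebra B'"
  using assms(1)
proof induction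
  case (const c) then show ?case by (rule gen_algebra.const)
next
  case (gen b) then show ?case using assms(2) by blast
next
  case (add F G) then show ?case using gen_algebra.add by blast
next
  case (mult F G) then show ?case using gen_algebra.mult by blast
qed

lemma gen_algebra_cong:
  assumes "F \<in> gen_algebra B" "\<And>b. b \<in> B \<Longrightarrow> b x = b y"
  shows "F x = F y"
  using assms(1) by induction (use assms(2) in auto)

lemma gen_algebra_mono: "B \<subseteq> B' \<Longrightarrow> F \<in> gen_algebra B \<Longrightarrow> F \<in> gen_algebra B'"
  by (rule gen_algebra_comp[where \<Phi> = "\<lambda>w. w" and B = B]) (auto intro: gen_algebra.gen)

text \<open>Restricting to polynomial curves reduces several variables to one.\<close>

lemma gen_algebra_curve:
  assumes "F \<in> gen_algebra B" "\<And>b. b \<in> B \<Longrightarrow> \<exists>p::complex poly. \<forall>t. b (\<gamma> t) = poly p t"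
  shows "\<exists>p::complex poly. \<forall>t. F (\<gamma> t) = poly p t"
  using assms(1)
proof induction
  case (const c) then show ?case by (intro exI[of _ "[:c:]"]) simp
next
  case (gen b) then show ?case using assms(2) by blast
next
  case (add F G) then show ?case by (metis poly_add)
next
  case (mult F G) then show ?case by (metis poly_mult)
qed

lemma polys_const [simp]: "(\<lambda>x. c) \<in> polys n"
  unfolding polys_def by (rule gen_algebra.const)

lemma polys_var: "i < n \<Longrightarrow> (\<lambda>x. x i) \<in> polys n"
  unfolding polys_def by (rule gen_algebra.gen) auto

lemma polys_add: "F \<in> polys n \<Longrightarrow> G \<in> polys n \<Longrightarrow> (\<lambda>x. F x + G x) \<in> polys n"
  unfolding polys_def by (rule gen_algebra.add)

lemma polys_mult: "F \<in> polys n \<Longrightarrow> G \<in> polys n \<Longrightarrow> (\<lambda>x. F x * G x) \<in> polys n"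
  unfolding polys_def by (rule gen_algebra.mult)

lemma polys_diff: "F \<in> polys n \<Longrightarrow> G \<in> polys n \<Longrightarrow> (\<lambda>x. F x - G x) \<in> polys n"
  unfolding polys_def by (rule gen_algebra_diff)

lemma polys_power: "F \<in> polys n \<Longrightarrow> (\<lambda>x. F x ^ k) \<in> polys n"
  unfolding polys_def by (rule gen_algebra_power)

lemma polys_sum: "(\<And>i. i \<in> I \<Longrightarrow> F i \<in> polys n) \<Longrightarrow> (\<lambda>x. \<Sum>i\<in>I. F i x) \<in> polys n"
  unfolding polys_def by (rule gen_algebra_sum)

lemmas polys_intros = polys_const polys_var polys_add polys_mult polys_diff polys_power polys_sum

lemma polys_comp:
  assumes "F \<in> polys m" "\<And>i. i < m \<Longrightarrow> (\<lambda>w. \<Phi> w i) \<in> polys n"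
  shows "(\<lambda>w. F (\<Phi> w)) \<in> polys n"
  unfolding polys_def
  by (rule gen_algebra_comp[OF assms(1)[unfolded polys_def]]) (use assms(2) in \<open>auto simp: polys_def\<close>)

lemma polys_cong: "F \<in> polys n \<Longrightarrow> (\<And>i. i < n \<Longrightarrow> x i = y i) \<Longrightarrow> F x = F y"
  unfolding polys_def by (erule gen_algebra_cong) auto

lemma polys_mono: "m \<le> n \<Longrightarrow> F \<in> polys m \<Longrightarrow> F \<in> polys n"
  unfolding polys_def by (erule gen_algebra_mono[rotated]) auto

lemma polys_line:
  assumes "F \<in> polys n"
  shows "\<exists>p::complex poly. \<forall>t. F (\<lambda>i. x i + t * y i) = poly p t"
proof (rule gen_algebra_curve[OF assms[unfolded polys_def]])
  fix b :: "cvec \<Rightarrow> complex" assume "b \<in> {\<lambda>x. x i |i. i < n}"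
  then obtain i where b: "b = (\<lambda>x. x i)" by auto
  show "\<exists>p::complex poly. \<forall>t. b (\<lambda>i. x i + t * y i) = poly p t"
    unfolding b by (intro exI[of _ "[:x i, y i:]"]) (simp add: algebra_simps)
qed

text \<open>
  On the line through a point where \<open>F\<close> does not vanish and a point where \<open>G\<close> does not vanish, both
  restrict to nonzero polynomials in one variable.
\<close>

lemma polys_integral:
  assumes F: "F \<in> polys n" and G: "G \<in> polys n" and 0: "\<And>x. F x * G x = 0"
  shows "(\<forall>x. F x = 0) \<or> (\<forall>x. G x = 0)"
proof (rule ccontr)
  assume "\<not> ?thesis"
  then obtain x y where xy: "F x \<noteq> 0" "G y \<noteq> 0" by auto
  obtain p where p: "\<And>t. F (\<lambda>i. x i + t * (y i - x i)) = poly p t"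
    using polys_line[OF F, of x "\<lambda>i. y i - x i"] by blast
  obtain q where q: "\<And>t. G (\<lambda>i. x i + t * (y i - x i)) = poly q t"
    using polys_line[OF G, of x "\<lambda>i. y i - x i"] by blast
  have "poly (p * q) t = 0" for t
    using 0[of "\<lambda>i. x i + t * (y i - x i)"] by (simp add: p q)
  then have "p * q = 0" using poly_all_0_iff_0 by blast
  moreover have "poly p 0 = F x" "poly q 1 = G y" by (simp_all flip: p q)
  ultimately show False using xy by auto
qed

lemma polys_cancel:
  assumes "F \<in> polys n" "G \<in> polys n" "G' \<in> polys n" "\<And>x. F x * G x = F x * G' x" "F x0 \<noteq> 0"
  shows "G x = G' x"
  using polys_integral[OF assms(1) polys_diff[OF assms(2,3)]] assms(4,5) by (auto simp: algebra_simps)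

text \<open>
  By the fundamental theorem of algebra on the line through the two points.
\<close>

lemma polys_nowhere_zero_const:
  assumes F: "F \<in> polys n" and S: "\<And>x y t. x \<in> S \<Longrightarrow> y \<in> S \<Longrightarrow> (\<lambda>i. x i + t * (y i - x i)) \<in> S"
    and nz: "\<And>x. x \<in> S \<Longrightarrow> F x \<noteq> 0" and xy: "x \<in> S" "y \<in> S"
  shows "F x = F y"
proof -
  obtain p where p: "\<And>t. F (\<lambda>i. x i + t * (y i - x i)) = poly p t"
    using polys_line[OF F, of x "\<lambda>i. y i - x i"] by blast
  have "poly p t \<noteq> 0" for t using nz[OF S[OF xy]] by (simp add: p)
  then have "constant (poly p)" using fundamental_theorem_of_algebra by blast
  then have "poly p 0 = poly p 1" unfolding constant_def by blast
  then show ?thesis using p[of 0] p[of 1] by simp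
qed

text \<open>
  The iterated polynomial ring is factorial; evaluation identifies it with the polynomial functions
  in three variables.
\<close>

definition ev3 :: "complex poly poly poly \<Rightarrow> cvec \<Rightarrow> complex" where
  "ev3 p x = poly (poly (poly p [:[:x 2:]:]) [:x 1:]) (x 0)"

lemma ev3_add [simp]: "ev3 (p + q) x = ev3 p x + ev3 q x"
  and ev3_diff [simp]: "ev3 (p - q) x = ev3 p x - ev3 q x"
  and ev3_mult [simp]: "ev3 (p * q) x = ev3 p x * ev3 q x"
  and ev3_0 [simp]: "ev3 0 x = 0"
  by (simp_all add: ev3_def)

lemma polys3_imp_ev3: "F \<in> polys 3 \<Longrightarrow> \<exists>p. F = ev3 p"
  unfolding polys_def
proof (induction rule: gen_algebra.induct)
  case (const c)
  then show ?case by (intro exI[of _ "[:[:[:c:]:]:]"]) (simp add: ev3_def fun_eq_iff)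
next
  case (gen b)
  then obtain i where "i < 3" and b: "b = (\<lambda>x. x i)" by auto
  then consider "i = 0" | "i = 1" | "i = 2" by linarith
  then show ?case unfolding b
  proof cases
    case 1 then show "\<exists>p. (\<lambda>x. x i) = ev3 p"
      by (intro exI[of _ "[:[:[:0,1:]:]:]"]) (simp add: ev3_def fun_eq_iff)
  next
    case 2 then show "\<exists>p. (\<lambda>x. x i) = ev3 p"
      by (intro exI[of _ "[:[:0,1:]:]"]) (simp add: ev3_def fun_eq_iff)
  next
    case 3 then show "\<exists>p. (\<lambda>x. x i) = ev3 p"
      by (intro exI[of _ "[:0,1:]"]) (simp add: ev3_def fun_eq_iff)
  qed
next
  case (add F G)
  then obtain p q where "F = ev3 p" "G = ev3 q" by blast
  then have "(\<lambda>v. F v + G v) = ev3 (p + q)" by (simp add: fun_eq_iff)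
  then show ?case by blast
next
  case (mult F G)
  then obtain p q where "F = ev3 p" "G = ev3 q" by blast
  then have "(\<lambda>v. F v * G v) = ev3 (p * q)" by (simp add: fun_eq_iff)
  then show ?case by blast
qed

lemma ev3_polys: "ev3 p \<in> polys 3"
proof -
  have 1: "(\<lambda>x. poly a (x 0)) \<in> polys 3" for a :: "complex poly"
    by (induction a) (auto intro!: polys_intros)
  have 2: "(\<lambda>x. poly (poly a [:x 1:]) (x 0)) \<in> polys 3" for a :: "complex poly poly"
    by (induction a) (auto intro!: polys_intros 1 simp del: One_nat_def)
  have "(\<lambda>x. poly (poly (poly p [:[:x 2:]:]) [:x 1:]) (x 0)) \<in> polys 3"
    by (induction p) (auto intro!: polys_intros 2 simp del: One_nat_def)
  then show ?thesis by (simp add: ev3_def[abs_def])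
qed

lemma poly_eq_0_of_const_roots:
  fixes p :: "'a::idom poly"
  assumes "inj c" "\<And>t::complex. poly p (c t) = 0"
  shows "p = 0"
proof (rule ccontr)
  assume "p \<noteq> 0"
  then have "finite {x. poly p x = 0}" by (rule poly_roots_finite)
  then have "finite (range c)" by (rule rev_finite_subset) (use assms(2) in auto)
  then have "finite (UNIV :: complex set)" using assms(1) finite_imageD by blast
  then show False using infinite_UNIV_char_0 by blast
qed

lemma ev3_inj:
  assumes "\<And>x. ev3 p x = 0" shows "p = 0"
proof -
  have "poly (poly (poly p [:[:c:]:]) [:b:]) a = 0" for a b c
    using assms[of "\<lambda>i. if i = 0 then a else if i = 1 then b else c"] by (simp add: ev3_def)
  then have "poly (poly p [:[:c:]:]) [:b:] = 0" for b c using poly_all_0_iff_0 by blast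
  then have "poly p [:[:c:]:] = 0" for c
    by (intro poly_eq_0_of_const_roots[of "\<lambda>b. [:b:]"]) (auto simp: inj_def)
  then show ?thesis
    by (intro poly_eq_0_of_const_roots[of "\<lambda>b. [:[:b:]:]"]) (auto simp: inj_def)
qed

text \<open>
  The fraction \<open>F / G\<close> is in lowest terms. What is recorded is the consequence of coprimality that
  serves below: any other representation \<open>B / A\<close> of the fraction arises from \<open>F / G\<close> by multiplying
  numerator and denominator with some \<open>C\<close>.
\<close>

definition lowest_terms :: "(cvec \<Rightarrow> complex) \<Rightarrow> (cvec \<Rightarrow> complex) \<Rightarrow> bool" where
  "lowest_terms F G \<longleftrightarrow> F \<in> polys 3 \<and> G \<in> polys 3 \<and>
     (\<forall>A\<in>polys 3. \<forall>B\<in>polys 3. (\<forall>x. F x * A x = G x * B x) \<longrightarrow>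
        (\<exists>C\<in>polys 3. \<forall>x. A x = G x * C x \<and> B x = F x * C x))"

lemma polys3_cofactors:
  assumes F: "F \<in> polys 3" and G: "G \<in> polys 3" and nz: "\<exists>x. F x \<noteq> 0 \<or> G x \<noteq> 0"
  shows "\<exists>D\<in>polys 3. \<exists>F' G'. lowest_terms F' G' \<and> (\<forall>x. F x = D x * F' x) \<and> (\<forall>x. G x = D x * G' x)"
proof -
  obtain f g where f: "F = ev3 f" and g: "G = ev3 g" using polys3_imp_ev3 F G by meson
  have "f \<noteq> 0 \<or> g \<noteq> 0" using nz unfolding f g by auto
  then obtain f' g' where fg: "f = f' * gcd f g" "g = g' * gcd f g" "coprime f' g'"
    using gcd_coprime_exists by (metis gcd_eq_0_iff)
  have "\<exists>C\<in>polys 3. \<forall>x. A x = ev3 g' x * C x \<and> B x = ev3 f' x * C x"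
    if AB: "A \<in> polys 3" "B \<in> polys 3" "\<forall>x. ev3 f' x * A x = ev3 g' x * B x" for A B
  proof -
    obtain a b where a: "A = ev3 a" and b: "B = ev3 b" using polys3_imp_ev3 AB(1,2) by meson
    have eq: "f' * a = g' * b"
    proof -
      have "f' * a - g' * b = 0"
      proof (rule ev3_inj)
        show "ev3 (f' * a - g' * b) x = 0" for x using AB(3) by (simp add: a b)
      qed
      then show ?thesis by simp
    qed
    then have "g' dvd f' * a" by simp
    then have "g' dvd a" using fg(3) by (simp add: coprime_commute coprime_dvd_mult_right_iff)
    then obtain c where c: "a = g' * c" by auto
    show ?thesis
    proof (cases "g' = 0")
      case True
      then have "is_unit f'" using fg(3) by simp
      then obtain u where u: "f' * u = 1" by (metis dvd_def)
      have "a = 0" using eq True u by auto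
      have "b = f' * (u * b)" using u by (simp flip: mult.assoc)
      then have "ev3 b x = ev3 f' x * ev3 (u * b) x" for x by (metis ev3_mult)
      then show ?thesis
        by (intro bexI[of _ "ev3 (u * b)"]) (auto simp: a b True \<open>a = 0\<close> ev3_polys simp del: ev3_mult)
    next
      case False
      then have "b = f' * c" using eq c by (simp add: algebra_simps)
      then show ?thesis by (intro bexI[of _ "ev3 c"]) (auto simp: a b c ev3_polys)
    qed
  qed
  then have "lowest_terms (ev3 f') (ev3 g')" unfolding lowest_terms_def using ev3_polys by blast
  moreover have "F x = ev3 (gcd f g) x * ev3 f' x" "G x = ev3 (gcd f g) x * ev3 g' x" for x
    unfolding f g by (metis fg(1) ev3_mult mult.commute, metis fg(2) ev3_mult mult.commute)
  ultimately show ?thesis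
    by (intro bexI[of _ "ev3 (gcd f g)"] exI[of _ "ev3 f'"] exI[of _ "ev3 g'"] conjI allI ev3_polys)
qed

lemma formsD: "F \<in> forms n d \<Longrightarrow> F \<in> polys n" "F \<in> forms n d \<Longrightarrow> F (\<lambda>i. c * x i) = c ^ d * F x"
  by (auto simp: forms_def)

text \<open>
  The order of vanishing at 0 is at most the degree. Both are additive and they agree on the product,
  so they agree on each factor.
\<close>

lemma monom_factor:
  fixes p q :: "'a::idom poly"
  assumes pq: "p * q = monom a d" and a: "a \<noteq> 0"
  shows "\<exists>k\<le>d. p = monom (lead_coeff p) k"
proof -
  have nz: "p \<noteq> 0" "q \<noteq> 0" using pq a by auto
  have m: "monom a d = smult a ([:0, 1:] ^ d)" by (simp add: monom_altdef)
  have "order 0 (p * q) = d" using a by (simp add: pq m order_smult order_power_n_n[of 0, simplified])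
  then have o: "order 0 p + order 0 q = d" using nz by (subst (asm) order_mult) auto
  have "degree p + degree q = d" using degree_mult_eq[OF nz] a by (simp add: pq degree_monom_eq)
  then have d: "order 0 p = degree p" using o order_degree[OF nz(1), of 0] order_degree[OF nz(2), of 0]
    by linarith
  obtain r where r: "p = [:0, 1:] ^ degree p * r" using order_1[of 0 p] d by auto
  then have "r \<noteq> 0" using nz by auto
  then have "degree r = 0" using arg_cong[OF r, of degree] by (simp add: degree_mult_eq degree_power_eq)
  then obtain c where "r = [:c:]" by (rule degree_eq_zeroE)
  then have p: "p = monom c (degree p)" using r by (simp add: monom_altdef mult.commute)
  then have "lead_coeff p = c" by (metis coeff_monom)
  then show ?thesis using p \<open>degree p + degree q = d\<close> by (intro exI[of _ "degree p"]) auto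
qed

text \<open>
  On a line through the origin both factors are monomials, of degrees that might depend on the
  line; dilation by 2 has only finitely many eigenvalues, so by irreducibility one degree serves
  all lines.
\<close>

lemma form_factor:
  assumes F: "F \<in> polys n" and G: "G \<in> polys n" and FG: "(\<lambda>x. F x * G x) \<in> forms n d"
    and nz: "F z * G z \<noteq> 0"
  shows "\<exists>k. F \<in> forms n k"
proof -
  have mono: "\<exists>k\<le>d. F (\<lambda>i. 2 * x i) = 2 ^ k * F x" if "F x * G x \<noteq> 0" for x
  proof -
    obtain p where p: "\<And>t. F (\<lambda>i. 0 + t * x i) = poly p t"
      using polys_line[OF F, of "\<lambda>_. 0" x] by blast
    obtain q where q: "\<And>t. G (\<lambda>i. 0 + t * x i) = poly q t"
      using polys_line[OF G, of "\<lambda>_. 0" x] by blast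
    have "poly (p * q) t = poly (monom (F x * G x) d) t" for t
      using formsD(2)[OF FG, of t x] by (simp add: poly_monom algebra_simps flip: p q)
    then have pq: "p * q = monom (F x * G x) d" by (simp add: poly_eq_poly_eq_iff[symmetric] fun_eq_iff)
    have nz2: "F x * G x \<noteq> 0" using that .
    obtain k where k: "k \<le> d" "p = monom (lead_coeff p) k" using monom_factor[OF pq nz2] by blast
    have "poly p t = lead_coeff p * t ^ k" for t by (subst k(2)) (simp add: poly_monom)
    then have "F (\<lambda>i. 2 * x i) = 2 ^ k * F x" using p[of 1] p[of 2] by simp
    then show ?thesis using k(1) by blast
  qed
  let ?E = "\<lambda>k x. F (\<lambda>i. 2 * x i) - 2 ^ k * F x"
  have E: "?E k \<in> polys n" for k
    by (intro polys_intros F polys_comp[OF F, where \<Phi> = "\<lambda>x i. 2 * x i"])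
  have fin: "\<exists>k\<in>K. \<forall>x. ?E k x = 0" if "finite K" "\<And>x. F x * G x * (\<Prod>k\<in>K. ?E k x) = 0" for K
    using that
  proof (induction K)
    case empty then show ?case using nz by simp
  next
    case (insert k K)
    have P: "(\<lambda>x. \<Prod>k\<in>K. ?E k x) \<in> polys n" for K
      by (induction K rule: infinite_finite_induct) (auto intro!: polys_intros(1) polys_mult E)
    have "?E k x * (F x * G x * (\<Prod>k\<in>K. ?E k x)) = 0" for x
      using insert.prems[of x] insert.hyps by auto
    then have "(\<forall>x. ?E k x = 0) \<or> (\<forall>x. F x * G x * (\<Prod>k\<in>K. ?E k x) = 0)"
      by (intro polys_integral[of _ n] polys_mult F G E P)
    then show ?case using insert by blast
  qed
  have zero: "F x * G x * (\<Prod>k\<in>{..d}. ?E k x) = 0" for x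
  proof (cases "F x * G x = 0")
    case False
    then have "\<exists>k\<in>{..d}. ?E k x = 0" using mono[of x] by auto
    then have "(\<Prod>k\<in>{..d}. ?E k x) = 0" by (intro prod_zero) auto
    then show ?thesis by simp
  qed simp
  from fin[OF finite_atMost zero] obtain k where k: "\<And>x. F (\<lambda>i. 2 * x i) = 2 ^ k * F x" by auto
  have pow: "F (\<lambda>i. 2 ^ m * x i) = (2 ^ m) ^ k * F x" for m x
  proof (induction m)
    case (Suc m)
    show ?case using k[of "\<lambda>i. 2 ^ m * x i"] Suc by (simp add: mult.assoc power_mult_distrib)
  qed simp
  have "F (\<lambda>i. c * x i) = c ^ k * F x" for c x
  proof -
    obtain p where p: "\<And>t. F (\<lambda>i. 0 + t * x i) = poly p t"
      using polys_line[OF F, of "\<lambda>_. 0" x] by blast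
    have "p - monom (F x) k = 0"
    proof (rule ccontr)
      assume "p - monom (F x) k \<noteq> 0"
      then have "finite {t. poly (p - monom (F x) k) t = 0}" by (rule poly_roots_finite)
      moreover have "range (\<lambda>m::nat. 2 ^ m) \<subseteq> {t. poly (p - monom (F x) k) t = 0}"
        using pow by (auto simp: poly_monom mult.commute simp flip: p)
      moreover have "inj (\<lambda>m::nat. 2 ^ m :: complex)"
        by (rule injI) (metis norm_power norm_numeral power_inject_exp one_less_numeral_iff semiring_norm(76))
      ultimately show False using finite_subset range_inj_infinite by blast
    qed
    then have "p = monom (F x) k" by simp
    then show ?thesis using p[of c] by (simp add: poly_monom mult.commute)
  qed
  then show ?thesis using F by (auto simp: forms_def)
qed

section \<open>Spaces with homogeneous coordinates\<close>

text \<open>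
  Regularity in terms of coordinate vectors only. It makes sense on arbitrary subsets of the space, so
  one notion serves open sets of the space, of closed subspaces, and of open subsets of these.
\<close>

definition regular_on ::
    "'a set \<Rightarrow> ('a \<Rightarrow> 'v set) \<Rightarrow> ('v \<Rightarrow> complex) set set \<Rightarrow> 'a set \<Rightarrow> ('a \<Rightarrow> complex) \<Rightarrow> bool" where
  "regular_on P crd HH U f \<longleftrightarrow>
     (\<forall>p\<in>U. \<exists>H\<in>HH. \<exists>F\<in>H. \<exists>G\<in>H. \<exists>K\<in>\<Union>HH. p \<in> principal_open P crd K \<and>
        (\<forall>q\<in>U \<inter> principal_open P crd K. \<forall>v\<in>crd q. G v \<noteq> 0 \<and> f q = F v / G v))"

text \<open>
  All spaces that occur are of this kind: the class is closed under passing to subspaces.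
\<close>

definition zsub ::
    "'a set \<Rightarrow> ('a \<Rightarrow> 'v set) \<Rightarrow> ('v \<Rightarrow> complex) set set \<Rightarrow> 'a fspace \<Rightarrow> 'a set \<Rightarrow> bool" where
  "zsub P crd HH X S \<longleftrightarrow> S \<subseteq> P \<and> zar X = subtopology (zariski_topology P crd HH) S \<and>
     (\<forall>U f. openin (zar X) U \<longrightarrow> reg X U f = regular_on P crd HH U f)"

text \<open>
  The properties that the coordinates of affine, projective and biprojective space have in common:
  vanishing and ratios are well defined, and the pieces are multiplicative.
\<close>

locale zcoord =
  fixes P :: "'a set" and crd :: "'a \<Rightarrow> 'v set" and HH :: "('v \<Rightarrow> complex) set set"
  assumes crd_nonempty: "p \<in> P \<Longrightarrow> crd p \<noteq> {}"
    and zero_indep: "H \<in> HH \<Longrightarrow> F \<in> H \<Longrightarrow> p \<in> P \<Longrightarrow> v \<in> crd p \<Longrightarrow> w \<in> crd p \<Longrightarrow> F v = 0 \<Longrightarrow> F w = 0"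
    and ratio_indep: "H \<in> HH \<Longrightarrow> F \<in> H \<Longrightarrow> G \<in> H \<Longrightarrow> p \<in> P \<Longrightarrow> v \<in> crd p \<Longrightarrow> w \<in> crd p \<Longrightarrow>
      F v * G w = F w * G v"
    and HH_mult: "H1 \<in> HH \<Longrightarrow> H2 \<in> HH \<Longrightarrow> \<exists>H\<in>HH. \<forall>F\<in>H1. \<forall>G\<in>H2. (\<lambda>v. F v * G v) \<in> H"
    and HH_one: "\<exists>H\<in>HH. (\<lambda>v. 1) \<in> H"
begin

abbreviation D :: "('v \<Rightarrow> complex) \<Rightarrow> 'a set" where "D F \<equiv> principal_open P crd F"
abbreviation Zar :: "'a topology" where "Zar \<equiv> zariski_topology P crd HH"

lemma D_iff: "F \<in> \<Union>HH \<Longrightarrow> p \<in> P \<Longrightarrow> v \<in> crd p \<Longrightarrow> p \<in> D F \<longleftrightarrow> F v \<noteq> 0"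
  unfolding principal_open_def using zero_indep[of _ F p _ v] by auto

lemma D_not: "F \<in> \<Union>HH \<Longrightarrow> p \<in> P \<Longrightarrow> p \<notin> D F \<longleftrightarrow> (\<forall>v\<in>crd p. F v = 0)"
  using D_iff[of F p] crd_nonempty[of p] by blast

lemma D_sub: "D F \<subseteq> P" by (auto simp: principal_open_def)

lemma mult_in: "F \<in> \<Union>HH \<Longrightarrow> G \<in> \<Union>HH \<Longrightarrow> (\<lambda>v. F v * G v) \<in> \<Union>HH"
  using HH_mult by blast

lemma D_mult: "D (\<lambda>v. F v * G v) = D F \<inter> D G"
  by (auto simp: principal_open_def)

lemma one_in: "(\<lambda>v. 1) \<in> \<Union>HH" using HH_one by blast

lemma D_one: "D (\<lambda>v. 1) = P" by (auto simp: principal_open_def)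

lemma openin_iff: "openin Zar U \<longleftrightarrow> U \<subseteq> P \<and> (\<forall>p\<in>U. \<exists>F\<in>\<Union>HH. p \<in> D F \<and> D F \<subseteq> U)"
proof
  assume "openin Zar U"
  then have "generate_topology_on {D F | F. F \<in> \<Union>HH} U"
    by (simp add: zariski_topology_def openin_topology_generated_by_iff)
  then show "U \<subseteq> P \<and> (\<forall>p\<in>U. \<exists>F\<in>\<Union>HH. p \<in> D F \<and> D F \<subseteq> U)"
  proof induction
    case (Int a b)
    have "\<exists>F\<in>\<Union>HH. p \<in> D F \<and> D F \<subseteq> a \<inter> b" if p: "p \<in> a \<inter> b" for p
    proof -
      obtain F where F: "F \<in> \<Union>HH" "p \<in> D F" "D F \<subseteq> a" using Int p by blast
      obtain G where G: "G \<in> \<Union>HH" "p \<in> D G" "D G \<subseteq> b" using Int p by blast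
      show ?thesis using F G D_mult[of F G] by (intro bexI[OF _ mult_in[OF F(1) G(1)]]) auto
    qed
    then show ?case using Int by blast
  next
    case (UN K) then show ?case by fast
  next
    case (Basis s) then show ?case using D_sub by fast
  qed simp
next
  assume U: "U \<subseteq> P \<and> (\<forall>p\<in>U. \<exists>F\<in>\<Union>HH. p \<in> D F \<and> D F \<subseteq> U)"
  then have "U = \<Union>{D F | F. F \<in> \<Union>HH \<and> D F \<subseteq> U}" by fast
  moreover have "openin Zar (D F)" if "F \<in> \<Union>HH" for F
    unfolding zariski_topology_def by (rule topology_generated_by_Basis) (use that in auto)
  then have "openin Zar (\<Union>{D F | F. F \<in> \<Union>HH \<and> D F \<subseteq> U})" by (intro openin_Union) auto
  ultimately show "openin Zar U" by simp
qed

lemma topspace_Zar [simp]: "topspace Zar = P"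
proof
  show "topspace Zar \<subseteq> P" using openin_iff openin_topspace by blast
  have "openin Zar P" unfolding openin_iff using one_in D_one by blast
  then show "P \<subseteq> topspace Zar" by (rule openin_subset)
qed

lemma openin_sub_iff:
  assumes "S \<subseteq> P"
  shows "openin (subtopology Zar S) U \<longleftrightarrow> U \<subseteq> S \<and> (\<forall>p\<in>U. \<exists>F\<in>\<Union>HH. p \<in> D F \<and> D F \<inter> S \<subseteq> U)"
proof
  assume "openin (subtopology Zar S) U"
  then obtain T where "openin Zar T" "U = T \<inter> S" unfolding openin_subtopology by blast
  then show "U \<subseteq> S \<and> (\<forall>p\<in>U. \<exists>F\<in>\<Union>HH. p \<in> D F \<and> D F \<inter> S \<subseteq> U)" unfolding openin_iff by fast
next
  assume U: "U \<subseteq> S \<and> (\<forall>p\<in>U. \<exists>F\<in>\<Union>HH. p \<in> D F \<and> D F \<inter> S \<subseteq> U)"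
  define T where "T = \<Union>{D F | F. F \<in> \<Union>HH \<and> D F \<inter> S \<subseteq> U}"
  have "U = T \<inter> S" unfolding T_def using U by fast
  moreover have "openin Zar (D F)" if "F \<in> \<Union>HH" for F
    unfolding openin_iff using that D_sub by blast
  then have "openin Zar T" unfolding T_def by (intro openin_Union) auto
  ultimately show "openin (subtopology Zar S) U" unfolding openin_subtopology by blast
qed

lemma closedin_sub_iff:
  assumes "S \<subseteq> P"
  shows "closedin (subtopology Zar S) C \<longleftrightarrow> C \<subseteq> S \<and> (\<forall>p\<in>S - C. \<exists>F\<in>\<Union>HH. p \<in> D F \<and> D F \<inter> C = {})"
proof -
  have ts: "topspace (subtopology Zar S) = S" using assms by (simp add: Int_absorb1)
  have eq: "D F \<inter> S \<subseteq> S - C \<longleftrightarrow> D F \<inter> C = {}" if "C \<subseteq> S" for F using that by blast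
  show ?thesis
    unfolding closedin_def ts openin_sub_iff[OF assms] by (rule conj_cong) (simp_all add: eq)
qed

lemma closedin_D_compl:
  assumes "S \<subseteq> P" "F \<in> \<Union>HH" "closedin (subtopology Zar S) C"
  shows "closedin (subtopology Zar S) (C - D F)"
proof -
  have "closedin (subtopology Zar S) C" by fact
  then show ?thesis using assms(2) unfolding closedin_sub_iff[OF assms(1)] by fast
qed

text \<open>
  The principal open sets form a basis, so irreducibility can be tested on them. In terms of
  coordinates, the vanishing ideal of the set is prime.
\<close>

lemma irreducible_closed_iff:
  assumes S: "S \<subseteq> P" and X: "zar X = subtopology Zar S"
  shows "irreducible_closed X C \<longleftrightarrow> closedin (zar X) C \<and> C \<noteq> {} \<and>
    (\<forall>F\<in>\<Union>HH. \<forall>G\<in>\<Union>HH. C \<inter> D F \<inter> D G = {} \<longrightarrow> C \<inter> D F = {} \<or> C \<inter> D G = {})"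
    (is "_ \<longleftrightarrow> ?cl \<and> ?ne \<and> ?pr")
proof -
  have "(\<forall>A B. closedin (zar X) A \<and> closedin (zar X) B \<and> C = A \<union> B \<longrightarrow> C = A \<or> C = B) \<longleftrightarrow> ?pr"
    if cl: "closedin (zar X) C"
  proof (intro iffI ballI impI allI)
    fix F G assume irr: "\<forall>A B. closedin (zar X) A \<and> closedin (zar X) B \<and> C = A \<union> B \<longrightarrow> C = A \<or> C = B"
      and FG: "F \<in> \<Union>HH" "G \<in> \<Union>HH" "C \<inter> D F \<inter> D G = {}"
    have "closedin (zar X) (C - D F)" "closedin (zar X) (C - D G)"
      using closedin_D_compl[OF S] FG cl unfolding X by auto
    moreover have "C = (C - D F) \<union> (C - D G)" using FG(3) by blast
    ultimately have "C = C - D F \<or> C = C - D G" using irr by blast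
    then show "C \<inter> D F = {} \<or> C \<inter> D G = {}" by blast
  next
    fix A B assume pr: ?pr and AB: "closedin (zar X) A \<and> closedin (zar X) B \<and> C = A \<union> B"
    show "C = A \<or> C = B"
    proof (rule ccontr)
      assume "\<not> ?thesis"
      then obtain p q where pq: "p \<in> C - A" "q \<in> C - B" using AB by blast
      have CS: "C \<subseteq> S" using cl unfolding X closedin_sub_iff[OF S] by blast
      have "p \<in> S - A" "q \<in> S - B" using pq CS by auto
      then obtain F G where "F \<in> \<Union>HH" "p \<in> D F" "D F \<inter> A = {}" "G \<in> \<Union>HH" "q \<in> D G" "D G \<inter> B = {}"
        using AB unfolding X closedin_sub_iff[OF S] by meson
      moreover from this have "C \<inter> D F \<inter> D G = {}" using AB by blast
      ultimately show False using pr pq by blast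
    qed
  qed
  then show ?thesis unfolding irreducible_closed_def by blast
qed

lemma closedin_zeros:
  assumes "S \<subseteq> P" "F \<in> \<Union>HH"
  shows "closedin (subtopology Zar S) {q \<in> S. \<forall>v\<in>crd q. F v = 0}"
proof -
  have eq: "{q \<in> S. \<forall>v\<in>crd q. F v = 0} = S - D F" using D_not[OF assms(2)] assms(1) by blast
  have "closedin (subtopology Zar S) S"
    using closedin_topspace[of "subtopology Zar S"] assms(1) by (simp add: Int_absorb1)
  then show ?thesis unfolding eq using closedin_D_compl assms by blast
qed

lemma regular_on_quotient:
  assumes "U \<subseteq> P" "H \<in> HH" "F \<in> H" "G \<in> H" "\<And>q v. q \<in> U \<Longrightarrow> v \<in> crd q \<Longrightarrow> G v \<noteq> 0 \<and> f q = F v / G v"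
  shows "regular_on P crd HH U f"
proof -
  have "\<exists>K\<in>\<Union>HH. p \<in> D K \<and> (\<forall>q\<in>U \<inter> D K. \<forall>v\<in>crd q. G v \<noteq> 0 \<and> f q = F v / G v)" if "p \<in> U" for p
    using that assms one_in D_one by blast
  then show ?thesis unfolding regular_on_def using assms(2-4) by blast
qed

lemma zsub_space: "zsub P crd HH (zariski_space P crd HH) P"
proof -
  have "reg (zariski_space P crd HH) U f = regular_on P crd HH U f" if U: "openin Zar U" for U f
  proof
    assume r: "reg (zariski_space P crd HH) U f"
    show "regular_on P crd HH U f" unfolding regular_on_def
    proof
      fix p assume "p \<in> U"
      then obtain W H F G where W: "openin Zar W" "p \<in> W" "W \<subseteq> U" "H \<in> HH" "F \<in> H" "G \<in> H"
        "\<forall>q\<in>W. \<forall>v\<in>crd q. G v \<noteq> 0 \<and> f q = F v / G v"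
        using r unfolding zariski_space_def fspace.simps by metis
      obtain K where K: "K \<in> \<Union>HH" "p \<in> D K" "D K \<subseteq> W" using W(1,2) unfolding openin_iff by meson
      then have "\<forall>q\<in>U \<inter> D K. \<forall>v\<in>crd q. G v \<noteq> 0 \<and> f q = F v / G v" using W(7) by blast
      then show "\<exists>H\<in>HH. \<exists>F\<in>H. \<exists>G\<in>H. \<exists>K\<in>\<Union>HH. p \<in> D K \<and>
          (\<forall>q\<in>U \<inter> D K. \<forall>v\<in>crd q. G v \<noteq> 0 \<and> f q = F v / G v)"
        using W K by blast
    qed
  next
    assume r: "regular_on P crd HH U f"
    have "\<exists>W. openin Zar W \<and> p \<in> W \<and> W \<subseteq> U \<and>
         (\<exists>H\<in>HH. \<exists>F\<in>H. \<exists>G\<in>H. \<forall>q\<in>W. \<forall>v\<in>crd q. G v \<noteq> 0 \<and> f q = F v / G v)" if p: "p \<in> U" for p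
    proof -
      obtain H F G K where h: "H \<in> HH" "F \<in> H" "G \<in> H" "K \<in> \<Union>HH" "p \<in> D K"
        "\<forall>q\<in>U \<inter> D K. \<forall>v\<in>crd q. G v \<noteq> 0 \<and> f q = F v / G v"
        using r p unfolding regular_on_def by metis
      have "openin Zar (D K)" unfolding openin_iff using h(4) D_sub by blast
      then have "openin Zar (U \<inter> D K)" using U by blast
      then show ?thesis using h p by (intro exI[of _ "U \<inter> D K"]) blast
    qed
    then show "reg (zariski_space P crd HH) U f" unfolding zariski_space_def fspace.simps by blast
  qed
  then show ?thesis unfolding zsub_def by (simp add: zariski_space_def subtopology_topspace[of Zar, simplified])
qed

lemma zsub_pts: "zsub P crd HH X S \<Longrightarrow> pts X = S"
  unfolding zsub_def by auto

lemma openin_zsub: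
  assumes "zsub P crd HH X S"
  shows "openin (zar X) U \<longleftrightarrow> U \<subseteq> S \<and> (\<forall>p\<in>U. \<exists>F\<in>\<Union>HH. p \<in> D F \<and> D F \<inter> S \<subseteq> U)"
  using assms openin_sub_iff unfolding zsub_def by metis

lemma closedin_zsub:
  assumes "zsub P crd HH X S"
  shows "closedin (zar X) U \<longleftrightarrow> U \<subseteq> S \<and> (\<forall>p\<in>S - U. \<exists>F\<in>\<Union>HH. p \<in> D F \<and> D F \<inter> U = {})"
  using assms closedin_sub_iff unfolding zsub_def by metis

text \<open>
  A local quotient on the subspace extends to the open set of the ambient space on which its
  denominator does not vanish, hence it is locally the restriction of a regular function.
\<close>

lemma zsub_subspace:
  assumes X: "zsub P crd HH X S" and S': "S' \<subseteq> S"
  shows "zsub P crd HH (subspace_of X S') S'"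
proof -
  have SP: "S \<subseteq> P" "S' \<subseteq> P" using X S' unfolding zsub_def by auto
  have z: "zar (subspace_of X S') = subtopology Zar S'"
    using X S' unfolding zsub_def subspace_of_def by (auto simp: subtopology_subtopology Int_absorb1)
  have "reg (subspace_of X S') U f = regular_on P crd HH U f" if U: "openin (subtopology Zar S') U" for U f
  proof
    have US: "U \<subseteq> S'" using U openin_sub_iff[OF SP(2)] by blast
    assume r: "reg (subspace_of X S') U f"
    show "regular_on P crd HH U f" unfolding regular_on_def
    proof
      fix p assume p: "p \<in> U"
      then obtain W h where W: "openin (zar X) W" "p \<in> W" "reg X W h" "\<forall>q\<in>W \<inter> U. f q = h q"
        using r unfolding subspace_of_def fspace.simps by metis
      have "regular_on P crd HH W h" using X W unfolding zsub_def by blast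
      then obtain H F G K where h: "H \<in> HH" "F \<in> H" "G \<in> H" "K \<in> \<Union>HH" "p \<in> D K"
        "\<forall>q\<in>W \<inter> D K. \<forall>v\<in>crd q. G v \<noteq> 0 \<and> h q = F v / G v"
        using W(2) unfolding regular_on_def by metis
      obtain K' where K': "K' \<in> \<Union>HH" "p \<in> D K'" "D K' \<inter> S \<subseteq> W"
        using W(1,2) unfolding openin_zsub[OF X] by meson
      have "\<forall>q\<in>U \<inter> D (\<lambda>v. K v * K' v). \<forall>v\<in>crd q. G v \<noteq> 0 \<and> f q = F v / G v"
        using h(6) K'(3) W(4) US S' unfolding D_mult by fastforce
      moreover have "p \<in> D (\<lambda>v. K v * K' v)" using h K' unfolding D_mult by blast
      ultimately show "\<exists>H\<in>HH. \<exists>F\<in>H. \<exists>G\<in>H. \<exists>K\<in>\<Union>HH. p \<in> D K \<and>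
          (\<forall>q\<in>U \<inter> D K. \<forall>v\<in>crd q. G v \<noteq> 0 \<and> f q = F v / G v)"
        using h(1-3) mult_in[OF h(4) K'(1)] by blast
    qed
  next
    have US: "U \<subseteq> S'" using U openin_sub_iff[OF SP(2)] by blast
    assume r: "regular_on P crd HH U f"
    have "\<exists>W h. openin (zar X) W \<and> p \<in> W \<and> reg X W h \<and> (\<forall>q\<in>W \<inter> U. f q = h q)" if p: "p \<in> U" for p
    proof -
      obtain H F G K where h: "H \<in> HH" "F \<in> H" "G \<in> H" "K \<in> \<Union>HH" "p \<in> D K"
        "\<forall>q\<in>U \<inter> D K. \<forall>v\<in>crd q. G v \<noteq> 0 \<and> f q = F v / G v"
        using r p unfolding regular_on_def by metis
      have G: "G \<in> \<Union>HH" using h by blast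
      have pP: "p \<in> P" using p US SP by blast
      have pG: "p \<in> D G" using h(5,6) p pP by (auto simp: principal_open_def)
      define W where "W = S \<inter> (D K \<inter> D G)"
      define k where "k q = (let v = (SOME v. v \<in> crd q) in F v / G v)" for q
      have W: "openin (zar X) W" unfolding openin_zsub[OF X] W_def
        using mult_in[OF h(4) G] D_mult[of K G] by blast
      have k: "k q = F v / G v" if "q \<in> W" "v \<in> crd q" for q v
      proof -
        have "(SOME v. v \<in> crd q) \<in> crd q" using that(2) by (rule someI)
        moreover have "q \<in> P" "q \<in> D G" using that W_def SP by auto
        ultimately show ?thesis using ratio_indep[OF h(1-3), of q v "SOME v. v \<in> crd q"] that(2)
          by (auto simp: k_def Let_def principal_open_def field_simps)
      qed
      have "regular_on P crd HH W k"
        by (rule regular_on_quotient[OF _ h(1-3)]) (use k W_def SP in \<open>auto simp: principal_open_def\<close>)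
      then have "reg X W k" using X W unfolding zsub_def by blast
      moreover have "p \<in> W" using p US S' h(5) pG W_def by blast
      moreover have "f q = k q" if q: "q \<in> W \<inter> U" for q
      proof -
        have "q \<in> P" using q W_def SP by blast
        then obtain v where v: "v \<in> crd q" using crd_nonempty by blast
        then have "f q = F v / G v" using h(6) q W_def by blast
        then show ?thesis using k[of q v] v q by simp
      qed
      ultimately show ?thesis using W by blast
    qed
    then show "reg (subspace_of X S') U f" unfolding subspace_of_def fspace.simps by blast
  qed
  then show ?thesis unfolding zsub_def z using SP by blast
qed

end

text \<open>
  The common factor \<open>n\<close> of numerator and denominator allows \<open>\<Phi>\<close> itself to have denominators, as
  happens when the target is an affine space.
\<close>

definition lifts_to ::
    "'a set \<Rightarrow> ('a \<Rightarrow> 'v set) \<Rightarrow> ('v \<Rightarrow> complex) set set \<Rightarrow> ('b \<Rightarrow> 'w set) \<Rightarrow> ('w \<Rightarrow> complex) set set \<Rightarrow>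
      ('a \<Rightarrow> 'b) \<Rightarrow> ('v \<Rightarrow> 'w) \<Rightarrow> bool" where
  "lifts_to T crd HH crd' HH' \<phi> \<Phi> \<longleftrightarrow> (\<forall>q\<in>T. \<forall>v\<in>crd q. \<Phi> v \<in> crd' (\<phi> q)) \<and>
     (\<forall>H'\<in>HH'. \<forall>F\<in>H'. \<forall>G\<in>H'. \<exists>H\<in>HH. \<exists>F'\<in>H. \<exists>G'\<in>H. \<forall>q\<in>T. \<forall>v\<in>crd q.
        \<exists>n. n \<noteq> 0 \<and> F' v = n * F (\<Phi> v) \<and> G' v = n * G (\<Phi> v))"

lemma lifts_toI:
  assumes "\<And>q v. q \<in> T \<Longrightarrow> v \<in> crd q \<Longrightarrow> \<Phi> v \<in> crd' (\<phi> q)"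
    and "\<And>H'. H' \<in> HH' \<Longrightarrow> \<exists>H\<in>HH. \<forall>F\<in>H'. (\<lambda>v. F (\<Phi> v)) \<in> H"
  shows "lifts_to T crd HH crd' HH' \<phi> \<Phi>"
  unfolding lifts_to_def
proof (intro conjI ballI assms(1))
  fix H' F G assume F: "H' \<in> HH'" "F \<in> H'" "G \<in> H'"
  obtain H where H: "H \<in> HH" "\<forall>F\<in>H'. (\<lambda>v. F (\<Phi> v)) \<in> H" using assms(2)[OF F(1)] by (elim bexE) (rule that)
  show "\<exists>H\<in>HH. \<exists>F'\<in>H. \<exists>G'\<in>H. \<forall>q\<in>T. \<forall>v\<in>crd q. \<exists>n. n \<noteq> 0 \<and> F' v = n * F (\<Phi> v) \<and> G' v = n * G (\<Phi> v)"
    by (rule bexI[OF _ H(1)], rule bexI[OF _ H(2)[THEN bspec, OF F(2)]], rule bexI[OF _ H(2)[THEN bspec, OF F(3)]])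
       (auto intro!: exI[of _ 1])
qed

text \<open>
  A map that has a lift to coordinates around every point is a morphism: the lift turns local
  quotients into local quotients, and principal open sets into principal open sets.
\<close>

lemma morphismI:
  assumes A: "zcoord P crd HH" and B: "zcoord P' crd' HH'"
    and X: "zsub P crd HH X S" and Y: "zsub P' crd' HH' Y S'"
    and im: "\<And>p. p \<in> S \<Longrightarrow> \<phi> p \<in> S'"
    and lift: "\<And>p. p \<in> S \<Longrightarrow> \<exists>K\<in>\<Union>HH. \<exists>\<Phi>. p \<in> principal_open P crd K \<and>
      lifts_to (S \<inter> principal_open P crd K) crd HH crd' HH' \<phi> \<Phi>"
  shows "morphism X Y \<phi>"
proof -
  interpret A: zcoord P crd HH by fact
  interpret B: zcoord P' crd' HH' by fact
  have SP: "S \<subseteq> P" "S' \<subseteq> P'" using X Y unfolding zsub_def by auto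
  have cont: "openin (zar X) (preim X \<phi> V)" if V: "openin (zar Y) V" for V
    unfolding A.openin_zsub[OF X]
  proof (intro conjI ballI)
    show "preim X \<phi> V \<subseteq> S" unfolding preim_def A.zsub_pts[OF X] by blast
    fix p assume "p \<in> preim X \<phi> V"
    then have p: "p \<in> S" "\<phi> p \<in> V" unfolding preim_def A.zsub_pts[OF X] by auto
    obtain L where L: "L \<in> \<Union>HH'" "\<phi> p \<in> B.D L" "B.D L \<inter> S' \<subseteq> V"
      using V p(2) unfolding B.openin_zsub[OF Y] by meson
    obtain H' where H': "H' \<in> HH'" "L \<in> H'" using L(1) by blast
    obtain K \<Phi> where K: "K \<in> \<Union>HH" "p \<in> A.D K" "\<forall>q\<in>S \<inter> A.D K. \<forall>v\<in>crd q. \<Phi> v \<in> crd' (\<phi> q)"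
      and lf: "\<forall>H'\<in>HH'. \<forall>F\<in>H'. \<forall>G\<in>H'. \<exists>H\<in>HH. \<exists>F'\<in>H. \<exists>G'\<in>H. \<forall>q\<in>S \<inter> A.D K. \<forall>v\<in>crd q.
         \<exists>n. n \<noteq> 0 \<and> F' v = n * F (\<Phi> v) \<and> G' v = n * G (\<Phi> v)"
      using lift[OF p(1)] unfolding lifts_to_def by (elim bexE exE conjE) (rule that)
    obtain H M M' where M: "H \<in> HH" "M \<in> H" "\<forall>q\<in>S \<inter> A.D K. \<forall>v\<in>crd q. \<exists>n. n \<noteq> 0 \<and> M v = n * L (\<Phi> v) \<and> M' v = n * L (\<Phi> v)"
      using lf[THEN bspec, OF H'(1), THEN bspec, OF H'(2), THEN bspec, OF H'(2)] by (elim bexE) (rule that)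
    have MU: "M \<in> \<Union>HH" using M by blast
    have *: "q \<in> A.D M \<longleftrightarrow> \<phi> q \<in> B.D L" if q: "q \<in> S \<inter> A.D K" for q
    proof -
      obtain v where v: "v \<in> crd q" using A.crd_nonempty q SP by blast
      then obtain n where "n \<noteq> 0" "M v = n * L (\<Phi> v)" using M(3) q by blast
      moreover have "\<Phi> v \<in> crd' (\<phi> q)" using K(3) q v by blast
      ultimately show ?thesis using A.D_iff[OF MU _ v] B.D_iff[OF L(1), of "\<phi> q" "\<Phi> v"] im q SP by auto
    qed
    show "\<exists>F\<in>\<Union>HH. p \<in> A.D F \<and> A.D F \<inter> S \<subseteq> preim X \<phi> V"
    proof (intro bexI[OF _ A.mult_in[OF K(1) MU]] conjI)
      show "p \<in> A.D (\<lambda>v. K v * M v)" unfolding A.D_mult using * p L K by blast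
      show "A.D (\<lambda>v. K v * M v) \<inter> S \<subseteq> preim X \<phi> V"
        unfolding A.D_mult preim_def A.zsub_pts[OF X] using * L(3) im by blast
    qed
  qed
  have "reg X (preim X \<phi> V) (f \<circ> \<phi>)" if V: "openin (zar Y) V" and f: "reg Y V f" for V f
  proof -
    have rf: "regular_on P' crd' HH' V f" using Y V f unfolding zsub_def by blast
    have VS: "V \<subseteq> S'" using V unfolding B.openin_zsub[OF Y] by blast
    have "regular_on P crd HH (preim X \<phi> V) (f \<circ> \<phi>)" unfolding regular_on_def
    proof
      fix p assume "p \<in> preim X \<phi> V"
      then have p: "p \<in> S" "\<phi> p \<in> V" unfolding preim_def A.zsub_pts[OF X] by auto
      obtain H' F G L where h: "H' \<in> HH'" "F \<in> H'" "G \<in> H'" "L \<in> \<Union>HH'" "\<phi> p \<in> B.D L"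
        "\<forall>q\<in>V \<inter> B.D L. \<forall>v\<in>crd' q. G v \<noteq> 0 \<and> f q = F v / G v"
        using rf p(2) unfolding regular_on_def by metis
      obtain K \<Phi> where K: "K \<in> \<Union>HH" "p \<in> A.D K" "\<forall>q\<in>S \<inter> A.D K. \<forall>v\<in>crd q. \<Phi> v \<in> crd' (\<phi> q)"
        and lf: "\<forall>H'\<in>HH'. \<forall>F\<in>H'. \<forall>G\<in>H'. \<exists>H\<in>HH. \<exists>F'\<in>H. \<exists>G'\<in>H. \<forall>q\<in>S \<inter> A.D K. \<forall>v\<in>crd q.
           \<exists>n. n \<noteq> 0 \<and> F' v = n * F (\<Phi> v) \<and> G' v = n * G (\<Phi> v)"
        using lift[OF p(1)] unfolding lifts_to_def by (elim bexE exE conjE) (rule that)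
      obtain H F' G' where FG: "H \<in> HH" "F' \<in> H" "G' \<in> H" "\<forall>q\<in>S \<inter> A.D K. \<forall>v\<in>crd q.
           \<exists>n. n \<noteq> 0 \<and> F' v = n * F (\<Phi> v) \<and> G' v = n * G (\<Phi> v)"
        using lf[THEN bspec, OF h(1), THEN bspec, OF h(2), THEN bspec, OF h(3)] by (elim bexE) (rule that)
      have "openin (zar Y) (S' \<inter> B.D L)" unfolding B.openin_zsub[OF Y] using h(4) by blast
      then have "openin (zar X) (preim X \<phi> (S' \<inter> B.D L))" by (rule cont)
      moreover have "p \<in> preim X \<phi> (S' \<inter> B.D L)" unfolding preim_def A.zsub_pts[OF X] using p h(5) im by blast
      ultimately obtain K' where K': "K' \<in> \<Union>HH" "p \<in> A.D K'" "A.D K' \<inter> S \<subseteq> preim X \<phi> (S' \<inter> B.D L)"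
        unfolding A.openin_zsub[OF X] by meson
      have "G' v \<noteq> 0 \<and> (f \<circ> \<phi>) q = F' v / G' v"
        if q: "q \<in> preim X \<phi> V \<inter> A.D (\<lambda>v. K v * K' v)" and v: "v \<in> crd q" for q v
      proof -
        have q': "q \<in> S \<inter> A.D K" "\<phi> q \<in> V \<inter> B.D L"
          using q K'(3) unfolding A.D_mult preim_def A.zsub_pts[OF X] by auto
        obtain n where n: "n \<noteq> 0" "F' v = n * F (\<Phi> v)" "G' v = n * G (\<Phi> v)" using FG(4) q'(1) v by blast
        have "\<Phi> v \<in> crd' (\<phi> q)" using K(3) q'(1) v by blast
        then have "G (\<Phi> v) \<noteq> 0 \<and> f (\<phi> q) = F (\<Phi> v) / G (\<Phi> v)" using h(6) q'(2) by blast
        then show ?thesis using n by simp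
      qed
      moreover have "p \<in> A.D (\<lambda>v. K v * K' v)" unfolding A.D_mult using K K' by blast
      ultimately show "\<exists>H\<in>HH. \<exists>F\<in>H. \<exists>G\<in>H. \<exists>K\<in>\<Union>HH. p \<in> A.D K \<and>
          (\<forall>q\<in>preim X \<phi> V \<inter> A.D K. \<forall>v\<in>crd q. G v \<noteq> 0 \<and> (f \<circ> \<phi>) q = F v / G v)"
        using FG(1-3) A.mult_in[OF K(1) K'(1)] by blast
    qed
    then show ?thesis using X cont[OF V] unfolding zsub_def by blast
  qed
  moreover have "continuous_map (zar X) (zar Y) \<phi>"
    unfolding continuous_map_def using cont im A.zsub_pts[OF X] B.zsub_pts[OF Y] by (auto simp: preim_def)
  ultimately show ?thesis unfolding morphism_def by blast
qed

lemma morphismI_global: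
  assumes A: "zcoord P crd HH" and B: "zcoord P' crd' HH'"
    and X: "zsub P crd HH X S" and Y: "zsub P' crd' HH' Y S'"
    and im: "\<And>p. p \<in> S \<Longrightarrow> \<phi> p \<in> S'" and lift: "lifts_to S crd HH crd' HH' \<phi> \<Phi>"
  shows "morphism X Y \<phi>"
proof (rule morphismI[OF A B X Y im])
  interpret zcoord P crd HH by fact
  fix p assume "p \<in> S"
  have S: "S \<subseteq> P" using X unfolding zsub_def by blast
  have "S \<inter> D (\<lambda>v. 1) = S" using S D_one by blast
  then show "\<exists>K\<in>\<Union>HH. \<exists>\<Phi>. p \<in> D K \<and> lifts_to (S \<inter> D K) crd HH crd' HH' \<phi> \<Phi>"
    by (intro bexI[OF _ one_in] exI[of _ \<Phi>]) (use lift \<open>p \<in> S\<close> S D_one in auto)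
qed

lemma morphism_maps: "morphism X Y \<phi> \<Longrightarrow> p \<in> pts X \<Longrightarrow> \<phi> p \<in> pts Y"
  unfolding morphism_def continuous_map_def by blast

lemma morphism_open: "morphism X Y \<phi> \<Longrightarrow> openin (zar Y) V \<Longrightarrow> openin (zar X) (preim X \<phi> V)"
  unfolding morphism_def continuous_map_def preim_def by blast

lemma morphism_reg: "morphism X Y \<phi> \<Longrightarrow> openin (zar Y) V \<Longrightarrow> reg Y V f \<Longrightarrow> reg X (preim X \<phi> V) (f \<circ> \<phi>)"
  unfolding morphism_def by blast

section \<open>Coordinate vectors\<close>

definition vec2 :: "complex \<Rightarrow> complex \<Rightarrow> cvec" where
  "vec2 a b = (\<lambda>i. if i = 0 then a else if i = 1 then b else 0)"

definition vec3 :: "complex \<Rightarrow> complex \<Rightarrow> complex \<Rightarrow> cvec" where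
  "vec3 a b c = (\<lambda>i. if i = 0 then a else if i = 1 then b else if i = 2 then c else 0)"

lemma vec2_simps [simp]: "vec2 a b 0 = a" "vec2 a b (Suc 0) = b" "i \<ge> 2 \<Longrightarrow> vec2 a b i = 0"
  by (auto simp: vec2_def)

lemma vec3_simps [simp]: "vec3 a b c 0 = a" "vec3 a b c (Suc 0) = b" "vec3 a b c 2 = c" "i \<ge> 3 \<Longrightarrow> vec3 a b c i = 0"
  by (auto simp: vec3_def)

lemma vec2_cspace [simp]: "vec2 a b \<in> cspace 2" by (auto simp: cspace_def)
lemma vec3_cspace [simp]: "vec3 a b c \<in> cspace 3" by (auto simp: cspace_def)

lemma less_2_iff: "i < (2::nat) \<longleftrightarrow> i = 0 \<or> i = Suc 0" by auto
lemma less_3_iff: "i < (3::nat) \<longleftrightarrow> i = 0 \<or> i = Suc 0 \<or> i = 2" by auto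

lemma cspace2_eq: "x \<in> cspace 2 \<Longrightarrow> x = vec2 (x 0) (x (Suc 0))"
  by (auto simp: cspace_def vec2_def fun_eq_iff)
lemma cspace3_eq: "x \<in> cspace 3 \<Longrightarrow> x = vec3 (x 0) (x (Suc 0)) (x 2)"
  by (auto simp: cspace_def vec3_def fun_eq_iff)

lemma vec2_eq_iff: "vec2 a b = vec2 a' b' \<longleftrightarrow> a = a' \<and> b = b'"
  by (metis vec2_simps(1,2))
lemma vec3_eq_iff: "vec3 a b c = vec3 a' b' c' \<longleftrightarrow> a = a' \<and> b = b' \<and> c = c'"
  by (metis vec3_simps(1,2,3))

lemma vec2_zero: "vec2 a b = (\<lambda>_. 0) \<longleftrightarrow> a = 0 \<and> b = 0"
proof -
  have "(\<lambda>_. 0) = vec2 0 0" by (auto simp: vec2_def)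
  then show ?thesis by (simp add: vec2_eq_iff)
qed
lemma vec3_zero: "vec3 a b c = (\<lambda>_. 0) \<longleftrightarrow> a = 0 \<and> b = 0 \<and> c = 0"
proof -
  have "(\<lambda>_. 0) = vec3 0 0 0" by (auto simp: vec3_def)
  then show ?thesis by (simp add: vec3_eq_iff)
qed

lemma vec2_scale: "(\<lambda>i. c * vec2 a b i) = vec2 (c * a) (c * b)" by (auto simp: vec2_def fun_eq_iff)
lemma vec3_scale: "(\<lambda>i. t * vec3 a b c i) = vec3 (t * a) (t * b) (t * c)" by (auto simp: vec3_def fun_eq_iff)

section \<open>Points of projective space\<close>

lemma proj_point_iff: "v \<in> proj_point x \<longleftrightarrow> (\<exists>c. c \<noteq> 0 \<and> v = (\<lambda>i. c * x i))"
  by (auto simp: proj_point_def)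

lemma proj_point_self [simp]: "x \<in> proj_point x"
  unfolding proj_point_iff by (rule exI[of _ 1]) simp

lemma proj_point_scale: "c \<noteq> 0 \<Longrightarrow> proj_point (\<lambda>i. c * x i) = proj_point x"
proof (intro set_eqI iffI)
  fix v assume c: "c \<noteq> 0"
  { assume "v \<in> proj_point (\<lambda>i. c * x i)"
    then obtain d where "d \<noteq> 0" "v = (\<lambda>i. d * (c * x i))" unfolding proj_point_iff by blast
    then show "v \<in> proj_point x" unfolding proj_point_iff using c by (intro exI[of _ "d * c"]) (simp add: mult.assoc) }
  { assume "v \<in> proj_point x"
    then obtain d where "d \<noteq> 0" "v = (\<lambda>i. d * x i)" unfolding proj_point_iff by blast
    then show "v \<in> proj_point (\<lambda>i. c * x i)" unfolding proj_point_iff using c by (intro exI[of _ "d / c"]) auto }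
qed

lemma proj_point_in: "x \<in> cspace (n + 1) \<Longrightarrow> x \<noteq> (\<lambda>_. 0) \<Longrightarrow> proj_point x \<in> proj_points n"
  by (auto simp: proj_points_def)

lemma proj_points_mem:
  assumes "p \<in> proj_points n" "x \<in> p"
  shows "x \<in> cspace (n + 1)" "x \<noteq> (\<lambda>_. 0)" "p = proj_point x"
proof -
  obtain y where y: "p = proj_point y" "y \<in> cspace (n + 1)" "y \<noteq> (\<lambda>_. 0)"
    using assms(1) by (auto simp: proj_points_def)
  then obtain c where c: "c \<noteq> 0" "x = (\<lambda>i. c * y i)" using assms(2) unfolding y(1) proj_point_iff by blast
  show "x \<in> cspace (n + 1)" using y c by (auto simp: cspace_def)
  show "x \<noteq> (\<lambda>_. 0)" using y c by (auto simp: fun_eq_iff)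
  show "p = proj_point x" using y c proj_point_scale by simp
qed

lemma proj_points_ex: "p \<in> proj_points n \<Longrightarrow> \<exists>x\<in>p. x \<in> cspace (n + 1) \<and> x \<noteq> (\<lambda>_. 0) \<and> p = proj_point x"
  unfolding proj_points_def by (erule imageE) (use proj_point_self in auto)

lemma proj_point_ne: "p \<in> proj_points n \<Longrightarrow> p \<noteq> {}"
  using proj_points_ex by blast

section \<open>Forms and biforms\<close>

lemma formsI: "F \<in> polys n \<Longrightarrow> (\<And>c x. F (\<lambda>i. c * x i) = c ^ d * F x) \<Longrightarrow> F \<in> forms n d"
  by (auto simp: forms_def)

lemma forms_mult: "F \<in> forms n d \<Longrightarrow> G \<in> forms n e \<Longrightarrow> (\<lambda>x. F x * G x) \<in> forms n (d + e)"
  by (auto simp: forms_def power_add intro: polys_mult)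

lemma forms_one: "(\<lambda>x. 1) \<in> forms n 0"
  by (auto simp: forms_def)

lemma forms_var: "i < n \<Longrightarrow> (\<lambda>x. x i) \<in> forms n 1"
  by (auto simp: forms_def polys_var)

lemma forms_add: "F \<in> forms n d \<Longrightarrow> G \<in> forms n d \<Longrightarrow> (\<lambda>x. F x + G x) \<in> forms n d"
  by (auto simp: forms_def algebra_simps intro: polys_add)

lemma forms_cmult: "F \<in> forms n d \<Longrightarrow> (\<lambda>x. c * F x) \<in> forms n d"
  by (auto simp: forms_def intro!: polys_mult)

abbreviation bigens :: "nat \<Rightarrow> nat \<Rightarrow> (cvec \<times> cvec \<Rightarrow> complex) set" where
  "bigens m n \<equiv> {(\<lambda>(x, y). x i) | i. i < m} \<union> {(\<lambda>(x, y). y j) | j. j < n}"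

lemma biformsD: "F \<in> biforms m n d e \<Longrightarrow> F \<in> gen_algebra (bigens m n)"
  "F \<in> biforms m n d e \<Longrightarrow> F ((\<lambda>i. a * x i), (\<lambda>j. b * y j)) = a ^ d * b ^ e * F (x, y)"
  by (auto simp: biforms_def)

lemma biformsI: "F \<in> gen_algebra (bigens m n) \<Longrightarrow>
  (\<And>a b x y. F ((\<lambda>i. a * x i), (\<lambda>j. b * y j)) = a ^ d * b ^ e * F (x, y)) \<Longrightarrow> F \<in> biforms m n d e"
  by (auto simp: biforms_def)

lemma biforms_x: "i < m \<Longrightarrow> (\<lambda>v. fst v i) \<in> biforms m n 1 0"
  by (rule biformsI) (auto intro!: gen_algebra.gen exI[of _ i] simp: fun_eq_iff)

lemma biforms_y: "j < n \<Longrightarrow> (\<lambda>v. snd v j) \<in> biforms m n 0 1"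
  by (rule biformsI) (auto intro!: gen_algebra.gen simp: fun_eq_iff)

lemma biforms_mult: "F \<in> biforms m n d e \<Longrightarrow> G \<in> biforms m n d' e' \<Longrightarrow>
  (\<lambda>v. F v * G v) \<in> biforms m n (d + d') (e + e')"
  by (rule biformsI) (auto intro: gen_algebra.mult biformsD(1) simp: biformsD(2) power_add mult_ac)

lemma biforms_add: "F \<in> biforms m n d e \<Longrightarrow> G \<in> biforms m n d e \<Longrightarrow> (\<lambda>v. F v + G v) \<in> biforms m n d e"
  by (rule biformsI) (auto intro: gen_algebra.add biformsD(1) simp: biformsD(2) algebra_simps)

lemma biforms_diff: "F \<in> biforms m n d e \<Longrightarrow> G \<in> biforms m n d e \<Longrightarrow> (\<lambda>v. F v - G v) \<in> biforms m n d e"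
  by (rule biformsI) (auto intro: gen_algebra_diff biformsD(1) simp: biformsD(2) algebra_simps)

lemma biforms_const: "(\<lambda>v. c) \<in> biforms m n 0 0"
  by (rule biformsI) (auto intro: gen_algebra.const)

lemma biforms_cmult: "F \<in> biforms m n d e \<Longrightarrow> (\<lambda>v. c * F v) \<in> biforms m n d e"
  using biforms_mult[OF biforms_const[of c m n], of F d e] by simp

lemma biforms_power: "F \<in> biforms m n d e \<Longrightarrow> (\<lambda>v. F v ^ k) \<in> biforms m n (k * d) (k * e)"
proof (induction k)
  case 0 then show ?case using biforms_const[of 1] by simp
next
  case (Suc k) then show ?case using biforms_mult[of F m n d e "\<lambda>v. F v ^ k"] by simp
qed

lemma biforms_comp_polys:
  assumes "F \<in> biforms m n d e" "\<And>i. i < m \<Longrightarrow> (\<lambda>w. fst (\<Phi> w) i) \<in> polys k"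
    "\<And>j. j < n \<Longrightarrow> (\<lambda>w. snd (\<Phi> w) j) \<in> polys k"
  shows "(\<lambda>w. F (\<Phi> w)) \<in> polys k"
  unfolding polys_def
  by (rule gen_algebra_comp[OF biformsD(1)[OF assms(1)]])
     (use assms(2,3) in \<open>auto simp: polys_def case_prod_beta\<close>)

lemma biforms_comp:
  assumes "F \<in> biforms m n d e"
    "\<And>i. i < m \<Longrightarrow> (\<lambda>w. fst (\<Phi> w) i) \<in> biforms m' n' d1 e1"
    "\<And>j. j < n \<Longrightarrow> (\<lambda>w. snd (\<Phi> w) j) \<in> biforms m' n' d2 e2"
    "\<And>i w. i \<ge> m \<Longrightarrow> fst (\<Phi> w) i = 0" "\<And>j w. j \<ge> n \<Longrightarrow> snd (\<Phi> w) j = 0"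
  shows "(\<lambda>w. F (\<Phi> w)) \<in> biforms m' n' (d * d1 + e * d2) (d * e1 + e * e2)"
proof (rule biformsI)
  show "(\<lambda>w. F (\<Phi> w)) \<in> gen_algebra (bigens m' n')"
    by (rule gen_algebra_comp[OF biformsD(1)[OF assms(1)]])
       (use biformsD(1)[OF assms(2)] biformsD(1)[OF assms(3)] in \<open>auto simp: case_prod_beta\<close>)
  fix a b x y
  have 1: "fst (\<Phi> ((\<lambda>i. a * x i), (\<lambda>j. b * y j))) = (\<lambda>i. (a ^ d1 * b ^ e1) * fst (\<Phi> (x, y)) i)" (is "?l = ?r")
  proof
    fix i show "?l i = ?r i" using biformsD(2)[OF assms(2)[of i]] assms(4)[of i] by (cases "i < m") auto
  qed
  have 2: "snd (\<Phi> ((\<lambda>i. a * x i), (\<lambda>j. b * y j))) = (\<lambda>i. (a ^ d2 * b ^ e2) * snd (\<Phi> (x, y)) i)" (is "?l = ?r")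
  proof
    fix i show "?l i = ?r i" using biformsD(2)[OF assms(3)[of i]] assms(5)[of i] by (cases "i < n") auto
  qed
  have "F (\<Phi> ((\<lambda>i. a * x i), (\<lambda>j. b * y j))) =
      F ((\<lambda>i. (a ^ d1 * b ^ e1) * fst (\<Phi> (x, y)) i), (\<lambda>i. (a ^ d2 * b ^ e2) * snd (\<Phi> (x, y)) i))"
    by (simp flip: 1 2)
  also have "\<dots> = (a ^ d1 * b ^ e1) ^ d * (a ^ d2 * b ^ e2) ^ e * F (\<Phi> (x, y))"
    by (simp add: biformsD(2)[OF assms(1)])
  finally show "F (\<Phi> ((\<lambda>i. a * x i), (\<lambda>j. b * y j))) =
      a ^ (d * d1 + e * d2) * b ^ (d * e1 + e * e2) * F (\<Phi> (x, y))"
    by (simp add: power_mult_distrib power_add mult_ac flip: power_mult)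
qed

lemma biforms_comp_forms:
  assumes "F \<in> biforms m n d e"
    "\<And>i. i < m \<Longrightarrow> (\<lambda>w. fst (\<Phi> w) i) \<in> forms k 1" "\<And>j. j < n \<Longrightarrow> (\<lambda>w. snd (\<Phi> w) j) \<in> forms k 1"
    "\<And>i w. i \<ge> m \<Longrightarrow> fst (\<Phi> w) i = 0" "\<And>j w. j \<ge> n \<Longrightarrow> snd (\<Phi> w) j = 0"
  shows "(\<lambda>w. F (\<Phi> w)) \<in> forms k (d + e)"
proof (rule formsI)
  show "(\<lambda>w. F (\<Phi> w)) \<in> polys k"
    by (rule biforms_comp_polys[OF assms(1)]) (use assms(2,3) formsD(1) in blast)+
  fix c x
  have 1: "fst (\<Phi> (\<lambda>i. c * x i)) = (\<lambda>i. c * fst (\<Phi> x) i)" (is "?l = ?r")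
  proof
    fix i show "?l i = ?r i" using formsD(2)[OF assms(2)[of i]] assms(4)[of i] by (cases "i < m") auto
  qed
  have 2: "snd (\<Phi> (\<lambda>i. c * x i)) = (\<lambda>i. c * snd (\<Phi> x) i)" (is "?l = ?r")
  proof
    fix i show "?l i = ?r i" using formsD(2)[OF assms(3)[of i]] assms(5)[of i] by (cases "i < n") auto
  qed
  have "F (\<Phi> (\<lambda>i. c * x i)) = F ((\<lambda>i. c * fst (\<Phi> x) i), (\<lambda>i. c * snd (\<Phi> x) i))" by (simp flip: 1 2)
  also have "\<dots> = c ^ d * c ^ e * F (\<Phi> x)" by (simp add: biformsD(2)[OF assms(1)])
  finally show "F (\<Phi> (\<lambda>i. c * x i)) = c ^ (d + e) * F (\<Phi> x)" by (simp add: power_add)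
qed

lemma forms_comp_biforms:
  assumes "F \<in> forms k d" "\<And>i. i < k \<Longrightarrow> (\<lambda>w. \<Phi> w i) \<in> biforms m n d1 e1"
    "\<And>i w. i \<ge> k \<Longrightarrow> \<Phi> w i = 0"
  shows "(\<lambda>w. F (\<Phi> w)) \<in> biforms m n (d * d1) (d * e1)"
proof (rule biformsI)
  show "(\<lambda>w. F (\<Phi> w)) \<in> gen_algebra (bigens m n)"
    by (rule gen_algebra_comp[OF formsD(1)[OF assms(1), unfolded polys_def]])
       (use biformsD(1)[OF assms(2)] in auto)
  fix a b x y
  have 1: "\<Phi> ((\<lambda>i. a * x i), (\<lambda>j. b * y j)) = (\<lambda>i. (a ^ d1 * b ^ e1) * \<Phi> (x, y) i)" (is "?l = ?r")
  proof
    fix i show "?l i = ?r i" using biformsD(2)[OF assms(2)[of i]] assms(3)[of i] by (cases "i < k") auto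
  qed
  show "F (\<Phi> ((\<lambda>i. a * x i), (\<lambda>j. b * y j))) = a ^ (d * d1) * b ^ (d * e1) * F (\<Phi> (x, y))"
    unfolding 1 formsD(2)[OF assms(1)] by (simp add: power_mult_distrib mult.commute flip: power_mult)
qed

lemma forms_comp_forms:
  assumes "F \<in> forms k d" "\<And>i. i < k \<Longrightarrow> (\<lambda>w. \<Phi> w i) \<in> forms n e" "\<And>i w. i \<ge> k \<Longrightarrow> \<Phi> w i = 0"
  shows "(\<lambda>w. F (\<Phi> w)) \<in> forms n (d * e)"
proof (rule formsI)
  show "(\<lambda>w. F (\<Phi> w)) \<in> polys n"
    by (rule polys_comp[OF formsD(1)[OF assms(1)]]) (use assms(2) formsD(1) in blast)
  fix c x
  have 1: "\<Phi> (\<lambda>i. c * x i) = (\<lambda>i. c ^ e * \<Phi> x i)" (is "?l = ?r")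
  proof
    fix i show "?l i = ?r i" using formsD(2)[OF assms(2)[of i]] assms(3)[of i] by (cases "i < k") auto
  qed
  show "F (\<Phi> (\<lambda>i. c * x i)) = c ^ (d * e) * F (\<Phi> x)"
    unfolding 1 formsD(2)[OF assms(1)] by (simp add: mult.commute flip: power_mult)
qed

section \<open>The coordinate systems of affine, projective and biprojective space\<close>

lemma zcoord_affine: "zcoord (cspace n) (\<lambda>x. {x}) {polys n}"
  by unfold_locales (auto intro: polys_mult)

lemma zcoord_proj: "zcoord (proj_points n) (\<lambda>p. p) (range (forms (n + 1)))"
proof
  fix p assume "p \<in> proj_points n" then show "p \<noteq> {}" by (rule proj_point_ne)
next
  fix H F p v w assume "H \<in> range (forms (n + 1))" "F \<in> H" and p: "p \<in> proj_points n" "v \<in> p" "w \<in> p" and F0: "F v = 0"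
  then obtain d where F: "F \<in> forms (n + 1) d" by auto
  have "w \<in> proj_point v" using proj_points_mem(3)[OF p(1,2)] p(3) by simp
  then obtain c where "w = (\<lambda>i. c * v i)" unfolding proj_point_iff by blast
  then show "F w = 0" using formsD(2)[OF F] F0 by simp
next
  fix H F G p v w assume "H \<in> range (forms (n + 1))" "F \<in> H" "G \<in> H" and p: "p \<in> proj_points n" "v \<in> p" "w \<in> p"
  then obtain d where F: "F \<in> forms (n + 1) d" "G \<in> forms (n + 1) d" by auto
  have "w \<in> proj_point v" using proj_points_mem(3)[OF p(1,2)] p(3) by simp
  then obtain c where "w = (\<lambda>i. c * v i)" unfolding proj_point_iff by blast
  then show "F v * G w = F w * G v" using formsD(2)[OF F(1)] formsD(2)[OF F(2)] by simp
next
  fix H1 H2 assume "H1 \<in> range (forms (n + 1))" "H2 \<in> range (forms (n + 1))"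
  then obtain d e where de: "H1 = forms (n + 1) d" "H2 = forms (n + 1) e" by auto
  show "\<exists>H\<in>range (forms (n + 1)). \<forall>F\<in>H1. \<forall>G\<in>H2. (\<lambda>v. F v * G v) \<in> H"
    unfolding de by (rule bexI[of _ "forms (n + 1) (d + e)"]) (auto intro: forms_mult)
next
  show "\<exists>H\<in>range (forms (n + 1)). (\<lambda>v. 1) \<in> H"
    by (rule bexI[of _ "forms (n + 1) 0"]) (auto intro: forms_one)
qed

lemma zcoord_biproj: "zcoord (proj_points m \<times> proj_points n) (\<lambda>(p, q). p \<times> q) {biforms (m + 1) (n + 1) d e | d e. True}"
proof
  fix p assume "p \<in> proj_points m \<times> proj_points n"
  then show "(case p of (p, q) \<Rightarrow> p \<times> q) \<noteq> {}" using proj_point_ne by fastforce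
next
  have sc: "\<exists>a b. w = ((\<lambda>i. a * fst v i), (\<lambda>i. b * snd v i))"
    if "p \<in> proj_points m \<times> proj_points n" "v \<in> (case p of (p, q) \<Rightarrow> p \<times> q)" "w \<in> (case p of (p, q) \<Rightarrow> p \<times> q)" for p v w
  proof -
    have "fst w \<in> proj_point (fst v)" using that proj_points_mem(3)[of "fst p" m "fst v"] by auto
    moreover have "snd w \<in> proj_point (snd v)" using that proj_points_mem(3)[of "snd p" n "snd v"] by auto
    ultimately show ?thesis unfolding proj_point_iff by (metis prod.collapse)
  qed
  { fix H F p v w assume "H \<in> {biforms (m + 1) (n + 1) d e | d e. True}" "F \<in> H"
      and p: "p \<in> proj_points m \<times> proj_points n" "v \<in> (case p of (p, q) \<Rightarrow> p \<times> q)" "w \<in> (case p of (p, q) \<Rightarrow> p \<times> q)" and F0: "F v = 0"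
    then obtain d e where F: "F \<in> biforms (m + 1) (n + 1) d e" by auto
    obtain a b where "w = ((\<lambda>i. a * fst v i), (\<lambda>i. b * snd v i))" using sc[OF p] by blast
    then show "F w = 0" using biformsD(2)[OF F] F0 by simp }
  { fix H F G p v w assume "H \<in> {biforms (m + 1) (n + 1) d e | d e. True}" "F \<in> H" "G \<in> H"
      and p: "p \<in> proj_points m \<times> proj_points n" "v \<in> (case p of (p, q) \<Rightarrow> p \<times> q)" "w \<in> (case p of (p, q) \<Rightarrow> p \<times> q)"
    then obtain d e where F: "F \<in> biforms (m + 1) (n + 1) d e" "G \<in> biforms (m + 1) (n + 1) d e" by auto
    obtain a b where "w = ((\<lambda>i. a * fst v i), (\<lambda>i. b * snd v i))" using sc[OF p] by blast
    then show "F v * G w = F w * G v" using biformsD(2)[OF F(1)] biformsD(2)[OF F(2)] by simp }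
next
  fix H1 H2 assume "H1 \<in> {biforms (m + 1) (n + 1) d e | d e. True}" "H2 \<in> {biforms (m + 1) (n + 1) d e | d e. True}"
  then obtain d e d' e' where de: "H1 = biforms (m + 1) (n + 1) d e" "H2 = biforms (m + 1) (n + 1) d' e'" by auto
  show "\<exists>H\<in>{biforms (m + 1) (n + 1) d e | d e. True}. \<forall>F\<in>H1. \<forall>G\<in>H2. (\<lambda>v. F v * G v) \<in> H"
    unfolding de by (rule bexI[of _ "biforms (m + 1) (n + 1) (d + d') (e + e')"]) (auto intro: biforms_mult)
next
  show "\<exists>H\<in>{biforms (m + 1) (n + 1) d e | d e. True}. (\<lambda>v. 1) \<in> H"
    by (rule bexI[of _ "biforms (m + 1) (n + 1) 0 0"]) (auto intro: biforms_const)
qed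

section \<open>Regular functions on the affine plane\<close>

text \<open>
  A fraction in lowest terms that represents the function somewhere has a denominator dividing
  all local denominators; hence that denominator vanishes nowhere and is constant.
\<close>

lemma regular_affine_plane:
  assumes "regular_on (cspace 2) (\<lambda>x. {x}) {polys 2} (cspace 2) f"
  shows "\<exists>F\<in>polys 2. \<forall>x\<in>cspace 2. f x = F x"
proof -
  have loc: "\<exists>F\<in>polys 2. \<exists>G\<in>polys 2. \<exists>K\<in>polys 2. K p \<noteq> 0 \<and> (\<forall>q\<in>cspace 2. K q \<noteq> 0 \<longrightarrow> G q \<noteq> 0 \<and> f q = F q / G q)"
    if p: "p \<in> cspace 2" for p
  proof -
    obtain F G K where "F \<in> polys 2" "G \<in> polys 2" "K \<in> polys 2"
      "p \<in> principal_open (cspace 2) (\<lambda>x. {x}) K"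
      "\<forall>q\<in>cspace 2 \<inter> principal_open (cspace 2) (\<lambda>x. {x}) K. \<forall>v\<in>{q}. G v \<noteq> 0 \<and> f q = F v / G v"
      using assms[unfolded regular_on_def, THEN bspec, OF p] by auto
    then show ?thesis unfolding principal_open_def
      by (intro bexI[of _ F] bexI[of _ G] bexI[of _ K]) auto
  qed
  have p23: "F \<in> polys 2 \<Longrightarrow> F \<in> polys 3" for F using polys_mono[of 2 3] by simp
  have trunc: "F x = F (vec2 (x 0) (x 1))" if "F \<in> polys 2" for F x
    by (rule polys_cong[OF that]) (auto simp: less_2_iff)
  define o2 where "o2 = vec2 0 0"
  obtain F G K where FGK: "F \<in> polys 2" "G \<in> polys 2" "K \<in> polys 2" "K o2 \<noteq> 0"
    "\<And>q. q \<in> cspace 2 \<Longrightarrow> K q \<noteq> 0 \<Longrightarrow> G q \<noteq> 0 \<and> f q = F q / G q"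
    using loc[of o2] unfolding o2_def by auto
  have G0: "G o2 \<noteq> 0" using FGK(4,5) o2_def by simp
  then have FG0: "\<exists>x. F x \<noteq> 0 \<or> G x \<noteq> 0" by blast
  obtain D F' G' where c: "D \<in> polys 3" "lowest_terms F' G'" "\<forall>x. F x = D x * F' x" "\<forall>x. G x = D x * G' x"
    using polys3_cofactors[OF p23[OF FGK(1)] p23[OF FGK(2)] FG0] by blast
  then have c': "F' \<in> polys 3" "G' \<in> polys 3" unfolding lowest_terms_def by auto
  have D: "D o2 \<noteq> 0" using c(4) G0 by auto
  have G': "G' p \<noteq> 0 \<and> f p = F' p / G' p" if p: "p \<in> cspace 2" for p
  proof -
    obtain A B L where l: "A \<in> polys 2" "B \<in> polys 2" "L \<in> polys 2" "L p \<noteq> 0"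
      "\<And>q. q \<in> cspace 2 \<Longrightarrow> L q \<noteq> 0 \<Longrightarrow> B q \<noteq> 0 \<and> f q = A q / B q"
      using loc[OF p] by blast
    have KL: "K x * (L x * (F x * B x)) = K x * (L x * (G x * A x))" for x
    proof -
      let ?x = "vec2 (x 0) (x 1)"
      have "K ?x * (L ?x * (F ?x * B ?x)) = K ?x * (L ?x * (G ?x * A ?x))"
        using FGK(5)[of ?x] l(5)[of ?x] by (cases "K ?x = 0"; cases "L ?x = 0") (auto simp: field_simps)
      then show ?thesis using trunc FGK(1-3) l(1-3) by metis
    qed
    have L: "L x * (F x * B x) = L x * (G x * A x)" for x
      by (rule polys_cancel[OF FGK(3) _ _ KL FGK(4)]) (intro polys_mult FGK l)+
    have "F x * B x = G x * A x" for x
      by (rule polys_cancel[OF l(3) _ _ L l(4)]) (intro polys_mult FGK l)+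
    then have D': "D x * (F' x * B x) = D x * (G' x * A x)" for x using c(3,4) by (simp add: mult_ac)
    have "F' x * B x = G' x * A x" for x
      by (rule polys_cancel[OF c(1) _ _ D' D]) (intro polys_mult c c' p23 l)+
    then obtain C where "\<forall>x. B x = G' x * C x \<and> A x = F' x * C x"
      using c(2) p23[OF l(1)] p23[OF l(2)] unfolding lowest_terms_def by blast
    then show ?thesis using l(5)[OF p l(4)] by auto
  qed
  have "G' x = G' o2" if "x \<in> cspace 2" for x
    by (rule polys_nowhere_zero_const[OF c'(2), of "cspace 2"]) (use G' that in \<open>auto simp: cspace_def o2_def\<close>)
  then have f: "f x = F' (vec2 (x 0) (x 1)) / G' o2" if "x \<in> cspace 2" for x
    using G'[OF that] that cspace2_eq[OF that] by simp
  have "(\<lambda>x. F' (vec2 (x 0) (x 1))) \<in> polys 2"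
    by (rule polys_comp[OF c'(1)]) (use polys_var[of 0 2] polys_var[of 1 2] in \<open>auto simp: less_3_iff\<close>)
  then have "(\<lambda>x. F' (vec2 (x 0) (x 1)) * inverse (G' o2)) \<in> polys 2" by (intro polys_mult polys_const)
  then show ?thesis by (rule bexI[rotated]) (use f in \<open>simp add: divide_inverse\<close>)
qed

section \<open>The blown-up plane\<close>

definition P21 :: "(ppoint \<times> ppoint) set" where "P21 = proj_points 2 \<times> proj_points 1"
definition crd21 :: "ppoint \<times> ppoint \<Rightarrow> (cvec \<times> cvec) set" where "crd21 = (\<lambda>(p, q). p \<times> q)"
definition BF :: "(cvec \<times> cvec \<Rightarrow> complex) set set" where "BF = {biforms 3 2 d e | d e. True}"

lemma BF_iff: "F \<in> \<Union>BF \<longleftrightarrow> (\<exists>d e. F \<in> biforms 3 2 d e)"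
  by (auto simp: BF_def)

lemma BF_I: "F \<in> biforms 3 2 d e \<Longrightarrow> F \<in> \<Union>BF"
  unfolding BF_iff by blast

interpretation bi: zcoord P21 crd21 BF
  using zcoord_biproj[of 2 1] unfolding P21_def crd21_def BF_def
  by (simp add: numeral_2_eq_2 numeral_3_eq_3)

definition F1pts :: "(ppoint \<times> ppoint) set" where
  "F1pts = {(p, q) \<in> P21. \<forall>x\<in>p. \<forall>y\<in>q. x 0 * y 1 = x 1 * y 0}"

lemma F1pts_sub: "F1pts \<subseteq> P21" by (auto simp: F1pts_def)

lemma zsub_F1: "zsub P21 crd21 BF F1 F1pts"
proof -
  have "zsub P21 crd21 BF (biproj_space 2 1) P21"
    using bi.zsub_space unfolding biproj_space_def P21_def crd21_def BF_def
    by (simp add: numeral_2_eq_2 numeral_3_eq_3)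
  from bi.zsub_subspace[OF this F1pts_sub] show ?thesis
    unfolding F1_def F1pts_def P21_def .
qed

lemma pts_F1: "pts F1 = F1pts" using bi.zsub_pts[OF zsub_F1] .

lemma zar_F1: "zar F1 = subtopology bi.Zar F1pts" using zsub_F1 unfolding zsub_def by blast

lemma reg_F1: "openin (zar F1) U \<Longrightarrow> reg F1 U f \<longleftrightarrow> regular_on P21 crd21 BF U f"
  using zsub_F1 unfolding zsub_def by blast

definition bpt :: "cvec \<times> cvec \<Rightarrow> ppoint \<times> ppoint" where
  "bpt v = (proj_point (fst v), proj_point (snd v))"

definition bvec :: "cvec \<times> cvec \<Rightarrow> bool" where
  "bvec v \<longleftrightarrow> fst v \<in> cspace 3 \<and> fst v \<noteq> (\<lambda>_. 0) \<and> snd v \<in> cspace 2 \<and> snd v \<noteq> (\<lambda>_. 0)"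

lemma bpt_crd: "v \<in> crd21 (bpt v)"
  by (auto simp: bpt_def crd21_def case_prod_beta mem_Times_iff)

lemma bpt_P21: "bvec v \<Longrightarrow> bpt v \<in> P21"
  using proj_point_in[of _ 2] proj_point_in[of _ 1]
  by (auto simp: bvec_def bpt_def P21_def numeral_2_eq_2 numeral_3_eq_3)

lemma crd21_bpt:
  assumes "q \<in> P21" "v \<in> crd21 q"
  shows "bvec v" "q = bpt v"
proof -
  have q: "fst q \<in> proj_points 2" "snd q \<in> proj_points 1" "fst v \<in> fst q" "snd v \<in> snd q"
    using assms by (auto simp: P21_def crd21_def)
  show "bvec v" using proj_points_mem(1,2)[OF q(1,3)] proj_points_mem(1,2)[OF q(2,4)]
    by (simp add: bvec_def numeral_2_eq_2 numeral_3_eq_3)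
  show "q = bpt v" using proj_points_mem(3)[OF q(1,3)] proj_points_mem(3)[OF q(2,4)]
    by (simp add: bpt_def prod_eq_iff)
qed

lemma crd21_scale: "v \<in> crd21 (bpt w) \<longleftrightarrow>
   (\<exists>a b. a \<noteq> 0 \<and> b \<noteq> 0 \<and> v = ((\<lambda>i. a * fst w i), (\<lambda>i. b * snd w i)))"
  by (cases v) (auto simp: crd21_def bpt_def proj_point_iff)

lemma bpt_scale: "a \<noteq> 0 \<Longrightarrow> b \<noteq> 0 \<Longrightarrow> bpt ((\<lambda>i. a * fst w i), (\<lambda>i. b * snd w i)) = bpt w"
  by (simp add: bpt_def proj_point_scale)

text \<open>
  Maps are defined on points by choosing coordinate vectors; homogeneity makes the choice immaterial.
\<close>

lemma some_crd:
  assumes q: "q \<in> P21" "v \<in> crd21 q"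
    and f: "\<And>a b. a \<noteq> 0 \<Longrightarrow> b \<noteq> 0 \<Longrightarrow> f ((\<lambda>i. a * fst v i), (\<lambda>i. b * snd v i)) = f v"
  shows "f (SOME v. v \<in> crd21 q) = f v"
proof -
  have "(SOME v. v \<in> crd21 q) \<in> crd21 q" using q(2) by (rule someI)
  then obtain a b where "a \<noteq> 0" "b \<noteq> 0" "(SOME v. v \<in> crd21 q) = ((\<lambda>i. a * fst v i), (\<lambda>i. b * snd v i))"
    using crd21_bpt(2)[OF q] crd21_scale by metis
  then show ?thesis using f by simp
qed

lemma D_bpt: "F \<in> \<Union>BF \<Longrightarrow> bvec v \<Longrightarrow> bpt v \<in> bi.D F \<longleftrightarrow> F v \<noteq> 0"
  using bi.D_iff bpt_P21 bpt_crd by blast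

lemma bpt_F1: "bvec v \<Longrightarrow> bpt v \<in> F1pts \<longleftrightarrow> fst v 0 * snd v 1 = fst v 1 * snd v 0"
proof -
  assume v: "bvec v"
  show ?thesis
  proof
    assume "bpt v \<in> F1pts"
    then show "fst v 0 * snd v 1 = fst v 1 * snd v 0" unfolding F1pts_def bpt_def by auto
  next
    assume eq: "fst v 0 * snd v 1 = fst v 1 * snd v 0"
    have "x 0 * y 1 = x 1 * y 0" if xy: "x \<in> proj_point (fst v)" "y \<in> proj_point (snd v)" for x y
    proof -
      obtain a b where "x = (\<lambda>i. a * fst v i)" "y = (\<lambda>i. b * snd v i)"
        using xy unfolding proj_point_iff by blast
      then show ?thesis using eq by (metis mult.assoc mult.left_commute)
    qed
    then show "bpt v \<in> F1pts" using bpt_P21[OF v] unfolding F1pts_def bpt_def by auto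
  qed
qed

section \<open>Cox coordinates\<close>

text \<open>
  Cox coordinates: \<open>[a:b]\<close> is the point of the base and \<open>h = 0\<close> is the exceptional curve, so every point
  has the coordinate vectors \<open>x = (a h, b h, s)\<close> and \<open>y = (a, b)\<close>. They turn the equation \<open>x0 y1 = x1 y0\<close>
  into an identity and make all curves below coordinate subspaces or graphs.
\<close>

definition cox :: "complex \<Rightarrow> complex \<Rightarrow> complex \<Rightarrow> complex \<Rightarrow> cvec \<times> cvec" where
  "cox a b h s = (vec3 (a * h) (b * h) s, vec2 a b)"

definition cval :: "complex \<Rightarrow> complex \<Rightarrow> complex \<Rightarrow> complex \<Rightarrow> bool" where
  "cval a b h s \<longleftrightarrow> (a \<noteq> 0 \<or> b \<noteq> 0) \<and> (h \<noteq> 0 \<or> s \<noteq> 0)"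

abbreviation cpt :: "complex \<Rightarrow> complex \<Rightarrow> complex \<Rightarrow> complex \<Rightarrow> ppoint \<times> ppoint" where
  "cpt a b h s \<equiv> bpt (cox a b h s)"

lemma cox_sel [simp]: "fst (cox a b h s) 0 = a * h" "fst (cox a b h s) (Suc 0) = b * h"
  "fst (cox a b h s) 2 = s" "snd (cox a b h s) 0 = a" "snd (cox a b h s) (Suc 0) = b"
  by (simp_all add: cox_def)

lemma cval_bvec: "cval a b h s \<Longrightarrow> bvec (cox a b h s)"
  by (auto simp: bvec_def cox_def cval_def vec2_zero vec3_zero)

lemma cpt_F1: "cval a b h s \<Longrightarrow> cpt a b h s \<in> F1pts"
  by (simp add: bpt_F1 cval_bvec)

lemma F1_vec:
  assumes "q \<in> F1pts" "v \<in> crd21 q"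
  shows "\<exists>a b h s. cval a b h s \<and> v = cox a b h s"
proof -
  have q: "q \<in> P21" using assms F1pts_sub by blast
  note v = crd21_bpt[OF q assms(2)]
  have eq: "fst v 0 * snd v 1 = fst v 1 * snd v 0" using assms v bpt_F1 by simp
  obtain x y where xy: "v = (x, y)" by (cases v)
  have x: "x = vec3 (x 0) (x 1) (x 2)" and y: "y = vec2 (y 0) (y 1)"
    using cspace3_eq cspace2_eq v(1) xy by (auto simp: bvec_def)
  have y0: "y 0 \<noteq> 0 \<or> y 1 \<noteq> 0" using v(1) xy y vec2_zero unfolding bvec_def by (metis snd_conv)
  have x0: "x 0 \<noteq> 0 \<or> x 1 \<noteq> 0 \<or> x 2 \<noteq> 0" using v(1) xy x vec3_zero unfolding bvec_def by (metis fst_conv)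
  define h where "h = (if y 0 \<noteq> 0 then x 0 / y 0 else x 1 / y 1)"
  have h: "x 0 = y 0 * h" "x 1 = y 1 * h" using eq y0 xy by (auto simp: h_def field_simps)
  have "v = cox (y 0) (y 1) h (x 2)" unfolding cox_def xy using x y h by simp
  moreover have "cval (y 0) (y 1) h (x 2)" unfolding cval_def using y0 x0 h by auto
  ultimately show ?thesis by blast
qed

lemma F1_cpt: "q \<in> F1pts \<Longrightarrow> \<exists>a b h s. cval a b h s \<and> q = cpt a b h s"
proof -
  assume q: "q \<in> F1pts"
  then have q': "q \<in> P21" using F1pts_sub by blast
  then obtain v where v: "v \<in> crd21 q" using bi.crd_nonempty by blast
  show ?thesis using F1_vec[OF q v] crd21_bpt(2)[OF q' v] by blast
qed

lemma D_cpt: "F \<in> \<Union>BF \<Longrightarrow> cval a b h s \<Longrightarrow> cpt a b h s \<in> bi.D F \<longleftrightarrow> F (cox a b h s) \<noteq> 0"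
  by (simp add: D_bpt cval_bvec)

lemma BF_cox_polys:
  assumes "F \<in> \<Union>BF" "A \<in> polys k" "B \<in> polys k" "H \<in> polys k" "S \<in> polys k"
  shows "(\<lambda>w. F (cox (A w) (B w) (H w) (S w))) \<in> polys k"
proof -
  obtain d e where F: "F \<in> biforms 3 2 d e" using assms(1) BF_iff by blast
  show ?thesis
    by (rule biforms_comp_polys[OF F])
       (use assms(2-5) in \<open>auto simp: less_3_iff less_2_iff intro: polys_mult\<close>)
qed

definition locus :: "(cvec \<times> cvec \<Rightarrow> complex) \<Rightarrow> (ppoint \<times> ppoint) set" where
  "locus F = {q \<in> F1pts. \<forall>v\<in>crd21 q. F v = 0}"

lemma closedin_locus: "F \<in> \<Union>BF \<Longrightarrow> closedin (zar F1) (locus F)"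
  unfolding zar_F1 locus_def using bi.closedin_zeros[OF F1pts_sub] .

lemma locus_eq: "F \<in> \<Union>BF \<Longrightarrow> locus F = F1pts - bi.D F"
  unfolding locus_def using bi.D_not F1pts_sub by blast

lemma cpt_locus: "F \<in> \<Union>BF \<Longrightarrow> cval a b h s \<Longrightarrow> cpt a b h s \<in> locus F \<longleftrightarrow> F (cox a b h s) = 0"
  by (simp add: locus_eq D_cpt cpt_F1)

text \<open>
  If the product of two biforms vanishes on \<open>C\<close>, then so does its pullback to the parameters with
  \<open>N w \<noteq> 0\<close>. These are Zariski dense, so the pullback of one of the biforms is the zero polynomial.
\<close>

lemma irreducible_param:
  assumes cl: "closedin (zar F1) C"
    and par: "\<And>a b h s. cval a b h s \<Longrightarrow> cpt a b h s \<in> C \<longleftrightarrow> (\<exists>w. a = A w \<and> b = B w \<and> h = H w \<and> s = S w)"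
    and poly: "A \<in> polys k" "B \<in> polys k" "H \<in> polys k" "S \<in> polys k"
    and N: "N \<in> polys k" "N w0 \<noteq> 0" "\<And>w. N w \<noteq> 0 \<Longrightarrow> cval (A w) (B w) (H w) (S w)"
  shows "irreducible_closed F1 C"
proof -
  have "C \<inter> bi.D F = {} \<or> C \<inter> bi.D G = {}"
    if FG: "F \<in> \<Union>BF" "G \<in> \<Union>BF" "C \<inter> bi.D F \<inter> bi.D G = {}" for F G
  proof -
    let ?F = "\<lambda>w. F (cox (A w) (B w) (H w) (S w))" and ?G = "\<lambda>w. G (cox (A w) (B w) (H w) (S w))"
    have p: "?F \<in> polys k" "?G \<in> polys k" using BF_cox_polys FG poly by blast+
    have "N w * (?F w * ?G w) = 0" for w
    proof (cases "N w = 0")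
      case False
      then have v: "cval (A w) (B w) (H w) (S w)" by (rule N(3))
      moreover have "cpt (A w) (B w) (H w) (S w) \<in> C" using par[OF v] by blast
      ultimately have "?F w = 0 \<or> ?G w = 0" using FG D_cpt by blast
      then show ?thesis by auto
    qed simp
    from polys_integral[OF N(1) polys_mult[OF p] this] N(2) have "?F w * ?G w = 0" for w by blast
    from polys_integral[OF p this] have "(\<forall>w. ?F w = 0) \<or> (\<forall>w. ?G w = 0)" .
    moreover have "C \<inter> bi.D E = {}" if E: "E \<in> \<Union>BF" "\<forall>w. E (cox (A w) (B w) (H w) (S w)) = 0" for E
    proof -
      { fix q assume q: "q \<in> C" "q \<in> bi.D E"
        then have "q \<in> F1pts" using closedin_subset[OF cl] pts_F1 by blast
        then obtain a b h s where *: "cval a b h s" "q = cpt a b h s" using F1_cpt by blast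
        then obtain w where "a = A w" "b = B w" "h = H w" "s = S w" using q(1) par by blast
        then have False using q(2) * D_cpt[OF E(1)] E(2) by blast }
      then show ?thesis by blast
    qed
    ultimately show ?thesis using FG(1,2) by blast
  qed
  moreover have "C \<noteq> {}" using par[OF N(3)[OF N(2)]] by blast
  ultimately show ?thesis unfolding bi.irreducible_closed_iff[OF F1pts_sub zar_F1] using cl by blast
qed

text \<open>
  The exceptional curve, the fibres over the two points \<open>[0:1]\<close> and \<open>[1:0]\<close> that are totally invariant
  under squaring, and the sections \<open>s = c a h\<close>, which are strict transforms of lines.
\<close>

definition curveE :: "(ppoint \<times> ppoint) set" where
  "curveE = locus (\<lambda>v. fst v 0) \<inter> locus (\<lambda>v. fst v 1)"
definition fib0 :: "(ppoint \<times> ppoint) set" where "fib0 = locus (\<lambda>v. snd v 0)"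
definition fib1 :: "(ppoint \<times> ppoint) set" where "fib1 = locus (\<lambda>v. snd v 1)"
definition sectionW :: "complex \<Rightarrow> (ppoint \<times> ppoint) set" where
  "sectionW c = locus (\<lambda>v. fst v 2 - c * fst v 0)"

lemma BF_coords: "(\<lambda>v. fst v 0) \<in> \<Union>BF" "(\<lambda>v. fst v 1) \<in> \<Union>BF" "(\<lambda>v. snd v 0) \<in> \<Union>BF"
  "(\<lambda>v. snd v 1) \<in> \<Union>BF" "(\<lambda>v. fst v 2 - c * fst v 0) \<in> \<Union>BF"
  by (rule BF_I[OF biforms_x] BF_I[OF biforms_y] BF_I[OF biforms_diff[OF biforms_x biforms_cmult[OF biforms_x]]]; simp)+

lemma cpt_curveE: "cval a b h s \<Longrightarrow> cpt a b h s \<in> curveE \<longleftrightarrow> h = 0"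
  using cpt_locus[OF BF_coords(1)] cpt_locus[OF BF_coords(2)] by (auto simp: curveE_def cval_def)
lemma cpt_fib0: "cval a b h s \<Longrightarrow> cpt a b h s \<in> fib0 \<longleftrightarrow> a = 0"
  using cpt_locus[OF BF_coords(3)] by (auto simp: fib0_def)
lemma cpt_fib1: "cval a b h s \<Longrightarrow> cpt a b h s \<in> fib1 \<longleftrightarrow> b = 0"
  using cpt_locus[OF BF_coords(4)] by (auto simp: fib1_def)
lemma cpt_sectionW: "cval a b h s \<Longrightarrow> cpt a b h s \<in> sectionW c \<longleftrightarrow> s = c * (a * h)"
  using cpt_locus[OF BF_coords(5)] by (auto simp: sectionW_def)

lemma locus_sub: "curveE \<subseteq> F1pts" "fib0 \<subseteq> F1pts" "fib1 \<subseteq> F1pts" "sectionW c \<subseteq> F1pts"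
  by (auto simp: locus_def curveE_def fib0_def fib1_def sectionW_def)

lemma irr_F1: "irreducible_closed F1 F1pts"
proof (rule irreducible_param[where A = "\<lambda>w. w 0" and B = "\<lambda>w. w 1" and H = "\<lambda>w. w 2" and S = "\<lambda>w. w 3"
      and N = "\<lambda>w. w 0 * w 2" and k = 4 and ?w0.0 = "\<lambda>_. 1"])
  show "closedin (zar F1) F1pts" using closedin_topspace[of "zar F1"] pts_F1 by simp
  show "cpt a b h s \<in> F1pts \<longleftrightarrow> (\<exists>w::cvec. a = w 0 \<and> b = w 1 \<and> h = w 2 \<and> s = w 3)" if "cval a b h s" for a b h s
    using cpt_F1[OF that]
    by (auto intro!: exI[of _ "\<lambda>i. if i = 0 then a else if i = 1 then b else if i = 2 then h else s"])
qed (auto intro!: polys_mult polys_var simp: cval_def)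

lemma irr_curveE: "irreducible_closed F1 curveE"
proof (rule irreducible_param[where A = "\<lambda>w. w 0" and B = "\<lambda>w. w 1" and H = "\<lambda>w. 0" and S = "\<lambda>w. w 2"
      and N = "\<lambda>w. w 0 * w 2" and k = 3 and ?w0.0 = "\<lambda>_. 1"])
  show "closedin (zar F1) curveE" unfolding curveE_def by (intro closedin_Int closedin_locus BF_coords)
  show "cpt a b h s \<in> curveE \<longleftrightarrow> (\<exists>w::cvec. a = w 0 \<and> b = w 1 \<and> h = 0 \<and> s = w 2)" if "cval a b h s" for a b h s
    using cpt_curveE[OF that] by (auto intro!: exI[of _ "vec3 a b s"])
qed (auto intro!: polys_mult polys_var simp: cval_def)

lemma irr_fib0: "irreducible_closed F1 fib0"
proof (rule irreducible_param[where A = "\<lambda>w. 0" and B = "\<lambda>w. w 0" and H = "\<lambda>w. w 1" and S = "\<lambda>w. w 2"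
      and N = "\<lambda>w. w 0 * w 2" and k = 3 and ?w0.0 = "\<lambda>_. 1"])
  show "closedin (zar F1) fib0" unfolding fib0_def by (intro closedin_locus BF_coords)
  show "cpt a b h s \<in> fib0 \<longleftrightarrow> (\<exists>w::cvec. a = 0 \<and> b = w 0 \<and> h = w 1 \<and> s = w 2)" if "cval a b h s" for a b h s
    using cpt_fib0[OF that] by (auto intro!: exI[of _ "vec3 b h s"])
qed (auto intro!: polys_mult polys_var simp: cval_def)

lemma irr_fib1: "irreducible_closed F1 fib1"
proof (rule irreducible_param[where A = "\<lambda>w. w 0" and B = "\<lambda>w. 0" and H = "\<lambda>w. w 1" and S = "\<lambda>w. w 2"
      and N = "\<lambda>w. w 0 * w 2" and k = 3 and ?w0.0 = "\<lambda>_. 1"])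
  show "closedin (zar F1) fib1" unfolding fib1_def by (intro closedin_locus BF_coords)
  show "cpt a b h s \<in> fib1 \<longleftrightarrow> (\<exists>w::cvec. a = w 0 \<and> b = 0 \<and> h = w 1 \<and> s = w 2)" if "cval a b h s" for a b h s
    using cpt_fib1[OF that] by (auto intro!: exI[of _ "vec3 a h s"])
qed (auto intro!: polys_mult polys_var simp: cval_def)

lemma irr_sectionW: "irreducible_closed F1 (sectionW c)"
proof (rule irreducible_param[where A = "\<lambda>w. w 0" and B = "\<lambda>w. w 1" and H = "\<lambda>w. w 2"
      and S = "\<lambda>w. c * (w 0 * w 2)" and N = "\<lambda>w. w 0 * w 2" and k = 3 and ?w0.0 = "\<lambda>_. 1"])
  show "closedin (zar F1) (sectionW c)" unfolding sectionW_def by (intro closedin_locus BF_coords)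
  show "cpt a b h s \<in> sectionW c \<longleftrightarrow> (\<exists>w::cvec. a = w 0 \<and> b = w 1 \<and> h = w 2 \<and> s = c * (w 0 * w 2))"
    if "cval a b h s" for a b h s
    using cpt_sectionW[OF that] by (auto intro!: exI[of _ "vec3 a b h"])
qed (auto intro!: polys_mult polys_var polys_const simp: cval_def)

lemma proportional:
  fixes x y :: cvec
  assumes "x \<in> cspace n" "y \<in> cspace n" "x \<noteq> (\<lambda>_. 0)" "y \<noteq> (\<lambda>_. 0)"
    and minors: "\<And>i j. i < n \<Longrightarrow> j < n \<Longrightarrow> x i * y j = x j * y i"
  shows "\<exists>c. c \<noteq> 0 \<and> x = (\<lambda>i. c * y i)"
proof -
  have m: "x i * y j = x j * y i" for i j
    using minors[of i j] assms(1,2) by (cases "i < n"; cases "j < n") (auto simp: cspace_def)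
  obtain i where i: "x i \<noteq> 0" using assms(3) by auto
  obtain j where "y j \<noteq> 0" using assms(4) by auto
  then have "y i \<noteq> 0" using m[of i j] i by auto
  then have "x = (\<lambda>j. x i / y i * y j)" using m[of i] by (auto simp: fun_eq_iff field_simps)
  then show ?thesis using i \<open>y i \<noteq> 0\<close> by (intro exI[of _ "x i / y i"]) auto
qed

text \<open>
  Two points are equal as soon as the 2 by 2 minors of their coordinate vectors vanish, and the minors
  are biforms in the coordinates of one of the points.
\<close>

lemma irr_point:
  assumes "q \<in> F1pts" shows "irreducible_closed F1 {q}"
proof -
  have qP: "q \<in> P21" using assms F1pts_sub by blast
  have "\<exists>F\<in>\<Union>BF. p \<in> bi.D F \<and> bi.D F \<inter> {q} = {}" if p: "p \<in> F1pts - {q}" for p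
  proof -
    obtain v where v: "v \<in> crd21 q" using bi.crd_nonempty[OF qP] by blast
    obtain w where w: "w \<in> crd21 p" using bi.crd_nonempty[of p] p F1pts_sub by blast
    have pP: "p \<in> P21" using p F1pts_sub by blast
    note v' = crd21_bpt[OF qP v] and w' = crd21_bpt[OF pP w]
    show ?thesis
    proof (rule ccontr)
      assume no: "\<not> ?thesis"
      have dt: "F w = 0" if "F \<in> \<Union>BF" "F v = 0" for F
        using no bi.D_iff[OF that(1) pP w] bi.D_iff[OF that(1) qP v] that by blast
      have "fst w i * fst v j = fst w j * fst v i" if "i < 3" "j < 3" for i j
      proof -
        have "(\<lambda>u. fst v j * fst u i - fst v i * fst u j) \<in> \<Union>BF"
          using that by (intro BF_I[OF biforms_diff[OF biforms_cmult[OF biforms_x] biforms_cmult[OF biforms_x]]])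
        from dt[OF this] show ?thesis by (simp add: mult.commute)
      qed
      then obtain c where c: "c \<noteq> 0" "fst w = (\<lambda>i. c * fst v i)"
        using proportional[of "fst w" 3 "fst v"] v' w' unfolding bvec_def by blast
      have "snd w i * snd v j = snd w j * snd v i" if "i < 2" "j < 2" for i j
      proof -
        have "(\<lambda>u. snd v j * snd u i - snd v i * snd u j) \<in> \<Union>BF"
          using that by (intro BF_I[OF biforms_diff[OF biforms_cmult[OF biforms_y] biforms_cmult[OF biforms_y]]])
        from dt[OF this] show ?thesis by (simp add: mult.commute)
      qed
      then obtain d where d: "d \<noteq> 0" "snd w = (\<lambda>i. d * snd v i)"
        using proportional[of "snd w" 2 "snd v"] v' w' unfolding bvec_def by blast
      have "w = ((\<lambda>i. c * fst v i), (\<lambda>i. d * snd v i))" using c d by (simp add: prod_eq_iff)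
      then have "bpt w = bpt v" using bpt_scale c d by simp
      then show False using p v' w' by simp
    qed
  qed
  then have "closedin (zar F1) {q}" unfolding bi.closedin_zsub[OF zsub_F1] using assms by blast
  then show ?thesis unfolding irreducible_closed_def by blast
qed

section \<open>Homogenization in two variables\<close>

text \<open>
  \<open>F\<close> is the function \<open>P (a / b, c / e)\<close> with its denominators cleared.
\<close>

definition homogenization :: "(cvec \<times> cvec \<Rightarrow> complex) \<Rightarrow> (cvec \<times> cvec \<Rightarrow> complex) \<Rightarrow>
    (cvec \<times> cvec \<Rightarrow> complex) \<Rightarrow> (cvec \<times> cvec \<Rightarrow> complex) \<Rightarrow> nat \<Rightarrow>
    (cvec \<times> cvec \<Rightarrow> complex) \<Rightarrow> (cvec \<Rightarrow> complex) \<Rightarrow> bool" where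
  "homogenization a b c e n F P \<longleftrightarrow> F \<in> biforms 3 2 n n \<and>
     (\<forall>v. b v \<noteq> 0 \<longrightarrow> e v \<noteq> 0 \<longrightarrow> F v = (b v * e v) ^ n * P (vec2 (a v / b v) (c v / e v)))"

text \<open>
  All large exponents are allowed, so that two polynomials can be homogenized with the same exponent.
\<close>

lemma homogenize:
  assumes P: "P \<in> polys 2" and ab: "a \<in> biforms 3 2 0 1" "b \<in> biforms 3 2 0 1"
    and ce: "c \<in> biforms 3 2 1 0" "e \<in> biforms 3 2 1 0"
  shows "\<exists>m. \<forall>n\<ge>m. \<exists>F. homogenization a b c e n F P"
proof -
  have be: "(\<lambda>v. b v * e v) \<in> biforms 3 2 1 1" using biforms_mult[OF ab(2) ce(2)] by simp
  have ae: "(\<lambda>v. a v * e v) \<in> biforms 3 2 1 1" using biforms_mult[OF ab(1) ce(2)] by simp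
  have bc: "(\<lambda>v. b v * c v) \<in> biforms 3 2 1 1" using biforms_mult[OF ab(2) ce(1)] by simp
  show ?thesis using P unfolding polys_def
  proof induction
    case (const k)
    have "homogenization a b c e n (\<lambda>v. k * (b v * e v) ^ n) (\<lambda>_. k)" for n
      using biforms_cmult[OF biforms_power[OF be, of n]] by (simp add: homogenization_def)
    then show ?case by blast
  next
    case (gen g)
    have h: "homogenization a b c e n (\<lambda>v. L v * (b v * e v) ^ (n - 1)) P"
      if L: "L \<in> biforms 3 2 1 1" and n: "n \<ge> 1"
        and P: "\<And>v. b v \<noteq> 0 \<Longrightarrow> e v \<noteq> 0 \<Longrightarrow> L v = (b v * e v) * P (vec2 (a v / b v) (c v / e v))" for L n P
    proof -
      have "(\<lambda>v. L v * (b v * e v) ^ (n - 1)) \<in> biforms 3 2 n n"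
        using biforms_mult[OF L biforms_power[OF be, of "n - 1"]] n by simp
      then show ?thesis using n by (cases n) (auto simp: homogenization_def P)
    qed
    obtain i where "i < 2" and g: "g = (\<lambda>x. x i)" using gen by auto
    then consider "i = 0" | "i = 1" by linarith
    then show ?case
    proof cases
      case 1
      then have "homogenization a b c e n (\<lambda>v. a v * e v * (b v * e v) ^ (n - 1)) g" if "n \<ge> 1" for n
        by (intro h[OF ae that]) (simp add: g)
      then show ?thesis by blast
    next
      case 2
      then have "homogenization a b c e n (\<lambda>v. b v * c v * (b v * e v) ^ (n - 1)) g" if "n \<ge> 1" for n
        by (intro h[OF bc that]) (simp add: g)
      then show ?thesis by blast
    qed
  next
    case (add F G)
    then obtain m1 m2 where m: "\<forall>n\<ge>m1. \<exists>H. homogenization a b c e n H F"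
      "\<forall>n\<ge>m2. \<exists>H. homogenization a b c e n H G" by blast
    show ?case
    proof (intro exI[of _ "max m1 m2"] allI impI)
      fix n assume "n \<ge> max m1 m2"
      then obtain H1 H2 where "homogenization a b c e n H1 F" "homogenization a b c e n H2 G"
        using m by (metis max.bounded_iff)
      then have "homogenization a b c e n (\<lambda>v. H1 v + H2 v) (\<lambda>x. F x + G x)"
        unfolding homogenization_def by (simp add: biforms_add distrib_left)
      then show "\<exists>H. homogenization a b c e n H (\<lambda>x. F x + G x)" by blast
    qed
  next
    case (mult F G)
    then obtain m1 m2 where m: "\<forall>n\<ge>m1. \<exists>H. homogenization a b c e n H F"
      "\<forall>n\<ge>m2. \<exists>H. homogenization a b c e n H G" by blast
    show ?case
    proof (intro exI[of _ "m1 + m2"] allI impI)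
      fix n assume n: "n \<ge> m1 + m2"
      then have "m2 \<le> n - m1" by simp
      then obtain H1 H2 where H: "homogenization a b c e m1 H1 F" "homogenization a b c e (n - m1) H2 G"
        using m by blast
      have "(\<lambda>v. H1 v * H2 v) \<in> biforms 3 2 n n"
        using H biforms_mult[of H1 3 2 m1 m1 H2 "n - m1" "n - m1"] n unfolding homogenization_def by simp
      moreover have "(b v * e v) ^ n = (b v * e v) ^ m1 * (b v * e v) ^ (n - m1)" for v
        using n by (simp flip: power_add)
      ultimately have "homogenization a b c e n (\<lambda>v. H1 v * H2 v) (\<lambda>x. F x * G x)"
        using H unfolding homogenization_def by (simp add: mult_ac)
      then show "\<exists>H. homogenization a b c e n H (\<lambda>x. F x * G x)" by blast
    qed
  qed
qed

section \<open>Affine charts\<close>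

text \<open>
  Each chart is the complement of a fibre and of a section of the ruling. The flag \<open>j\<close>
  chooses the coordinate of the base that is invertible; \<open>t\<close> tells whether the exceptional curve or the
  section \<open>x2 = \<epsilon> x0\<close> is removed. The parameter \<open>\<epsilon>\<close> is 1 on the target of the endomorphism and 0 on its
  source.
\<close>

definition ynum :: "bool \<Rightarrow> cvec \<times> cvec \<Rightarrow> complex" where "ynum j v = snd v (if j then 1 else 0)"
definition yden :: "bool \<Rightarrow> cvec \<times> cvec \<Rightarrow> complex" where "yden j v = snd v (if j then 0 else 1)"
definition xc :: "bool \<Rightarrow> cvec \<times> cvec \<Rightarrow> complex" where "xc j v = fst v (if j then 0 else 1)"
definition xs :: "complex \<Rightarrow> cvec \<times> cvec \<Rightarrow> complex" where "xs \<epsilon> v = fst v 2 - \<epsilon> * fst v 0"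
definition xnum :: "bool \<Rightarrow> bool \<Rightarrow> complex \<Rightarrow> cvec \<times> cvec \<Rightarrow> complex" where
  "xnum j t \<epsilon> v = (if t then xs \<epsilon> v else xc j v)"
definition xden :: "bool \<Rightarrow> bool \<Rightarrow> complex \<Rightarrow> cvec \<times> cvec \<Rightarrow> complex" where
  "xden j t \<epsilon> v = (if t then xc j v else xs \<epsilon> v)"

lemma chart_biforms: "ynum j \<in> biforms 3 2 0 1" "yden j \<in> biforms 3 2 0 1"
  "xnum j t \<epsilon> \<in> biforms 3 2 1 0" "xden j t \<epsilon> \<in> biforms 3 2 1 0"
proof -
  have 1: "xs \<epsilon> \<in> biforms 3 2 1 0"
    unfolding xs_def[abs_def] by (intro biforms_diff biforms_cmult biforms_x) auto
  have 2: "xc j \<in> biforms 3 2 1 0" unfolding xc_def[abs_def] by (intro biforms_x) auto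
  show "xnum j t \<epsilon> \<in> biforms 3 2 1 0" "xden j t \<epsilon> \<in> biforms 3 2 1 0"
    unfolding xnum_def[abs_def] xden_def[abs_def] using 1 2 by (cases t; simp)+
  show "ynum j \<in> biforms 3 2 0 1" "yden j \<in> biforms 3 2 0 1"
    unfolding ynum_def[abs_def] yden_def[abs_def] by (intro biforms_y; simp)+
qed

definition chden :: "bool \<Rightarrow> bool \<Rightarrow> complex \<Rightarrow> cvec \<times> cvec \<Rightarrow> complex" where
  "chden j t \<epsilon> v = yden j v * xden j t \<epsilon> v"

lemma chden_BF: "chden j t \<epsilon> \<in> \<Union>BF"
  unfolding chden_def[abs_def] by (rule BF_I[OF biforms_mult[OF chart_biforms(2,4)]])

definition chart :: "bool \<Rightarrow> bool \<Rightarrow> complex \<Rightarrow> (ppoint \<times> ppoint) set" where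
  "chart j t \<epsilon> = F1pts \<inter> bi.D (chden j t \<epsilon>)"

definition chcoord :: "bool \<Rightarrow> bool \<Rightarrow> complex \<Rightarrow> cvec \<times> cvec \<Rightarrow> cvec" where
  "chcoord j t \<epsilon> v = vec2 (ynum j v / yden j v) (xnum j t \<epsilon> v / xden j t \<epsilon> v)"

definition chpar :: "bool \<Rightarrow> bool \<Rightarrow> complex \<Rightarrow> cvec \<Rightarrow> cvec \<times> cvec" where
  "chpar j t \<epsilon> u = (let a = (if j then 1 else u 0); b = (if j then u 0 else 1);
      h = (if t then 1 else u 1); s = (if t then u 1 else 1) in cox a b h (s + \<epsilon> * (a * h)))"

lemma chpar_cox: "\<exists>a b h s. cval a b h s \<and> chpar j t \<epsilon> u = cox a b h s"
proof -
  let ?a = "if j then 1 else u 0" and ?b = "if j then u 0 else 1"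
    and ?h = "if t then 1 else u 1" and ?s = "if t then u 1 else 1"
  have "cval ?a ?b ?h (?s + \<epsilon> * (?a * ?h))" by (auto simp: cval_def)
  then show ?thesis unfolding chpar_def Let_def by blast
qed

lemma chpar_bvec: "bvec (chpar j t \<epsilon> u)" and chpar_F1: "bpt (chpar j t \<epsilon> u) \<in> F1pts"
  using chpar_cox[of j t \<epsilon> u] cval_bvec cpt_F1 by metis+

lemma chpar_den: "chden j t \<epsilon> (chpar j t \<epsilon> u) \<noteq> 0"
  by (auto simp: chden_def yden_def xden_def xc_def xs_def chpar_def Let_def)

lemma chpar_chart: "bpt (chpar j t \<epsilon> u) \<in> chart j t \<epsilon>"
  unfolding chart_def using chpar_F1 D_bpt[OF chden_BF chpar_bvec] chpar_den by blast

lemma chcoord_chpar: "u \<in> cspace 2 \<Longrightarrow> chcoord j t \<epsilon> (chpar j t \<epsilon> u) = u"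
proof -
  assume "u \<in> cspace 2"
  then have u: "u = vec2 (u 0) (u 1)" using cspace2_eq by simp
  have "chcoord j t \<epsilon> (chpar j t \<epsilon> u) = vec2 (u 0) (u 1)"
    by (cases j; cases t) (simp_all add: chcoord_def ynum_def yden_def xnum_def xden_def xc_def xs_def chpar_def Let_def)
  then show ?thesis using u by simp
qed

lemma chcoord_scale:
  "a \<noteq> 0 \<Longrightarrow> b \<noteq> 0 \<Longrightarrow> chcoord j t \<epsilon> ((\<lambda>i. a * fst w i), (\<lambda>i. b * snd w i)) = chcoord j t \<epsilon> w"
proof -
  assume ab: "a \<noteq> 0" "b \<noteq> 0"
  have "xs \<epsilon> ((\<lambda>i. a * fst w i), (\<lambda>i. b * snd w i)) = a * xs \<epsilon> w" by (simp add: xs_def algebra_simps)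
  then show ?thesis using ab
    by (cases j; cases t) (simp_all add: chcoord_def ynum_def yden_def xnum_def xden_def xc_def)
qed

lemma chart_mem: "q \<in> chart j t \<epsilon> \<Longrightarrow> v \<in> crd21 q \<Longrightarrow> yden j v \<noteq> 0 \<and> xden j t \<epsilon> v \<noteq> 0"
  using bi.D_iff[OF chden_BF, of q v] F1pts_sub unfolding chart_def chden_def by auto

lemma chart_par:
  assumes q: "q \<in> chart j t \<epsilon>" and v: "v \<in> crd21 q"
  shows "chpar j t \<epsilon> (chcoord j t \<epsilon> v) \<in> crd21 q"
proof -
  have q': "q \<in> F1pts" using q by (simp add: chart_def)
  obtain a b h s where *: "v = cox a b h s" using F1_vec[OF q' v] by blast
  have nz: "yden j v \<noteq> 0" "xden j t \<epsilon> v \<noteq> 0" using chart_mem[OF q v] by auto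
  have q2: "q = bpt v" using crd21_bpt(2) v q' F1pts_sub by blast
  let ?w = "chpar j t \<epsilon> (chcoord j t \<epsilon> v)"
  have "?w = ((\<lambda>i. inverse (xden j t \<epsilon> v) * fst v i), (\<lambda>i. inverse (yden j v) * snd v i))"
    using nz unfolding * chcoord_def chpar_def Let_def cox_def
    by (cases j; cases t)
      (auto simp: ynum_def yden_def xnum_def xden_def xc_def xs_def prod_eq_iff vec2_def vec3_def
         fun_eq_iff field_simps)
  then show ?thesis unfolding q2 crd21_scale using nz by (metis inverse_nonzero_iff_nonzero)
qed

lemma chart_cover:
  assumes "q \<in> F1pts" shows "\<exists>j t. q \<in> chart j t \<epsilon>"
proof -
  obtain a b h s where *: "cval a b h s" "q = cpt a b h s" using F1_cpt assms by blast
  have D: "q \<in> chart j t \<epsilon> \<longleftrightarrow> chden j t \<epsilon> (cox a b h s) \<noteq> 0" for j t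
    unfolding chart_def using assms * D_cpt[OF chden_BF] by simp
  consider "a \<noteq> 0" | "a = 0" "b \<noteq> 0" using * by (auto simp: cval_def)
  then show ?thesis
  proof cases
    case 1
    then have "chden True True \<epsilon> (cox a b h s) \<noteq> 0 \<or> chden True False \<epsilon> (cox a b h s) \<noteq> 0"
      using * by (auto simp: cval_def chden_def yden_def xden_def xc_def xs_def)
    then show ?thesis using D by blast
  next
    case 2
    then have "chden False True \<epsilon> (cox a b h s) \<noteq> 0 \<or> chden False False \<epsilon> (cox a b h s) \<noteq> 0"
      using * by (auto simp: cval_def chden_def yden_def xden_def xc_def xs_def)
    then show ?thesis using D by blast
  qed
qed

lemma BF_chpar_polys: "F \<in> \<Union>BF \<Longrightarrow> (\<lambda>u. F (chpar j t \<epsilon> u)) \<in> polys 2"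
  unfolding chpar_def Let_def
  by (erule BF_cox_polys) (cases j; cases t; auto intro!: polys_intros)+

lemma chart_homogenize:
  assumes "P \<in> polys 2"
  shows "\<exists>m. \<forall>n\<ge>m. \<exists>F\<in>biforms 3 2 n n. \<forall>q\<in>chart j t \<epsilon>. \<forall>v\<in>crd21 q.
    F v = chden j t \<epsilon> v ^ n * P (chcoord j t \<epsilon> v)"
proof -
  obtain m where m: "\<forall>n\<ge>m. \<exists>F. homogenization (ynum j) (yden j) (xnum j t \<epsilon>) (xden j t \<epsilon>) n F P"
    using homogenize[OF assms chart_biforms] by blast
  have "\<exists>F\<in>biforms 3 2 n n. \<forall>q\<in>chart j t \<epsilon>. \<forall>v\<in>crd21 q. F v = chden j t \<epsilon> v ^ n * P (chcoord j t \<epsilon> v)"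
    if n: "n \<ge> m" for n
  proof -
    obtain F where "homogenization (ynum j) (yden j) (xnum j t \<epsilon>) (xden j t \<epsilon>) n F P" using m n by blast
    then show ?thesis unfolding homogenization_def chden_def chcoord_def
      by (intro bexI[of _ F]) (use chart_mem in blast)+
  qed
  then show ?thesis by blast
qed

lemma BF_of_poly:
  assumes "P \<in> polys 2"
  shows "\<exists>F\<in>\<Union>BF. \<forall>q\<in>chart j t \<epsilon>. \<forall>v\<in>crd21 q. F v = 0 \<longleftrightarrow> P (chcoord j t \<epsilon> v) = 0"
proof -
  obtain m F where F: "F \<in> biforms 3 2 m m" "\<forall>q\<in>chart j t \<epsilon>. \<forall>v\<in>crd21 q. F v = chden j t \<epsilon> v ^ m * P (chcoord j t \<epsilon> v)"
    using chart_homogenize[OF assms, of j t \<epsilon>] by blast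
  show ?thesis by (rule bexI[OF _ BF_I[OF F(1)]]) (use F(2) chart_mem in \<open>auto simp: chden_def\<close>)
qed

section \<open>The dimension of the surface\<close>

text \<open>
  Gaussian elimination. An equation with a nonzero coefficient eliminates one unknown; otherwise it
  can be dropped.
\<close>

lemma homogeneous_system:
  fixes a :: "'i \<Rightarrow> 'j \<Rightarrow> complex"
  assumes "finite J" "finite I" "card J < card I"
  shows "\<exists>c. (\<exists>i\<in>I. c i \<noteq> 0) \<and> (\<forall>j\<in>J. (\<Sum>i\<in>I. c i * a i j) = 0)"
  using assms
proof (induction J arbitrary: I a rule: finite_induct)
  case empty
  then have "I \<noteq> {}" by auto
  then show ?case by (intro exI[of _ "\<lambda>_. 1"]) auto
next
  case (insert j J)
  show ?case
  proof (cases "\<forall>i\<in>I. a i j = 0")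
    case True
    obtain c where "\<exists>i\<in>I. c i \<noteq> 0" "\<forall>j\<in>J. (\<Sum>i\<in>I. c i * a i j) = 0"
      using insert.IH[of I a] insert.prems insert.hyps by auto
    then show ?thesis using True by (intro exI[of _ c]) auto
  next
    case False
    then obtain k where k: "k \<in> I" "a k j \<noteq> 0" by blast
    let ?I = "I - {k}" and ?b = "\<lambda>i l. a i l - a i j / a k j * a k l"
    have "card J < card ?I" using insert k by (simp add: card_Diff_singleton)
    then obtain c where c: "\<exists>i\<in>?I. c i \<noteq> 0" "\<forall>l\<in>J. (\<Sum>i\<in>?I. c i * ?b i l) = 0"
      using insert.IH[of ?I ?b] insert.prems by blast
    define s where "s = (\<Sum>i\<in>?I. c i * a i j)"
    define d where "d = c(k := - s / a k j)"
    have d: "(\<Sum>i\<in>I. d i * a i l) = (\<Sum>i\<in>?I. c i * ?b i l)" for l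
    proof -
      have "(\<Sum>i\<in>I. d i * a i l) = d k * a k l + (\<Sum>i\<in>?I. d i * a i l)"
        by (rule sum.remove[OF insert.prems(1) k(1)])
      also have "(\<Sum>i\<in>?I. d i * a i l) = (\<Sum>i\<in>?I. c i * a i l)"
        by (rule sum.cong) (auto simp: d_def)
      also have "d k * a k l = - (\<Sum>i\<in>?I. c i * (a i j / a k j * a k l))"
        by (simp add: d_def s_def sum_distrib_right sum_divide_distrib flip: sum_negf)
           (simp add: mult_ac)
      finally show ?thesis by (simp add: algebra_simps sum_subtractf)
    qed
    have "(\<Sum>i\<in>I. d i * a i l) = 0" if "l \<in> insert j J" for l
      using that c(2) k by (auto simp: d)
    moreover have "\<exists>i\<in>I. d i \<noteq> 0" using c(1) by (auto simp: d_def)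
    ultimately show ?thesis by blast
  qed
qed

text \<open>
  The exponents of the two variables are bounded separately, which bounds the dimension by \<open>(e + 1)^2\<close>.
\<close>

definition bounded_deg :: "nat \<Rightarrow> (cvec \<Rightarrow> complex) \<Rightarrow> bool" where
  "bounded_deg e F \<longleftrightarrow> (\<exists>c. \<forall>x. F x = (\<Sum>(i, j)\<in>{..e} \<times> {..e}. c (i, j) * (x 0 ^ i * x 1 ^ j)))"

lemma bounded_degI:
  assumes "finite K" "\<And>k. k \<in> K \<Longrightarrow> f k \<le> e \<and> g k \<le> e" "\<And>x. F x = (\<Sum>k\<in>K. c k * (x 0 ^ f k * x 1 ^ g k))"
  shows "bounded_deg e F"
proof -
  let ?c = "\<lambda>p. \<Sum>k | k \<in> K \<and> (f k, g k) = p. c k"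
  have "F x = (\<Sum>(i, j)\<in>{..e} \<times> {..e}. ?c (i, j) * (x 0 ^ i * x 1 ^ j))" for x
  proof -
    have "F x = (\<Sum>p\<in>{..e} \<times> {..e}. \<Sum>k | k \<in> K \<and> (f k, g k) = p. c k * (x 0 ^ f k * x 1 ^ g k))"
      unfolding assms(3) by (rule sum.group[symmetric]) (use assms in auto)
    also have "\<dots> = (\<Sum>p\<in>{..e} \<times> {..e}. ?c p * (x 0 ^ fst p * x 1 ^ snd p))"
      by (rule sum.cong) (auto simp: sum_distrib_right intro!: sum.cong)
    also have "\<dots> = (\<Sum>(i, j)\<in>{..e} \<times> {..e}. ?c (i, j) * (x 0 ^ i * x 1 ^ j))"
      by (rule sum.cong) auto
    finally show ?thesis .
  qed
  then show ?thesis unfolding bounded_deg_def by (intro exI[of _ ?c] allI)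
qed

lemma bounded_deg_mult: "bounded_deg d F \<Longrightarrow> bounded_deg e G \<Longrightarrow> bounded_deg (d + e) (\<lambda>x. F x * G x)"
proof -
  assume "bounded_deg d F" "bounded_deg e G"
  then obtain c c' where c: "\<And>x. F x = (\<Sum>(i, j)\<in>{..d} \<times> {..d}. c (i, j) * (x 0 ^ i * x 1 ^ j))"
    "\<And>x. G x = (\<Sum>(i, j)\<in>{..e} \<times> {..e}. c' (i, j) * (x 0 ^ i * x 1 ^ j))"
    unfolding bounded_deg_def by blast
  show ?thesis
  proof (rule bounded_degI[where K = "({..d} \<times> {..d}) \<times> ({..e} \<times> {..e})"
        and f = "\<lambda>(p, q). fst p + fst q" and g = "\<lambda>(p, q). snd p + snd q" and c = "\<lambda>(p, q). c p * c' q"])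
    fix x
    show "F x * G x = (\<Sum>k\<in>({..d} \<times> {..d}) \<times> {..e} \<times> {..e}. (case k of (p, q) \<Rightarrow> c p * c' q) *
         (x 0 ^ (case k of (p, q) \<Rightarrow> fst p + fst q) * x 1 ^ (case k of (p, q) \<Rightarrow> snd p + snd q)))"
      unfolding c sum_product sum.cartesian_product
      by (rule sum.cong) (auto simp: power_add mult_ac)
  qed auto
qed

lemma bounded_deg_mono: "bounded_deg d F \<Longrightarrow> d \<le> e \<Longrightarrow> bounded_deg e F"
proof -
  assume "bounded_deg d F" "d \<le> e"
  then obtain c where c: "\<And>x. F x = (\<Sum>(i, j)\<in>{..d} \<times> {..d}. c (i, j) * (x 0 ^ i * x 1 ^ j))"
    unfolding bounded_deg_def by blast
  show ?thesis
    by (rule bounded_degI[where K = "{..d} \<times> {..d}" and f = fst and g = snd and c = c])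
       (use \<open>d \<le> e\<close> c in \<open>auto simp: case_prod_beta\<close>)
qed

lemma bounded_deg_add: "bounded_deg e F \<Longrightarrow> bounded_deg e G \<Longrightarrow> bounded_deg e (\<lambda>x. F x + G x)"
proof -
  assume "bounded_deg e F" "bounded_deg e G"
  then obtain c c' where c: "\<And>x. F x = (\<Sum>(i, j)\<in>{..e} \<times> {..e}. c (i, j) * (x 0 ^ i * x 1 ^ j))"
    "\<And>x. G x = (\<Sum>(i, j)\<in>{..e} \<times> {..e}. c' (i, j) * (x 0 ^ i * x 1 ^ j))"
    unfolding bounded_deg_def by blast
  show ?thesis
    by (rule bounded_degI[where K = "{..e} \<times> {..e}" and f = fst and g = snd and c = "\<lambda>p. c p + c' p"])
       (auto simp: c case_prod_beta algebra_simps sum.distrib)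
qed

lemma bounded_deg_const: "bounded_deg 0 (\<lambda>x. k)"
  by (rule bounded_degI[where K = "{()}" and f = "\<lambda>_. 0" and g = "\<lambda>_. 0" and c = "\<lambda>_. k"]) auto

lemma polys_bounded_deg: "F \<in> polys 2 \<Longrightarrow> \<exists>e. bounded_deg e F"
  unfolding polys_def
proof (induction rule: gen_algebra.induct)
  case (const c) then show ?case using bounded_deg_const by blast
next
  case (gen b)
  then obtain i where "i < 2" and b: "b = (\<lambda>x. x i)" by auto
  then consider "i = 0" | "i = 1" by linarith
  then have "bounded_deg 1 b" unfolding b
  proof cases
    case 1 then show "bounded_deg 1 (\<lambda>x. x i)"
      by (intro bounded_degI[where K = "{()}" and f = "\<lambda>_. 1" and g = "\<lambda>_. 0" and c = "\<lambda>_. 1"]) auto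
  next
    case 2 then show "bounded_deg 1 (\<lambda>x. x i)"
      by (intro bounded_degI[where K = "{()}" and f = "\<lambda>_. 0" and g = "\<lambda>_. 1" and c = "\<lambda>_. 1"]) auto
  qed
  then show ?case by blast
next
  case (add F G)
  then obtain d e where "bounded_deg d F" "bounded_deg e G" by blast
  then have "bounded_deg (max d e) F" "bounded_deg (max d e) G" using bounded_deg_mono by auto
  then show ?case using bounded_deg_add by blast
next
  case (mult F G) then show ?case using bounded_deg_mult by blast
qed

lemma bounded_deg_power: "bounded_deg e F \<Longrightarrow> bounded_deg (k * e) (\<lambda>x. F x ^ k)"
proof (induction k)
  case 0 then show ?case using bounded_deg_const[of 1] by simp
next
  case (Suc k) then show ?case using bounded_deg_mult[of e F "k * e" "\<lambda>x. F x ^ k"] by simp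
qed

text \<open>
  Irreducibility of \<open>T\<close>, expressed by its ring of polynomial functions being an integral domain.
\<close>

definition prime_set :: "cvec set \<Rightarrow> bool" where
  "prime_set T \<longleftrightarrow> (\<forall>F\<in>polys 2. \<forall>G\<in>polys 2. (\<forall>x\<in>T. F x * G x = 0) \<longrightarrow> (\<forall>x\<in>T. F x = 0) \<or> (\<forall>x\<in>T. G x = 0))"

definition indep_on :: "cvec set \<Rightarrow> 'i set \<Rightarrow> ('i \<Rightarrow> cvec \<Rightarrow> complex) \<Rightarrow> bool" where
  "indep_on T I h \<longleftrightarrow> (\<forall>k. (\<forall>x\<in>T. (\<Sum>i\<in>I. k i * h i x) = 0) \<longrightarrow> (\<forall>i\<in>I. k i = 0))"

text \<open>
  On \<open>T'\<close> only the terms without a factor \<open>f\<close> survive in a linear relation, so their coefficients vanish;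
  on \<open>T\<close> the factor \<open>f\<close> can then be cancelled, and the argument repeats.
\<close>

lemma indep_step:
  assumes T: "prime_set T" and T': "T' \<subseteq> T" and ind: "indep_on T' I h"
    and h: "\<And>i. i \<in> I \<Longrightarrow> h i \<in> polys 2" and f: "f \<in> polys 2" "\<And>x. x \<in> T' \<Longrightarrow> f x = 0" "\<exists>x\<in>T. f x \<noteq> 0"
  shows "indep_on T ({..<n} \<times> I) (\<lambda>(a, i) x. f x ^ a * h i x)"
proof (induction n)
  case 0 then show ?case by (simp add: indep_on_def)
next
  case (Suc n)
  show ?case unfolding indep_on_def
  proof (intro allI impI)
    fix k assume k0: "\<forall>x\<in>T. (\<Sum>p\<in>{..<Suc n} \<times> I. k p * (case p of (a, i) \<Rightarrow> \<lambda>x. f x ^ a * h i x) x) = 0"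
    let ?R = "\<lambda>x. \<Sum>p\<in>{..<n} \<times> I. k (Suc (fst p), snd p) * (f x ^ fst p * h (snd p) x)"
    have split: "(\<Sum>p\<in>{..<Suc n} \<times> I. k p * (case p of (a, i) \<Rightarrow> \<lambda>x. f x ^ a * h i x) x)
        = (\<Sum>i\<in>I. k (0, i) * h i x) + f x * ?R x" for x
    proof -
      have "(\<Sum>p\<in>{..<Suc n} \<times> I. k p * (case p of (a, i) \<Rightarrow> \<lambda>x. f x ^ a * h i x) x)
          = (\<Sum>a<Suc n. \<Sum>i\<in>I. k (a, i) * (f x ^ a * h i x))"
        by (simp add: sum.cartesian_product case_prod_beta)
      also have "\<dots> = (\<Sum>i\<in>I. k (0, i) * h i x) + (\<Sum>a<n. \<Sum>i\<in>I. k (Suc a, i) * (f x ^ Suc a * h i x))"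
        by (subst sum.lessThan_Suc_shift) simp
      also have "(\<Sum>a<n. \<Sum>i\<in>I. k (Suc a, i) * (f x ^ Suc a * h i x)) = f x * ?R x"
        by (simp add: sum.cartesian_product case_prod_beta sum_distrib_left mult_ac)
      finally show ?thesis .
    qed
    have "(\<Sum>i\<in>I. k (0, i) * h i x) = 0" if "x \<in> T'" for x
    proof -
      have "x \<in> T" using that T' by blast
      then show ?thesis using k0[THEN bspec, of x] f(2)[OF that] unfolding split by simp
    qed
    then have k1: "\<forall>i\<in>I. k (0, i) = 0" using ind[unfolded indep_on_def, THEN spec[of _ "\<lambda>i. k (0, i)"]] by blast
    then have "f x * ?R x = 0" if "x \<in> T" for x using k0[THEN bspec, OF that] unfolding split by simp
    then have fR: "\<forall>x\<in>T. f x * ?R x = 0" by blast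
    have R: "?R \<in> polys 2"
      by (rule polys_sum) (auto intro!: polys_mult polys_const polys_power f h)
    have "\<forall>x\<in>T. ?R x = 0"
      using T[unfolded prime_set_def, THEN bspec, OF f(1), THEN bspec, OF R, THEN mp, OF fR] f(3) by blast
    then have k2: "\<forall>p\<in>{..<n} \<times> I. k (Suc (fst p), snd p) = 0"
      using Suc[unfolded indep_on_def, THEN spec[of _ "\<lambda>p. k (Suc (fst p), snd p)"]]
      by (simp add: case_prod_beta)
    show "\<forall>p\<in>{..<Suc n} \<times> I. k p = 0"
    proof
      fix p assume "p \<in> {..<Suc n} \<times> I"
      then show "k p = 0" using k1 k2 by (cases p; cases "fst p") force+
    qed
  qed
qed

text \<open>
  Functions separating consecutive members of a chain of length three would be algebraically
  independent: the \<open>n^3\<close> products \<open>f1^a f2^b f3^c\<close> with exponents below \<open>n\<close> are linearly independent by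
  \<open>indep_step\<close>. In two variables they lie in a space whose dimension grows only like \<open>n^2\<close>.
\<close>

lemma no_long_prime_chain:
  assumes T: "prime_set T1" "prime_set T2" "prime_set T3" "T0 \<subseteq> T1" "T1 \<subseteq> T2" "T2 \<subseteq> T3" "T0 \<noteq> {}"
    and f: "f1 \<in> polys 2" "f2 \<in> polys 2" "f3 \<in> polys 2"
      "\<forall>x\<in>T0. f1 x = 0" "\<exists>x\<in>T1. f1 x \<noteq> 0" "\<forall>x\<in>T1. f2 x = 0" "\<exists>x\<in>T2. f2 x \<noteq> 0"
      "\<forall>x\<in>T2. f3 x = 0" "\<exists>x\<in>T3. f3 x \<noteq> 0"
  shows False
proof -
  obtain e1 e2 e3 where e: "bounded_deg e1 f1" "bounded_deg e2 f2" "bounded_deg e3 f3"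
    using polys_bounded_deg f(1-3) by meson
  define e where "e = e1 + e2 + e3 + 1"
  have be: "bounded_deg e f1" "bounded_deg e f2" "bounded_deg e f3"
    using e bounded_deg_mono by (auto simp: e_def)
  \<comment> \<open>large enough for \<open>(3 n e + 1)^2 < n^3\<close>, since \<open>3 n e + 1 \<le> 4 n e\<close>\<close>
  define n where "n = 16 * e ^ 2 + 1"
  have e0: "e \<ge> 1" by (simp add: e_def)
  let ?h0 = "\<lambda>(u::unit) (x::cvec). 1::complex"
  let ?h1 = "\<lambda>(a, u) x. f1 x ^ a * ?h0 u x" let ?h2 = "\<lambda>(b, p) x. f2 x ^ b * ?h1 p x"
  let ?h3 = "\<lambda>(c, p) x. f3 x ^ c * ?h2 p x"
  let ?I1 = "{..<n} \<times> {()}" let ?I2 = "{..<n} \<times> ?I1" let ?I3 = "{..<n} \<times> ?I2"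
  have i0: "indep_on T0 {()} ?h0" using T(7) by (auto simp: indep_on_def)
  have h1: "?h1 i \<in> polys 2" for i using f by (cases i) (auto intro!: polys_intros)
  have h2: "?h2 i \<in> polys 2" for i using f h1 by (cases i) (auto intro!: polys_intros)
  have i1: "indep_on T1 ?I1 ?h1" by (rule indep_step[OF T(1,4) i0]) (use f in auto)
  have i2: "indep_on T2 ?I2 ?h2" by (rule indep_step[OF T(2,5) i1]) (use f h1 in auto)
  have i3: "indep_on T3 ?I3 ?h3" by (rule indep_step[OF T(3,6) i2]) (use f h2 in auto)
  let ?J = "{..3 * n * e} \<times> {..3 * n * e}"
  have "bounded_deg (3 * n * e) (?h3 p)" if "p \<in> ?I3" for p
  proof -
    obtain c b a where "p = (c, b, a, ())" by (cases p) auto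
    then have p: "p = (c, b, a, ())" "a \<le> n" "b \<le> n" "c \<le> n" using that by auto
    have "bounded_deg (c * e + (b * e + (a * e + 0))) (\<lambda>x. f3 x ^ c * (f2 x ^ b * (f1 x ^ a * 1)))"
      by (intro bounded_deg_mult bounded_deg_power be bounded_deg_const)
    moreover have "c * e + (b * e + (a * e + 0)) \<le> 3 * n * e"
    proof -
      have "a * e \<le> n * e" "b * e \<le> n * e" "c * e \<le> n * e" by (intro mult_le_mono1 p)+
      then show ?thesis unfolding mult.assoc by linarith
    qed
    ultimately show ?thesis using bounded_deg_mono p(1) by auto
  qed
  then have "\<forall>p\<in>?I3. \<exists>c. \<forall>x. ?h3 p x = (\<Sum>(i, j)\<in>?J. c (i, j) * (x 0 ^ i * x 1 ^ j))"
    unfolding bounded_deg_def by blast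
  then obtain c where c: "\<And>p x. p \<in> ?I3 \<Longrightarrow> ?h3 p x = (\<Sum>(i, j)\<in>?J. c p (i, j) * (x 0 ^ i * x 1 ^ j))"
    by (subst (asm) bchoice_iff) blast
  have "card ?J < card ?I3"
  proof -
    have "1 \<le> n * e" using mult_le_mono[of 1 n 1 e] e0 by (simp add: n_def)
    then have "3 * n * e + 1 \<le> 4 * (n * e)" by simp
    then have "(3 * n * e + 1) ^ 2 \<le> (4 * (n * e)) ^ 2" by (rule power_mono) simp
    also have "\<dots> = n ^ 2 * (16 * e ^ 2)" by (simp add: power_mult_distrib)
    also have "\<dots> < n ^ 2 * n" by (rule mult_strict_left_mono) (simp_all add: n_def)
    finally have "(3 * n * e + 1) ^ 2 < n ^ 3" by (simp add: power2_eq_square power3_eq_cube)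
    then show ?thesis by (simp add: card_cartesian_product power2_eq_square power3_eq_cube)
  qed
  then obtain k where k: "\<exists>p\<in>?I3. k p \<noteq> 0" "\<forall>j\<in>?J. (\<Sum>p\<in>?I3. k p * c p j) = 0"
    using homogeneous_system[of ?J ?I3 c] by auto
  have "(\<Sum>p\<in>?I3. k p * ?h3 p x) = 0" for x
  proof -
    have "(\<Sum>p\<in>?I3. k p * ?h3 p x) = (\<Sum>p\<in>?I3. \<Sum>j\<in>?J. k p * c p j * (x 0 ^ fst j * x 1 ^ snd j))"
      by (rule sum.cong[OF refl]) (simp only: c, simp add: sum_distrib_left case_prod_beta mult_ac)
    also have "\<dots> = (\<Sum>j\<in>?J. (\<Sum>p\<in>?I3. k p * c p j) * (x 0 ^ fst j * x 1 ^ snd j))"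
      by (subst sum.swap) (simp only: sum_distrib_right)
    also have "\<dots> = 0" by (rule sum.neutral) (use k(2) in auto)
    finally show ?thesis .
  qed
  then show False using i3 k(1) unfolding indep_on_def by blast
qed

text \<open>Chains in the surface are compared with chains in a chart around their smallest member.\<close>

definition chtrace :: "bool \<Rightarrow> bool \<Rightarrow> (ppoint \<times> ppoint) set \<Rightarrow> cvec set" where
  "chtrace j t Z = {u \<in> cspace 2. bpt (chpar j t 0 u) \<in> Z}"

lemma chtrace_ex:
  assumes q: "q \<in> chart j t 0" "q \<in> Z"
  obtains u where "u \<in> chtrace j t Z" "q = bpt (chpar j t 0 u)" "\<And>v. v \<in> crd21 q \<Longrightarrow> u = chcoord j t 0 v"
proof -
  have qP: "q \<in> P21" using q(1) F1pts_sub by (auto simp: chart_def)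
  obtain v where v: "v \<in> crd21 q" using bi.crd_nonempty[OF qP] by blast
  define u where "u = chcoord j t 0 v"
  have 1: "q = bpt (chpar j t 0 u)" using crd21_bpt(2)[OF qP chart_par[OF q(1) v]] by (simp add: u_def)
  have "u = chcoord j t 0 w" if "w \<in> crd21 q" for w
  proof -
    have "w \<in> crd21 (bpt v)" using crd21_bpt(2)[OF qP v] that by simp
    then show ?thesis unfolding u_def crd21_scale using chcoord_scale by auto
  qed
  moreover have "u \<in> chtrace j t Z" using 1 q(2) by (simp add: chtrace_def u_def chcoord_def)
  ultimately show ?thesis using 1 that by blast
qed

lemma F1_irreducible_iff: "irreducible_closed F1 C \<longleftrightarrow> closedin (zar F1) C \<and> C \<noteq> {} \<and>
    (\<forall>F\<in>\<Union>BF. \<forall>G\<in>\<Union>BF. C \<inter> bi.D F \<inter> bi.D G = {} \<longrightarrow> C \<inter> bi.D F = {} \<or> C \<inter> bi.D G = {})"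
  by (rule bi.irreducible_closed_iff[OF F1pts_sub zar_F1])

lemma irreducible_sub: "irreducible_closed F1 Z \<Longrightarrow> Z \<subseteq> F1pts"
  using closedin_subset[of "zar F1" Z] by (simp add: pts_F1 irreducible_closed_def)

lemma chtrace_prime:
  assumes Z: "irreducible_closed F1 Z" and p: "p \<in> Z" "p \<in> chart j t 0"
  shows "prime_set (chtrace j t Z)"
  unfolding prime_set_def
proof (intro ballI impI)
  fix P Q assume PQ: "P \<in> polys 2" "Q \<in> polys 2" "\<forall>x\<in>chtrace j t Z. P x * Q x = 0"
  obtain F where F: "F \<in> \<Union>BF" "\<forall>q\<in>chart j t 0. \<forall>v\<in>crd21 q. F v = 0 \<longleftrightarrow> P (chcoord j t 0 v) = 0"
    using BF_of_poly[OF PQ(1), of j t 0] by (elim bexE) (rule that)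
  obtain G where G: "G \<in> \<Union>BF" "\<forall>q\<in>chart j t 0. \<forall>v\<in>crd21 q. G v = 0 \<longleftrightarrow> Q (chcoord j t 0 v) = 0"
    using BF_of_poly[OF PQ(2), of j t 0] by (elim bexE) (rule that)
  let ?N = "chden j t 0"
  have irr: "Z \<inter> bi.D F' \<inter> bi.D G' = {} \<longrightarrow> Z \<inter> bi.D F' = {} \<or> Z \<inter> bi.D G' = {}"
    if "F' \<in> \<Union>BF" "G' \<in> \<Union>BF" for F' G' using Z that unfolding F1_irreducible_iff by blast
  have ch: "q \<in> chart j t 0" if "q \<in> Z" "q \<in> bi.D ?N" for q
    using that irreducible_sub[OF Z] by (auto simp: chart_def)
  have "Z \<inter> bi.D (\<lambda>v. ?N v * F v) \<inter> bi.D G = {}"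
  proof -
    { fix q assume q: "q \<in> Z" "q \<in> bi.D ?N" "q \<in> bi.D F" "q \<in> bi.D G"
      obtain u where u: "u \<in> chtrace j t Z" "\<And>v. v \<in> crd21 q \<Longrightarrow> u = chcoord j t 0 v"
        using chtrace_ex[OF ch[OF q(1,2)] q(1)] by metis
      have qP: "q \<in> P21" using q(2) bi.D_sub by blast
      then obtain v where v: "v \<in> crd21 q" using bi.crd_nonempty by blast
      have "F v \<noteq> 0" "G v \<noteq> 0" using q(3,4) bi.D_iff[OF F(1) qP v] bi.D_iff[OF G(1) qP v] by auto
      then have "P u \<noteq> 0" "Q u \<noteq> 0" using F(2) G(2) ch[OF q(1,2)] v u(2)[OF v] by auto
      then have False using PQ(3) u(1) by auto }
    then show ?thesis unfolding bi.D_mult by blast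
  qed
  then have "Z \<inter> bi.D (\<lambda>v. ?N v * F v) = {} \<or> Z \<inter> bi.D G = {}"
    using irr[OF bi.mult_in[OF chden_BF F(1)] G(1)] by blast
  moreover have "Z \<inter> bi.D ?N \<noteq> {}" using p by (auto simp: chart_def)
  ultimately have "Z \<inter> bi.D F = {} \<or> Z \<inter> bi.D G = {}"
    using irr[OF chden_BF[of j t 0] F(1)] unfolding bi.D_mult Int_assoc by blast
  moreover have "P x = 0" if "Z \<inter> bi.D F = {}" "x \<in> chtrace j t Z" for x
  proof -
    have x: "bpt (chpar j t 0 x) \<in> Z" "x \<in> cspace 2" using that(2) by (auto simp: chtrace_def)
    then have "F (chpar j t 0 x) = 0" using that(1) D_bpt[OF F(1) chpar_bvec] by blast
    then show ?thesis using F(2)[THEN bspec, OF chpar_chart, THEN bspec, OF bpt_crd] chcoord_chpar[OF x(2)] by simp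
  qed
  moreover have "Q x = 0" if "Z \<inter> bi.D G = {}" "x \<in> chtrace j t Z" for x
  proof -
    have x: "bpt (chpar j t 0 x) \<in> Z" "x \<in> cspace 2" using that(2) by (auto simp: chtrace_def)
    then have "G (chpar j t 0 x) = 0" using that(1) D_bpt[OF G(1) chpar_bvec] by blast
    then show ?thesis using G(2)[THEN bspec, OF chpar_chart, THEN bspec, OF bpt_crd] chcoord_chpar[OF x(2)] by simp
  qed
  ultimately show "(\<forall>x\<in>chtrace j t Z. P x = 0) \<or> (\<forall>x\<in>chtrace j t Z. Q x = 0)" by blast
qed

text \<open>
  A biform separating \<open>Z\<close> from \<open>Z'\<close> at some point also does so inside the chart, because the
  irreducible set \<open>Z'\<close> meets the chart in a dense subset.
\<close>

lemma chtrace_separate: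
  assumes Z: "irreducible_closed F1 Z" "irreducible_closed F1 Z'" "Z \<subset> Z'" and p: "p \<in> Z'" "p \<in> chart j t 0"
  shows "\<exists>f\<in>polys 2. (\<forall>x\<in>chtrace j t Z. f x = 0) \<and> (\<exists>x\<in>chtrace j t Z'. f x \<noteq> 0)"
proof -
  let ?N = "chden j t 0"
  obtain q where q: "q \<in> Z'" "q \<notin> Z" using Z(3) by blast
  then have "q \<in> F1pts - Z" using irreducible_sub[OF Z(2)] by blast
  moreover have "closedin (zar F1) Z" using Z(1) unfolding irreducible_closed_def by blast
  ultimately obtain F where F: "F \<in> \<Union>BF" "q \<in> bi.D F" "bi.D F \<inter> Z = {}"
    unfolding bi.closedin_zsub[OF zsub_F1] by meson
  have "Z' \<inter> bi.D F \<noteq> {}" "Z' \<inter> bi.D ?N \<noteq> {}" using q(1) F(2) p by (auto simp: chart_def)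
  then have "Z' \<inter> bi.D F \<inter> bi.D ?N \<noteq> {}" using Z(2) F(1) chden_BF unfolding F1_irreducible_iff by meson
  then obtain r where r: "r \<in> Z'" "r \<in> bi.D F" "r \<in> bi.D ?N" by blast
  then have "r \<in> chart j t 0" using irreducible_sub[OF Z(2)] by (auto simp: chart_def)
  then obtain u where u: "u \<in> chtrace j t Z'" "r = bpt (chpar j t 0 u)"
    using chtrace_ex[OF _ r(1)] by metis
  have "F (chpar j t 0 u) \<noteq> 0" using r(2) unfolding u(2) D_bpt[OF F(1) chpar_bvec] .
  moreover have "F (chpar j t 0 x) = 0" if "x \<in> chtrace j t Z" for x
  proof -
    have "bpt (chpar j t 0 x) \<in> Z" using that by (simp add: chtrace_def)
    then show ?thesis using F(3) D_bpt[OF F(1) chpar_bvec] by blast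
  qed
  ultimately show ?thesis using u(1) by (intro bexI[OF _ BF_chpar_polys[OF F(1)]]) auto
qed

lemma chain_le_2:
  assumes "irreducible_chain F1 n Z" shows "n \<le> 2"
proof (rule ccontr)
  assume "\<not> n \<le> 2"
  then have irr: "irreducible_closed F1 (Z i)" if "i \<le> 3" for i
    using assms that unfolding irreducible_chain_def by auto
  have ss: "Z i \<subset> Z (Suc i)" if "i < 3" for i
    using assms that \<open>\<not> n \<le> 2\<close> unfolding irreducible_chain_def by auto
  obtain p where p: "p \<in> Z 0" using irr[of 0] unfolding irreducible_closed_def by auto
  then have "p \<in> F1pts" using irreducible_sub[OF irr[of 0]] by auto
  then obtain j t where jt: "p \<in> chart j t 0" using chart_cover by blast
  have s: "Z 0 \<subset> Z 1" "Z 1 \<subset> Z 2" "Z 2 \<subset> Z 3" using ss[of 0] ss[of 1] ss[of 2] by (auto simp: numeral_2_eq_2 numeral_3_eq_3)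
  then have pp: "p \<in> Z 1" "p \<in> Z 2" "p \<in> Z 3" using p by auto
  have ir: "irreducible_closed F1 (Z 0)" "irreducible_closed F1 (Z 1)" "irreducible_closed F1 (Z 2)"
    "irreducible_closed F1 (Z 3)" using irr by auto
  obtain f1 where f1: "f1 \<in> polys 2" "\<forall>x\<in>chtrace j t (Z 0). f1 x = 0" "\<exists>x\<in>chtrace j t (Z 1). f1 x \<noteq> 0"
    using chtrace_separate[OF ir(1,2) s(1) pp(1) jt] by blast
  obtain f2 where f2: "f2 \<in> polys 2" "\<forall>x\<in>chtrace j t (Z 1). f2 x = 0" "\<exists>x\<in>chtrace j t (Z 2). f2 x \<noteq> 0"
    using chtrace_separate[OF ir(2,3) s(2) pp(2) jt] by blast
  obtain f3 where f3: "f3 \<in> polys 2" "\<forall>x\<in>chtrace j t (Z 2). f3 x = 0" "\<exists>x\<in>chtrace j t (Z 3). f3 x \<noteq> 0"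
    using chtrace_separate[OF ir(3,4) s(3) pp(3) jt] by blast
  have mono: "chtrace j t A \<subseteq> chtrace j t B" if "A \<subset> B" for A B using that by (auto simp: chtrace_def)
  have ne: "chtrace j t (Z 0) \<noteq> {}" by (rule chtrace_ex[OF jt p]) blast
  show False
    by (rule no_long_prime_chain[OF chtrace_prime[OF ir(2) pp(1) jt] chtrace_prime[OF ir(3) pp(2) jt]
          chtrace_prime[OF ir(4) pp(3) jt] mono[OF s(1)] mono[OF s(2)] mono[OF s(3)] ne
          f1(1) f2(1) f3(1) f1(2,3) f2(2,3) f3(2,3)])
qed

section \<open>The endomorphism\<close>

text \<open>
  Squaring all coordinates, followed by the linear automorphism \<open>x2 \<mapsto> x2 + x0\<close>. The automorphism breaks
  the symmetry between the two invariant fibres: on \<open>x0 = 0\<close> the map is squaring, on \<open>x1 = 0\<close> it is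
  \<open>z \<mapsto> z^2 + 1\<close>.
\<close>

definition gvec :: "cvec \<times> cvec \<Rightarrow> cvec \<times> cvec" where
  "gvec v = (vec3 (fst v 0 ^ 2) (fst v 1 ^ 2) (fst v 2 ^ 2 + fst v 0 ^ 2), vec2 (snd v 0 ^ 2) (snd v 1 ^ 2))"

definition gF1 :: "ppoint \<times> ppoint \<Rightarrow> ppoint \<times> ppoint" where
  "gF1 q = bpt (gvec (SOME v. v \<in> crd21 q))"

lemma gvec_scale: "gvec ((\<lambda>i. a * fst v i), (\<lambda>i. b * snd v i)) =
   ((\<lambda>i. a ^ 2 * fst (gvec v) i), (\<lambda>i. b ^ 2 * snd (gvec v) i))"
  by (simp add: gvec_def vec2_scale vec3_scale vec2_eq_iff vec3_eq_iff power_mult_distrib distrib_left)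

lemma gF1_crd:
  assumes "q \<in> P21" "v \<in> crd21 q"
  shows "gF1 q = bpt (gvec v)"
  unfolding gF1_def by (rule some_crd[OF assms]) (simp add: gvec_scale bpt_scale)

lemma gvec_cox: "gvec (cox a b h s) = cox (a ^ 2) (b ^ 2) (h ^ 2) (s ^ 2 + (a * h) ^ 2)"
  by (simp add: gvec_def cox_def power_mult_distrib)

lemma gF1_cpt: "cval a b h s \<Longrightarrow> gF1 (cpt a b h s) = cpt (a ^ 2) (b ^ 2) (h ^ 2) (s ^ 2 + (a * h) ^ 2)"
  using gF1_crd[OF bpt_P21 bpt_crd] cval_bvec by (simp add: gvec_cox)

lemma gF1_cval: "cval a b h s \<Longrightarrow> cval (a ^ 2) (b ^ 2) (h ^ 2) (s ^ 2 + (a * h) ^ 2)"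
  by (auto simp: cval_def)

lemma gF1_in: "q \<in> F1pts \<Longrightarrow> gF1 q \<in> F1pts"
  using F1_cpt gF1_cpt gF1_cval cpt_F1 by metis

lemma gvec_crd: "q \<in> F1pts \<Longrightarrow> v \<in> crd21 q \<Longrightarrow> gvec v \<in> crd21 (gF1 q)"
  using gF1_crd bpt_crd F1pts_sub by (metis subsetD)

lemma gvec_biforms: "F \<in> biforms 3 2 d e \<Longrightarrow> (\<lambda>v. F (gvec v)) \<in> biforms 3 2 (d * 2 + e * 0) (d * 0 + e * 2)"
proof (rule biforms_comp)
  have x: "(\<lambda>v. fst v i ^ 2) \<in> biforms 3 2 2 0" if "i < 3" for i
    using biforms_power[OF biforms_x[OF that, of 2], of 2] by simp
  have y: "(\<lambda>v. snd v i ^ 2) \<in> biforms 3 2 0 2" if "i < 2" for i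
    using biforms_power[OF biforms_y[OF that, of 3], of 2] by simp
  show "(\<lambda>v. fst (gvec v) i) \<in> biforms 3 2 2 0" if "i < 3" for i
    using that x[of 0] x[of 1] x[of 2] biforms_add[OF x[of 2] x[of 0]] by (auto simp: less_3_iff gvec_def)
  show "(\<lambda>v. snd (gvec v) i) \<in> biforms 3 2 0 2" if "i < 2" for i
    using that y[of 0] y[of 1] by (auto simp: less_2_iff gvec_def)
qed (auto simp: gvec_def)

lemma gF1_morphism: "morphism F1 F1 gF1"
proof (rule morphismI_global[OF bi.zcoord_axioms bi.zcoord_axioms zsub_F1 zsub_F1 gF1_in], assumption, rule lifts_toI)
  fix H' assume "H' \<in> BF"
  then obtain d e where "H' = biforms 3 2 d e" unfolding BF_def by blast
  then show "\<exists>H\<in>BF. \<forall>F\<in>H'. (\<lambda>v. F (gvec v)) \<in> H" using gvec_biforms[of _ d e] unfolding BF_def by blast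
qed (rule gvec_crd)

lemma gF1_surj: "gF1 ` F1pts = F1pts"
proof
  show "gF1 ` F1pts \<subseteq> F1pts" using gF1_in by blast
  show "F1pts \<subseteq> gF1 ` F1pts"
  proof
    fix q assume "q \<in> F1pts"
    then obtain a b h s where q: "cval a b h s" "q = cpt a b h s" using F1_cpt by blast
    let ?h = "csqrt h" and ?a = "csqrt a" and ?b = "csqrt b" and ?s = "csqrt (s - a * h)"
    have c: "cval ?a ?b ?h ?s" using q(1) by (auto simp: cval_def)
    have "gF1 (cpt ?a ?b ?h ?s) = q" unfolding gF1_cpt[OF c] q(2) by (simp add: power_mult_distrib)
    then show "q \<in> gF1 ` F1pts" using cpt_F1[OF c] by blast
  qed
qed

section \<open>The charts are affine planes\<close>

interpretation af: zcoord "cspace 2" "\<lambda>x. {x}" "{polys 2}" by (rule zcoord_affine)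

lemma zsub_affine: "zsub (cspace 2) (\<lambda>x. {x}) {polys 2} (affine_space 2) (cspace 2)"
  unfolding affine_space_def by (rule af.zsub_space)

definition chmap :: "bool \<Rightarrow> bool \<Rightarrow> complex \<Rightarrow> ppoint \<times> ppoint \<Rightarrow> cvec" where
  "chmap j t \<epsilon> q = chcoord j t \<epsilon> (SOME v. v \<in> crd21 q)"

lemma chmap_crd:
  assumes "q \<in> P21" "v \<in> crd21 q" shows "chmap j t \<epsilon> q = chcoord j t \<epsilon> v"
  unfolding chmap_def by (rule some_crd[OF assms]) (rule chcoord_scale)

lemma chart_sub: "chart j t \<epsilon> \<subseteq> F1pts" "chart j t \<epsilon> \<subseteq> P21"
  using F1pts_sub by (auto simp: chart_def)

lemma chmap_cspace: "chmap j t \<epsilon> q \<in> cspace 2"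
  by (simp add: chmap_def chcoord_def)

lemma chmap_chpar: "u \<in> cspace 2 \<Longrightarrow> chmap j t \<epsilon> (bpt (chpar j t \<epsilon> u)) = u"
  using chmap_crd[OF bpt_P21[OF chpar_bvec] bpt_crd] chcoord_chpar by simp

lemma chpar_chmap: "q \<in> chart j t \<epsilon> \<Longrightarrow> bpt (chpar j t \<epsilon> (chmap j t \<epsilon> q)) = q"
proof -
  assume q: "q \<in> chart j t \<epsilon>"
  then have qP: "q \<in> P21" using chart_sub by blast
  obtain v where v: "v \<in> crd21 q" using bi.crd_nonempty[OF qP] by blast
  show ?thesis using crd21_bpt(2)[OF qP chart_par[OF q v]] chmap_crd[OF qP v] by simp
qed

lemma chmap_morphism:
  assumes X: "zsub P21 crd21 BF X (chart j t \<epsilon>)"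
    and Y: "zsub (cspace 2) (\<lambda>x. {x}) {polys 2} Y (cspace 2)"
  shows "morphism X Y (chmap j t \<epsilon>)"
proof (rule morphismI_global[OF bi.zcoord_axioms af.zcoord_axioms X Y chmap_cspace])
  show "lifts_to (chart j t \<epsilon>) crd21 BF (\<lambda>x. {x}) {polys 2} (chmap j t \<epsilon>) (chcoord j t \<epsilon>)"
    unfolding lifts_to_def
  proof (intro conjI ballI)
    fix q v assume "q \<in> chart j t \<epsilon>" "v \<in> crd21 q"
    then show "chcoord j t \<epsilon> v \<in> {chmap j t \<epsilon> q}" using chmap_crd[of q v] chart_sub(2) by fastforce
  next
    fix H' F G assume "H' \<in> {polys 2}" "F \<in> H'" "G \<in> H'"
    then have FG: "F \<in> polys 2" "G \<in> polys 2" by auto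
    let ?hom = "\<lambda>n P F. \<forall>q\<in>chart j t \<epsilon>. \<forall>v\<in>crd21 q. F v = chden j t \<epsilon> v ^ n * P (chcoord j t \<epsilon> v)"
    obtain m1 where m1: "\<forall>n\<ge>m1. \<exists>H\<in>biforms 3 2 n n. ?hom n F H"
      using chart_homogenize[OF FG(1), of j t \<epsilon>] by (elim exE) (rule that)
    obtain m2 where m2: "\<forall>n\<ge>m2. \<exists>H\<in>biforms 3 2 n n. ?hom n G H"
      using chart_homogenize[OF FG(2), of j t \<epsilon>] by (elim exE) (rule that)
    define n where "n = max m1 m2"
    have n: "m1 \<le> n" "m2 \<le> n" by (auto simp: n_def)
    obtain F' where F': "F' \<in> biforms 3 2 n n" "?hom n F F'"
      using m1[THEN spec, THEN mp, OF n(1)] by (elim bexE) (rule that)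
    obtain G' where G': "G' \<in> biforms 3 2 n n" "?hom n G G'"
      using m2[THEN spec, THEN mp, OF n(2)] by (elim bexE) (rule that)
    have "\<exists>k. k \<noteq> 0 \<and> F' v = k * F (chcoord j t \<epsilon> v) \<and> G' v = k * G (chcoord j t \<epsilon> v)"
      if "q \<in> chart j t \<epsilon>" "v \<in> crd21 q" for q v
      using chart_mem[OF that] F'(2)[THEN bspec, OF that(1), THEN bspec, OF that(2)]
        G'(2)[THEN bspec, OF that(1), THEN bspec, OF that(2)]
      by (intro exI[of _ "chden j t \<epsilon> v ^ n"]) (simp add: chden_def)
    moreover have "biforms 3 2 n n \<in> BF" unfolding BF_def by blast
    ultimately show "\<exists>H\<in>BF. \<exists>F'\<in>H. \<exists>G'\<in>H. \<forall>q\<in>chart j t \<epsilon>. \<forall>v\<in>crd21 q.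
         \<exists>n. n \<noteq> 0 \<and> F' v = n * F (chcoord j t \<epsilon> v) \<and> G' v = n * G (chcoord j t \<epsilon> v)"
      by (intro bexI[of _ "biforms 3 2 n n"] bexI[OF _ F'(1)] bexI[OF _ G'(1)]) auto
  qed
qed

lemma chpar_morphism:
  assumes X: "zsub P21 crd21 BF X S" "chart j t \<epsilon> \<subseteq> S"
    and Y: "zsub (cspace 2) (\<lambda>x. {x}) {polys 2} Y (cspace 2)"
  shows "morphism Y X (\<lambda>u. bpt (chpar j t \<epsilon> u))"
proof (rule morphismI_global[OF af.zcoord_axioms bi.zcoord_axioms Y X(1)])
  show "bpt (chpar j t \<epsilon> u) \<in> S" for u using chpar_chart X(2) by blast
  show "lifts_to (cspace 2) (\<lambda>x. {x}) {polys 2} crd21 BF (\<lambda>u. bpt (chpar j t \<epsilon> u)) (chpar j t \<epsilon>)"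
  proof (rule lifts_toI)
    fix H' assume "H' \<in> BF"
    then show "\<exists>H\<in>{polys 2}. \<forall>F\<in>H'. (\<lambda>v. F (chpar j t \<epsilon> v)) \<in> H" using BF_chpar_polys by blast
  qed (use bpt_crd in auto)
qed

lemma zsub_chart: "zsub P21 crd21 BF (subspace_of F1 (chart j t \<epsilon>)) (chart j t \<epsilon>)"
  by (rule bi.zsub_subspace[OF zsub_F1 chart_sub(1)])

lemma affine_chart: "affine_fspace (subspace_of F1 (chart j t \<epsilon>))"
proof -
  let ?X = "subspace_of F1 (chart j t \<epsilon>)" and ?A = "subspace_of (affine_space 2) (cspace 2)"
  have pX: "pts ?X = chart j t \<epsilon>" by (rule bi.zsub_pts[OF zsub_chart])
  have A: "zsub (cspace 2) (\<lambda>x. {x}) {polys 2} ?A (cspace 2)" by (rule af.zsub_subspace[OF zsub_affine]) simp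
  have im: "chmap j t \<epsilon> ` pts ?X = cspace 2"
    unfolding pX using chmap_cspace chmap_chpar chpar_chart by (auto simp: image_iff) metis
  have "closedin (zar (affine_space 2)) (cspace 2)"
    using closedin_topspace[of "zar (affine_space 2)"] af.zsub_pts[OF zsub_affine] by simp
  moreover have "isomorphism ?X ?A (chmap j t \<epsilon>)"
    unfolding isomorphism_def pX af.zsub_pts[OF A]
    using chmap_morphism[OF zsub_chart A] chpar_morphism[OF zsub_chart _ A] chmap_chpar chpar_chmap by blast
  ultimately have "closed_immersion ?X (affine_space 2) (chmap j t \<epsilon>)"
    unfolding closed_immersion_def im by blast
  then show ?thesis unfolding affine_fspace_def by blast
qed

lemma openin_chart: "openin (zar F1) (chart j t \<epsilon>)"
  unfolding bi.openin_zsub[OF zsub_F1]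
  by (intro conjI ballI bexI[OF _ chden_BF[of j t \<epsilon>]]) (auto simp: chart_def)

section \<open>Finiteness of the endomorphism\<close>

lemma chden_gvec: "chden j t 1 (gvec v) = chden j t 0 v ^ 2"
  by (cases j; cases t) (simp_all add: chden_def yden_def xden_def xc_def xs_def gvec_def power_mult_distrib)

lemma chcoord_gvec: "chcoord j t 1 (gvec v) = vec2 (chcoord j t 0 v 0 ^ 2) (chcoord j t 0 v 1 ^ 2)"
  by (cases j; cases t) (simp_all add: chcoord_def ynum_def xnum_def yden_def xden_def xc_def xs_def gvec_def power_divide)

text \<open>
  The automorphism maps the charts for \<open>\<epsilon> = 0\<close> to those for \<open>\<epsilon> = 1\<close>, and squaring preserves the former.
  Thus both a chart and its preimage are planes, and the endomorphism is \<open>(u, v) \<mapsto> (u^2, v^2)\<close>.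
\<close>

lemma preim_chart: "preim F1 gF1 (chart j t 1) = chart j t 0"
proof -
  have "gF1 q \<in> chart j t 1 \<longleftrightarrow> q \<in> chart j t 0" if q: "q \<in> F1pts" for q
  proof -
    have qP: "q \<in> P21" using q F1pts_sub by blast
    obtain v where v: "v \<in> crd21 q" using bi.crd_nonempty[OF qP] by blast
    have "gF1 q \<in> P21" using gF1_in[OF q] F1pts_sub by blast
    then have "gF1 q \<in> bi.D (chden j t 1) \<longleftrightarrow> chden j t 1 (gvec v) \<noteq> 0"
      by (rule bi.D_iff[OF chden_BF _ gvec_crd[OF q v]])
    also have "\<dots> \<longleftrightarrow> q \<in> bi.D (chden j t 0)" using bi.D_iff[OF chden_BF qP v] by (simp add: chden_gvec)
    finally show ?thesis using q gF1_in by (auto simp: chart_def)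
  qed
  then show ?thesis unfolding preim_def pts_F1 using chart_sub(1) by blast
qed

lemma chmap_gF1: "q \<in> F1pts \<Longrightarrow> chmap j t 1 (gF1 q) = vec2 (chmap j t 0 q 0 ^ 2) (chmap j t 0 q 1 ^ 2)"
proof -
  assume q: "q \<in> F1pts"
  then have qP: "q \<in> P21" using F1pts_sub by blast
  obtain v where v: "v \<in> crd21 q" using bi.crd_nonempty[OF qP] by blast
  have "gF1 q \<in> P21" using gF1_in[OF q] F1pts_sub by blast
  then show ?thesis using chmap_crd[OF _ gvec_crd[OF q v]] chmap_crd[OF qP v] chcoord_gvec by simp
qed

text \<open>Polynomials in two variables form a free module with basis \<open>1, u, v, u v\<close> over those in the squares.\<close>

definition sq_comb :: "(cvec \<Rightarrow> complex) \<Rightarrow> (cvec \<Rightarrow> complex) \<Rightarrow> (cvec \<Rightarrow> complex) \<Rightarrow> (cvec \<Rightarrow> complex) \<Rightarrow> cvec \<Rightarrow> complex" where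
  "sq_comb A B C D x = (let y = vec2 (x 0 ^ 2) (x 1 ^ 2) in A y + B y * x 0 + C y * x 1 + D y * (x 0 * x 1))"

lemma poly_squares:
  assumes "P \<in> polys 2"
  shows "\<exists>A B C D. A \<in> polys 2 \<and> B \<in> polys 2 \<and> C \<in> polys 2 \<and> D \<in> polys 2 \<and> P = sq_comb A B C D"
  using assms unfolding polys_def
proof (induction rule: gen_algebra.induct)
  case (const c)
  show ?case unfolding polys_def[symmetric]
    by (rule exI[of _ "\<lambda>_. c"], rule exI[of _ "\<lambda>_. 0"], rule exI[of _ "\<lambda>_. 0"], rule exI[of _ "\<lambda>_. 0"])
       (simp add: sq_comb_def fun_eq_iff)
next
  case (gen b)
  then obtain i where "i < 2" and b: "b = (\<lambda>x. x i)" by auto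
  then have "b = sq_comb (\<lambda>_. 0) (\<lambda>_. if i = 0 then 1 else 0) (\<lambda>_. if i = 1 then 1 else 0) (\<lambda>_. 0)"
    by (auto simp: sq_comb_def less_2_iff)
  then show ?case unfolding polys_def[symmetric] by (intro exI conjI; assumption?) (rule polys_const)+
next
  case (add F G)
  obtain A B C D where 1: "A \<in> polys 2" "B \<in> polys 2" "C \<in> polys 2" "D \<in> polys 2" "F = sq_comb A B C D"
    using add.IH(1) unfolding polys_def[symmetric] by (elim exE conjE) (rule that)
  obtain A' B' C' D' where 2: "A' \<in> polys 2" "B' \<in> polys 2" "C' \<in> polys 2" "D' \<in> polys 2" "G = sq_comb A' B' C' D'"
    using add.IH(2) unfolding polys_def[symmetric] by (elim exE conjE) (rule that)
  have "(\<lambda>x. F x + G x) = sq_comb (\<lambda>y. A y + A' y) (\<lambda>y. B y + B' y) (\<lambda>y. C y + C' y) (\<lambda>y. D y + D' y)"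
    by (rule ext) (simp add: 1(5) 2(5) sq_comb_def Let_def algebra_simps)
  moreover note polys_add[OF 1(1) 2(1)] polys_add[OF 1(2) 2(2)] polys_add[OF 1(3) 2(3)] polys_add[OF 1(4) 2(4)]
  ultimately show ?case unfolding polys_def[symmetric] by (intro exI conjI)
next
  case (mult F G)
  obtain A B C D where 1: "A \<in> polys 2" "B \<in> polys 2" "C \<in> polys 2" "D \<in> polys 2" "F = sq_comb A B C D"
    using mult.IH(1) unfolding polys_def[symmetric] by (elim exE conjE) (rule that)
  obtain A' B' C' D' where 2: "A' \<in> polys 2" "B' \<in> polys 2" "C' \<in> polys 2" "D' \<in> polys 2" "G = sq_comb A' B' C' D'"
    using mult.IH(2) unfolding polys_def[symmetric] by (elim exE conjE) (rule that)
  have v: "(\<lambda>x. x 0) \<in> polys 2" "(\<lambda>x. x 1) \<in> polys 2" by (auto intro: polys_var)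
  let ?A = "\<lambda>y. A y * A' y + B y * B' y * y 0 + C y * C' y * y 1 + D y * D' y * (y 0 * y 1)"
  let ?B = "\<lambda>y. A y * B' y + B y * A' y + (C y * D' y + D y * C' y) * y 1"
  let ?C = "\<lambda>y. A y * C' y + C y * A' y + (B y * D' y + D y * B' y) * y 0"
  let ?D = "\<lambda>y. A y * D' y + D y * A' y + B y * C' y + C y * B' y"
  have "(\<lambda>x. F x * G x) = sq_comb ?A ?B ?C ?D"
    by (rule ext) (simp add: 1(5) 2(5) sq_comb_def Let_def algebra_simps power2_eq_square)
  moreover have "?A \<in> polys 2" "?B \<in> polys 2" "?C \<in> polys 2" "?D \<in> polys 2"
    by (intro polys_add polys_mult 1 2 v)+
  ultimately show ?case unfolding polys_def[symmetric] by (intro exI conjI)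
qed

lemma reg_chart_poly:
  assumes "reg F1 (chart j t \<epsilon>) f"
  shows "\<exists>P\<in>polys 2. \<forall>q\<in>chart j t \<epsilon>. f q = P (chmap j t \<epsilon> q)"
proof -
  have m: "morphism (affine_space 2) F1 (\<lambda>u. bpt (chpar j t \<epsilon> u))"
    by (rule chpar_morphism[OF zsub_F1 chart_sub(1) zsub_affine])
  have pr: "preim (affine_space 2) (\<lambda>u. bpt (chpar j t \<epsilon> u)) (chart j t \<epsilon>) = cspace 2"
    unfolding preim_def af.zsub_pts[OF zsub_affine] using chpar_chart by blast
  have "reg (affine_space 2) (cspace 2) (f \<circ> (\<lambda>u. bpt (chpar j t \<epsilon> u)))"
    using m[unfolded morphism_def, THEN conjunct2, THEN spec, THEN spec, THEN mp, OF conjI[OF openin_chart assms]]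
    unfolding pr .
  moreover have "openin (zar (affine_space 2)) (cspace 2)"
    using openin_topspace[of "zar (affine_space 2)"] af.zsub_pts[OF zsub_affine] by simp
  ultimately have "regular_on (cspace 2) (\<lambda>x. {x}) {polys 2} (cspace 2) (f \<circ> (\<lambda>u. bpt (chpar j t \<epsilon> u)))"
    using zsub_affine unfolding zsub_def by blast
  from regular_affine_plane[OF this] obtain P where
    P: "P \<in> polys 2" "\<forall>x\<in>cspace 2. (f \<circ> (\<lambda>u. bpt (chpar j t \<epsilon> u))) x = P x" by (elim bexE) (rule that)
  have "f q = P (chmap j t \<epsilon> q)" if "q \<in> chart j t \<epsilon>" for q
    using P(2)[THEN bspec, OF chmap_cspace[of j t \<epsilon> q]] chpar_chmap[OF that] by simp
  then show ?thesis using P(1) by blast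
qed

lemma reg_poly_chart:
  assumes "P \<in> polys 2" shows "reg F1 (chart j t \<epsilon>) (\<lambda>q. P (chmap j t \<epsilon> q))"
proof -
  let ?X = "subspace_of F1 (chart j t \<epsilon>)"
  have m: "morphism ?X (affine_space 2) (chmap j t \<epsilon>)" by (rule chmap_morphism[OF zsub_chart zsub_affine])
  have o: "openin (zar (affine_space 2)) (cspace 2)"
    using openin_topspace[of "zar (affine_space 2)"] af.zsub_pts[OF zsub_affine] by simp
  have "regular_on (cspace 2) (\<lambda>x. {x}) {polys 2} (cspace 2) P"
    by (rule af.regular_on_quotient[of _ "polys 2" P "\<lambda>_. 1"]) (use assms in auto)
  then have "reg (affine_space 2) (cspace 2) P" using o zsub_affine unfolding zsub_def by blast
  from m[unfolded morphism_def, THEN conjunct2, THEN spec, THEN spec, THEN mp, OF conjI[OF o this]]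
  have r: "reg ?X (preim ?X (chmap j t \<epsilon>) (cspace 2)) (P \<circ> chmap j t \<epsilon>)" .
  have pr: "preim ?X (chmap j t \<epsilon>) (cspace 2) = chart j t \<epsilon>"
    unfolding preim_def bi.zsub_pts[OF zsub_chart] using chmap_cspace by blast
  have "openin (zar ?X) (chart j t \<epsilon>)"
    using openin_topspace[of "zar ?X"] bi.zsub_pts[OF zsub_chart] by metis
  then have "regular_on P21 crd21 BF (chart j t \<epsilon>) (P \<circ> chmap j t \<epsilon>)"
    using r zsub_chart unfolding pr zsub_def by blast
  then show ?thesis using reg_F1[OF openin_chart] by (simp add: comp_def)
qed

lemma gF1_finite: "finite_morphism F1 F1 gF1"
  unfolding finite_morphism_def
proof (intro conjI ballI gF1_morphism)
  fix y assume "y \<in> pts F1"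
  then obtain j t where y: "y \<in> chart j t 1" using chart_cover pts_F1 by blast
  let ?U = "chart j t 0" and ?V = "chart j t 1"
  let ?u = "\<lambda>q. chmap j t 0 q 0" and ?v = "\<lambda>q. chmap j t 0 q 1"
  let ?b1 = "\<lambda>q::ppoint \<times> ppoint. 1::complex" and ?b4 = "\<lambda>q. ?u q * ?v q"
  let ?B = "{?b1, ?u, ?v, ?b4}"
  let ?p = "bpt (chpar j t 0 (vec2 2 3))"
  have ev: "?b1 ?p = 1" "?u ?p = 2" "?v ?p = 3" "?b4 ?p = 6" by (simp_all add: chmap_chpar)
  have d: "?b1 \<noteq> ?u" "?b1 \<noteq> ?v" "?b1 \<noteq> ?b4" "?u \<noteq> ?v" "?u \<noteq> ?b4" "?v \<noteq> ?b4"
    by (rule notI, drule fun_cong[of _ _ ?p], simp add: chmap_chpar)+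
  have polb: "(\<lambda>x. 1) \<in> polys 2" "(\<lambda>x. x 0) \<in> polys 2" "(\<lambda>x. x 1) \<in> polys 2" "(\<lambda>x. x 0 * x 1) \<in> polys 2"
    by (auto intro!: polys_mult polys_var)
  have regB: "\<forall>b\<in>?B. reg F1 ?U b"
    using reg_poly_chart[OF polb(1), of j t 0] reg_poly_chart[OF polb(2), of j t 0]
      reg_poly_chart[OF polb(3), of j t 0] reg_poly_chart[OF polb(4), of j t 0] by blast
  have "\<exists>c. (\<forall>b\<in>?B. reg F1 ?V (c b)) \<and> (\<forall>x\<in>?U. f x = (\<Sum>b\<in>?B. c b (gF1 x) * b x))"
    if f: "reg F1 ?U f" for f
  proof -
    obtain P where P: "P \<in> polys 2" "\<forall>q\<in>?U. f q = P (chmap j t 0 q)"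
      using reg_chart_poly[OF f] by (elim bexE) (rule that)
    obtain A B C D where Q: "A \<in> polys 2" "B \<in> polys 2" "C \<in> polys 2" "D \<in> polys 2" "P = sq_comb A B C D"
      using poly_squares[OF P(1)] by blast
    define c where "c b q = (if b = ?b1 then A else if b = ?u then B else if b = ?v then C else D) (chmap j t 1 q)"
      for b :: "ppoint \<times> ppoint \<Rightarrow> complex" and q
    have c: "c ?b1 = (\<lambda>q. A (chmap j t 1 q))" "c ?u = (\<lambda>q. B (chmap j t 1 q))"
      "c ?v = (\<lambda>q. C (chmap j t 1 q))" "c ?b4 = (\<lambda>q. D (chmap j t 1 q))"
      unfolding c_def using d by (auto intro!: ext simp del: One_nat_def)
    have "\<forall>b\<in>?B. reg F1 ?V (c b)"
      using reg_poly_chart[OF Q(1), of j t 1] reg_poly_chart[OF Q(2), of j t 1]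
        reg_poly_chart[OF Q(3), of j t 1] reg_poly_chart[OF Q(4), of j t 1] by (simp add: c del: One_nat_def)
    moreover have "f x = (\<Sum>b\<in>?B. c b (gF1 x) * b x)" if "x \<in> ?U" for x
    proof -
      have x: "x \<in> F1pts" using that chart_sub by blast
      have "(\<Sum>b\<in>?B. c b (gF1 x) * b x) = c ?b1 (gF1 x) * 1 + (c ?u (gF1 x) * ?u x + (c ?v (gF1 x) * ?v x + c ?b4 (gF1 x) * ?b4 x))"
        using d by (simp del: One_nat_def)
      also have "\<dots> = f x" using P(2) that by (simp add: c chmap_gF1[OF x] Q(5) sq_comb_def Let_def del: One_nat_def)
      finally show ?thesis by simp
    qed
    ultimately show ?thesis by blast
  qed
  then show "\<exists>V. openin (zar F1) V \<and> y \<in> V \<and> affine_fspace (subspace_of F1 V) \<and>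
      affine_fspace (subspace_of F1 (preim F1 gF1 V)) \<and>
      (\<exists>B. finite B \<and> (\<forall>b\<in>B. reg F1 (preim F1 gF1 V) b) \<and>
         (\<forall>f. reg F1 (preim F1 gF1 V) f \<longrightarrow>
            (\<exists>c. (\<forall>b\<in>B. reg F1 V (c b)) \<and> (\<forall>x\<in>preim F1 gF1 V. f x = (\<Sum>b\<in>B. c b (gF1 x) * b x)))))"
    by (intro exI[of _ ?V] conjI exI[of _ ?B])
       (use y openin_chart affine_chart regB in \<open>simp_all add: preim_chart del: One_nat_def\<close>)
qed

lemma gF1_finite_surjective: "finite_surjective_endo F1 gF1"
  unfolding finite_surjective_endo_def pts_F1 using gF1_finite gF1_surj by blast

section \<open>Codimension\<close>

lemma chain1: "irreducible_closed F1 A \<Longrightarrow> irreducible_closed F1 B \<Longrightarrow> A \<subset> B \<Longrightarrow>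
  irreducible_chain F1 1 (\<lambda>i. if i = 0 then A else B)"
  by (auto simp: irreducible_chain_def)

lemma chain2: "irreducible_closed F1 A \<Longrightarrow> irreducible_closed F1 B \<Longrightarrow> irreducible_closed F1 C \<Longrightarrow>
  A \<subset> B \<Longrightarrow> B \<subset> C \<Longrightarrow> irreducible_chain F1 2 (\<lambda>i. if i = 0 then A else if i = 1 then B else C)"
  by (auto simp: irreducible_chain_def less_2_iff)

lemma no_chain3: "irreducible_closed F1 A \<Longrightarrow> irreducible_closed F1 B \<Longrightarrow> irreducible_closed F1 C \<Longrightarrow>
  irreducible_closed F1 D \<Longrightarrow> A \<subset> B \<Longrightarrow> B \<subset> C \<Longrightarrow> C \<subset> D \<Longrightarrow> False"
proof -
  assume a: "irreducible_closed F1 A" "irreducible_closed F1 B" "irreducible_closed F1 C"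
    "irreducible_closed F1 D" "A \<subset> B" "B \<subset> C" "C \<subset> D"
  have "irreducible_chain F1 3 (\<lambda>i. if i = 0 then A else if i = 1 then B else if i = 2 then C else D)"
    unfolding irreducible_chain_def
  proof (intro conjI allI impI)
    fix i :: nat assume "i < 3"
    then consider "i = 0" | "i = 1" | "i = 2" by linarith
    then show "(if i = 0 then A else if i = 1 then B else if i = 2 then C else D)
        \<subset> (if Suc i = 0 then A else if Suc i = 1 then B else if Suc i = 2 then C else D)"
      by cases (simp_all add: a)
  qed (simp add: a)
  then show False using chain_le_2 by fastforce
qed

lemma point_psubset: "irreducible_closed F1 V \<Longrightarrow> p \<in> V \<Longrightarrow> V \<noteq> {p} \<Longrightarrow> irreducible_closed F1 {p} \<and> {p} \<subset> V"
  using irr_point irreducible_sub by blast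

lemma codim_le: "irreducible_chain F1 n Z \<Longrightarrow> Z 0 = V \<Longrightarrow> enat n \<le> codimension F1 V"
  unfolding codimension_def by (rule Sup_upper) auto

lemma codim_chain:
  assumes "codimension F1 V = enat r" "r \<ge> 1"
  shows "\<exists>Z. irreducible_chain F1 r Z \<and> Z 0 = V"
proof -
  have "\<exists>n Z. n \<ge> r \<and> irreducible_chain F1 n Z \<and> Z 0 = V"
  proof (rule ccontr)
    assume no: "\<not> ?thesis"
    have "codimension F1 V \<le> enat (r - 1)"
      unfolding codimension_def
    proof (rule Sup_least)
      fix x assume "x \<in> {enat n |n Z. irreducible_chain F1 n Z \<and> Z 0 = V}"
      then obtain n Z where "x = enat n" "irreducible_chain F1 n Z" "Z 0 = V" by blast
      then show "x \<le> enat (r - 1)" using no by (cases "n \<ge> r") auto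
    qed
    then show False using assms by simp
  qed
  then obtain n Z where "n \<ge> r" and Z: "irreducible_chain F1 n Z" "Z 0 = V" by blast
  moreover have "n \<le> r" using codim_le[OF Z] assms(1) by simp
  ultimately show ?thesis by auto
qed

lemma codim_point:
  assumes "irreducible_closed F1 C" "p \<in> C" "C \<noteq> {p}" "C \<subset> F1pts"
  shows "codimension F1 {p} = 2"
proof (rule antisym)
  have p: "irreducible_closed F1 {p}" "{p} \<subset> C" using point_psubset assms by blast+
  show "2 \<le> codimension F1 {p}"
    using codim_le[OF chain2[OF p(1) assms(1) irr_F1 p(2) assms(4)]] by (simp add: numeral_eq_enat)
  show "codimension F1 {p} \<le> 2"
    unfolding codimension_def by (rule Sup_least) (auto simp: numeral_eq_enat dest: chain_le_2)
qed

text \<open>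
  A longer chain starting from the curve would extend downwards by a point to a chain of length three.
\<close>

lemma codim_curve:
  assumes "irreducible_closed F1 C" "p \<in> C" "C \<noteq> {p}" "C \<subset> F1pts"
  shows "codimension F1 C = 1"
proof (rule antisym)
  have p: "irreducible_closed F1 {p}" "{p} \<subset> C" using point_psubset assms by blast+
  show "1 \<le> codimension F1 C"
    using codim_le[OF chain1[OF assms(1) irr_F1 assms(4)]] by (simp add: one_enat_def)
  show "codimension F1 C \<le> 1"
    unfolding codimension_def
  proof (rule Sup_least)
    fix x assume "x \<in> {enat n |n Z. irreducible_chain F1 n Z \<and> Z 0 = C}"
    then obtain n Z where x: "x = enat n" and Z: "irreducible_chain F1 n Z" "Z 0 = C" by blast
    have "\<not> n \<ge> 2"
    proof
      assume "n \<ge> 2"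
      then have "irreducible_closed F1 (Z 1)" "irreducible_closed F1 (Z 2)" "Z 0 \<subset> Z 1" "Z 1 \<subset> Z 2"
        using Z(1) unfolding irreducible_chain_def by (auto simp: numeral_2_eq_2)
      then show False using no_chain3[OF p(1) assms(1)] p(2) Z(2) by blast
    qed
    then show "x \<le> 1" using x by (simp add: one_enat_def)
  qed
qed

text \<open>
  Otherwise a point of \<open>V\<close> could be put below the chain that realizes the codimension.
\<close>

lemma codim_2_singleton:
  assumes "irreducible_closed F1 V" "codimension F1 V = 2"
  shows "\<exists>p\<in>F1pts. V = {p}"
proof -
  obtain Z where Z: "irreducible_chain F1 2 Z" "Z 0 = V"
    using codim_chain[of V 2] assms(2) by (auto simp: numeral_eq_enat)
  have z: "irreducible_closed F1 (Z 1)" "irreducible_closed F1 (Z 2)" "Z 0 \<subset> Z 1" "Z 1 \<subset> Z 2"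
    using Z(1) unfolding irreducible_chain_def by (auto simp: numeral_2_eq_2)
  obtain p where p: "p \<in> V" using assms(1) unfolding irreducible_closed_def by blast
  have "V = {p}"
  proof (rule ccontr)
    assume "V \<noteq> {p}"
    then show False using no_chain3[of "{p}" V "Z 1" "Z 2"] point_psubset[OF assms(1) p] assms(1) z Z(2) by blast
  qed
  then show ?thesis using p irreducible_sub[OF assms(1)] by blast
qed

lemma codim_1_maximal:
  assumes "irreducible_closed F1 V" "codimension F1 V = 1"
  shows "V \<subset> F1pts" "\<And>C. irreducible_closed F1 C \<Longrightarrow> V \<subseteq> C \<Longrightarrow> C \<subset> F1pts \<Longrightarrow> V = C"
    "\<And>C p. irreducible_closed F1 C \<Longrightarrow> C \<subseteq> V \<Longrightarrow> p \<in> C \<Longrightarrow> C \<noteq> {p} \<Longrightarrow> V = C"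
proof -
  obtain Z where Z: "irreducible_chain F1 1 Z" "Z 0 = V"
    using codim_chain[of V 1] assms(2) by (auto simp: one_enat_def)
  have z: "irreducible_closed F1 (Z 1)" "Z 0 \<subset> Z 1"
    using Z(1) unfolding irreducible_chain_def by auto
  then show V: "V \<subset> F1pts" using irreducible_sub Z(2) by blast
  show "V = C" if C: "irreducible_closed F1 C" "V \<subseteq> C" "C \<subset> F1pts" for C
  proof (rule ccontr)
    assume "V \<noteq> C"
    then have "V \<subset> C" using C by blast
    from codim_le[OF chain2[OF assms(1) C(1) irr_F1 this C(3)]] assms(2) show False
      by (simp add: one_enat_def)
  qed
  show "V = C" if C: "irreducible_closed F1 C" "C \<subseteq> V" "p \<in> C" "C \<noteq> {p}" for C p
    using no_chain3[of "{p}" C V F1pts] point_psubset[OF C(1,3,4)] C assms(1) irr_F1 V by blast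
qed

lemma krull_dim_F1: "krull_dim F1 = 2"
proof (rule antisym)
  show "krull_dim F1 \<le> 2"
    unfolding krull_dim_def by (rule Sup_least) (auto simp: numeral_eq_enat dest: chain_le_2)
  have c: "cval 1 0 0 1" "cval 0 1 0 1" "cval 1 0 1 1" by (auto simp: cval_def)
  have p: "cpt 1 0 0 1 \<in> curveE" "cpt 0 1 0 1 \<in> curveE" "cpt 1 0 1 1 \<notin> curveE" "cpt 1 0 1 1 \<in> F1pts"
    "cpt 0 1 0 1 \<in> fib0" "cpt 1 0 0 1 \<notin> fib0"
    using cpt_curveE cpt_fib0 cpt_F1 c by auto
  then have ne: "curveE \<noteq> {cpt 1 0 0 1}" "curveE \<subset> F1pts"
    using locus_sub(1) by (metis singletonD, metis psubsetI)
  note pp = point_psubset[OF irr_curveE p(1) ne(1)]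
  have "irreducible_chain F1 2 (\<lambda>i. if i = 0 then {cpt 1 0 0 1} else if i = 1 then curveE else F1pts)"
    by (rule chain2) (use pp irr_curveE irr_F1 ne in auto)
  then have "enat 2 \<le> krull_dim F1" unfolding krull_dim_def by (intro Sup_upper) auto
  then show "2 \<le> krull_dim F1" by (simp add: numeral_eq_enat)
qed

lemma var_dim_F1: "var_dim F1 = 2"
  unfolding var_dim_def krull_dim_F1 by (simp add: numeral_eq_enat)

section \<open>Iterates of the endomorphism\<close>

lemma cpt_scale: "l \<noteq> 0 \<Longrightarrow> m \<noteq> 0 \<Longrightarrow> cpt (l * a) (l * b) (m * h) (l * m * s) = cpt a b h s"
proof -
  assume lm: "l \<noteq> 0" "m \<noteq> 0"
  have "cox (l * a) (l * b) (m * h) (l * m * s) = ((\<lambda>i. (l * m) * fst (cox a b h s) i), (\<lambda>i. l * snd (cox a b h s) i))"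
    by (auto simp: cox_def vec2_def vec3_def fun_eq_iff)
  then show ?thesis using bpt_scale[of "l * m" l "cox a b h s"] lm by simp
qed

text \<open>
  The action on the last Cox coordinate; \<open>t\<close> stands for the product \<open>a h\<close>.
\<close>

fun fibre_iter :: "nat \<Rightarrow> complex \<Rightarrow> complex \<Rightarrow> complex" where
  "fibre_iter 0 t s = s"
| "fibre_iter (Suc n) t s = fibre_iter n t s ^ 2 + (t ^ 2 ^ n) ^ 2"

lemma fibre_iter_even: "n \<ge> 1 \<Longrightarrow> fibre_iter n t (- s) = fibre_iter n t s"
proof (induction n rule: nat_induct_at_least)
  case base then show ?case by simp
qed simp

text \<open>
  After the first step, the orbit of 0 under \<open>z \<mapsto> z^2 + 1\<close> consists of real numbers that are at least 1.
\<close>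

lemma fibre_iter_pos: "n \<ge> 1 \<Longrightarrow> \<exists>r\<ge>1. fibre_iter n 1 0 = complex_of_real r"
proof (induction n rule: nat_induct_at_least)
  case base then show ?case by (intro exI[of _ 1]) simp
next
  case (Suc n)
  then obtain r where "r \<ge> 1" "fibre_iter n 1 0 = complex_of_real r" by blast
  then show ?case by (intro exI[of _ "r ^ 2 + 1"]) simp
qed

lemma gF1_funpow: "cval a b h s \<Longrightarrow> cval (a ^ 2 ^ n) (b ^ 2 ^ n) (h ^ 2 ^ n) (fibre_iter n (a * h) s) \<and>
  (gF1 ^^ n) (cpt a b h s) = cpt (a ^ 2 ^ n) (b ^ 2 ^ n) (h ^ 2 ^ n) (fibre_iter n (a * h) s)"
proof (induction n)
  case (Suc n)
  have p: "x ^ 2 ^ Suc n = (x ^ 2 ^ n) ^ 2" for x :: complex by (simp add: mult.commute flip: power_mult)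
  have IH: "cval (a ^ 2 ^ n) (b ^ 2 ^ n) (h ^ 2 ^ n) (fibre_iter n (a * h) s)"
    "(gF1 ^^ n) (cpt a b h s) = cpt (a ^ 2 ^ n) (b ^ 2 ^ n) (h ^ 2 ^ n) (fibre_iter n (a * h) s)"
    using Suc by auto
  have t: "fibre_iter (Suc n) (a * h) s = fibre_iter n (a * h) s ^ 2 + (a ^ 2 ^ n * h ^ 2 ^ n) ^ 2"
    by (simp add: power_mult_distrib)
  show ?case unfolding p t using gF1_cval[OF IH(1)] gF1_cpt[OF IH(1)] IH(2) by simp
qed simp

lemma gF1_funpow_in: "q \<in> F1pts \<Longrightarrow> (gF1 ^^ n) q \<in> F1pts"
  by (induction n) (auto intro: gF1_in)

lemma preim_funpow:
  assumes "preim F1 (gF1 ^^ b) V = V"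
  shows "preim F1 (gF1 ^^ (b * k)) V = V"
proof (induction k)
  case 0
  have "V \<subseteq> F1pts" using assms unfolding preim_def pts_F1 by blast
  then show ?case unfolding preim_def pts_F1 by auto
next
  case (Suc k)
  have "q \<in> F1pts \<and> (gF1 ^^ (b * Suc k)) q \<in> V \<longleftrightarrow> q \<in> V" for q
  proof -
    have e: "(gF1 ^^ (b * Suc k)) q = (gF1 ^^ b) ((gF1 ^^ (b * k)) q)" by (simp add: funpow_add)
    have 1: "x \<in> F1pts \<and> (gF1 ^^ b) x \<in> V \<longleftrightarrow> x \<in> V" for x using assms unfolding preim_def pts_F1 by blast
    have 2: "x \<in> F1pts \<and> (gF1 ^^ (b * k)) x \<in> V \<longleftrightarrow> x \<in> V" for x using Suc unfolding preim_def pts_F1 by blast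
    show ?thesis unfolding e using 1[of "(gF1 ^^ (b * k)) q"] 2[of q] gF1_funpow_in by blast
  qed
  then show ?case unfolding preim_def pts_F1 by blast
qed

text \<open>
  Total periodicity for \<open>b\<close> passes to all multiples of \<open>b\<close>, so the set is stable under the
  symmetries of arbitrarily high iterates, although each iterate has only finitely many.
\<close>

lemma totally_periodic_saturated:
  assumes "preim F1 (gF1 ^^ b) V = V" "p \<in> V" "q \<in> F1pts" "(gF1 ^^ (b * k)) q = (gF1 ^^ (b * k)) p"
  shows "q \<in> V"
proof -
  have pr: "x \<in> F1pts \<and> (gF1 ^^ (b * k)) x \<in> V \<longleftrightarrow> x \<in> V" for x
    using preim_funpow[OF assms(1), of k] unfolding preim_def pts_F1 by blast
  then show ?thesis using assms by metis
qed

section \<open>Totally periodic curves\<close>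

text \<open>
  The iterates identify the points \<open>(1, \<zeta> \<beta>, 1, c)\<close> for all roots of unity \<open>\<zeta>\<close> of 2-power order. These
  are infinitely many points of the section, hence Zariski dense in it.
\<close>

lemma saturated_contains_section:
  assumes V: "closedin (zar F1) V" and sat: "preim F1 (gF1 ^^ b) V = V" "b \<ge> 1"
    and p: "cpt 1 \<beta> 1 c \<in> V" "\<beta> \<noteq> 0"
  shows "sectionW c \<subseteq> V"
proof -
  have cv: "cval 1 t 1 c" for t by (auto simp: cval_def)
  have orbit: "cpt 1 (\<zeta> * \<beta>) 1 c \<in> V" if z: "\<zeta> ^ 2 ^ n = 1" for \<zeta> n
  proof (rule totally_periodic_saturated[OF sat(1) p(1) cpt_F1[OF cv], of n])
    have "n \<le> b * n" using sat(2) by simp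
    then have "(2::nat) ^ n dvd 2 ^ (b * n)" by (rule le_imp_power_dvd)
    then obtain m where "(2::nat) ^ (b * n) = 2 ^ n * m" by (elim dvdE)
    then have "\<zeta> ^ 2 ^ (b * n) = 1" using z by (simp add: power_mult)
    then show "(gF1 ^^ (b * n)) (cpt 1 (\<zeta> * \<beta>) 1 c) = (gF1 ^^ (b * n)) (cpt 1 \<beta> 1 c)"
      by (simp only: gF1_funpow[OF cv, THEN conjunct2] power_mult_distrib mult_1)
  qed
  have open_part: "cpt 1 t 1 c \<in> V" for t
  proof (rule ccontr)
    assume "cpt 1 t 1 c \<notin> V"
    then have "cpt 1 t 1 c \<in> F1pts - V" using cpt_F1[OF cv] by blast
    then obtain F where F: "F \<in> \<Union>BF" "cpt 1 t 1 c \<in> bi.D F" "bi.D F \<inter> V = {}"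
      using V unfolding bi.closedin_zsub[OF zsub_F1] by meson
    have "(\<lambda>w. F (cox 1 (w 0) 1 c)) \<in> polys 1"
      by (rule BF_cox_polys[OF F(1)]) (auto intro: polys_var)
    from polys_line[OF this, of "\<lambda>_. 0" "\<lambda>_. 1"] obtain P where P: "\<And>t. F (cox 1 t 1 c) = poly P t" by auto
    have Pt: "poly P t \<noteq> 0" using F(2) unfolding D_cpt[OF F(1) cv] P .
    have roots: "poly P (\<zeta> * \<beta>) = 0" if "\<zeta> ^ 2 ^ n = 1" for \<zeta> n
    proof -
      have "cpt 1 (\<zeta> * \<beta>) 1 c \<notin> bi.D F" using orbit[OF that] F(3) by (meson disjoint_iff)
      then show ?thesis by (simp only: D_cpt[OF F(1) cv] P) simp
    qed
    have "2 ^ n \<le> degree P" for n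
    proof -
      have "2 ^ n = card {z::complex. z ^ 2 ^ n = 1}" by (rule card_roots_unity_eq[symmetric]) simp
      also have "\<dots> = card ((\<lambda>z. z * \<beta>) ` {z::complex. z ^ 2 ^ n = 1})"
        by (rule card_image[symmetric]) (use p(2) in \<open>auto simp: inj_on_def\<close>)
      also have "\<dots> \<le> card {x. poly P x = 0}"
        by (rule card_mono) (use Pt roots in \<open>auto intro!: poly_roots_finite\<close>)
      also have "\<dots> \<le> degree P" by (rule card_poly_roots_bound) (use Pt in auto)
      finally show ?thesis .
    qed
    from this[of "degree P"] show False using less_exp[of "degree P"] by simp
  qed
  have "sectionW c \<subseteq> V \<union> fib0"
  proof
    fix q assume q: "q \<in> sectionW c"
    then obtain a b' h s where *: "cval a b' h s" "q = cpt a b' h s" using F1_cpt locus_sub by blast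
    then have s: "s = c * (a * h)" using cpt_sectionW q by blast
    show "q \<in> V \<union> fib0"
    proof (cases "a = 0")
      case True then show ?thesis using * cpt_fib0 by blast
    next
      case False
      have h: "h \<noteq> 0" using * s by (auto simp: cval_def)
      have "q = cpt 1 (b' / a) 1 c" using cpt_scale[of a h 1 "b' / a" 1 c] False h * s by (simp add: mult_ac)
      then show ?thesis using open_part by blast
    qed
  qed
  then have "sectionW c = (sectionW c \<inter> V) \<union> (sectionW c \<inter> fib0)" by blast
  moreover have "closedin (zar F1) (sectionW c \<inter> V)" "closedin (zar F1) (sectionW c \<inter> fib0)"
    using irr_sectionW irr_fib0 V unfolding irreducible_closed_def by blast+
  ultimately have "sectionW c = sectionW c \<inter> V \<or> sectionW c = sectionW c \<inter> fib0"
    using irr_sectionW[of c] unfolding irreducible_closed_def by blast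
  moreover have "cpt 1 0 1 c \<in> sectionW c" "cpt 1 0 1 c \<notin> fib0"
    using cpt_sectionW[OF cv] cpt_fib0[OF cv] by auto
  ultimately show ?thesis by blast
qed

text \<open>
  The iterates are even in the fibre coordinate, which leaves only \<open>c = 0\<close>; but over the points with
  \<open>a h = 1\<close> the iterates do not fix 0.
\<close>

lemma section_not_periodic:
  assumes "b \<ge> 1" "preim F1 (gF1 ^^ b) (sectionW c) = sectionW c"
  shows False
proof -
  have pr: "x \<in> F1pts \<and> (gF1 ^^ b) x \<in> sectionW c \<longleftrightarrow> x \<in> sectionW c" for x
    using assms(2) unfolding preim_def pts_F1 by blast
  have cv: "cval 1 1 1 s" for s by (auto simp: cval_def)
  have mem: "cpt 1 1 1 s \<in> sectionW c \<longleftrightarrow> s = c" for s using cpt_sectionW[OF cv] by simp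
  have g: "(gF1 ^^ b) (cpt 1 1 1 s) = cpt 1 1 1 (fibre_iter b 1 s)" for s using gF1_funpow[OF cv] by simp
  have "cpt 1 1 1 (fibre_iter b 1 c) \<in> sectionW c" using pr[of "cpt 1 1 1 c"] mem g by simp
  then have fc: "fibre_iter b 1 c = c" using mem by simp
  then have "(gF1 ^^ b) (cpt 1 1 1 (- c)) \<in> sectionW c" using mem g fibre_iter_even[OF assms(1)] by simp
  then have "cpt 1 1 1 (- c) \<in> sectionW c" using pr cpt_F1[OF cv] by blast
  then have "c = 0" using mem by simp
  then show False using fc fibre_iter_pos[OF assms(1)] by auto
qed

lemma curves_facts:
  "curveE \<subset> F1pts" "fib0 \<subset> F1pts" "fib1 \<subset> F1pts"
  "cpt 1 0 0 1 \<in> curveE" "cpt 0 1 0 1 \<in> curveE" "cpt 0 1 0 1 \<in> fib0" "cpt 0 1 1 0 \<in> fib0"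
  "cpt 1 0 0 1 \<in> fib1" "cpt 1 0 1 0 \<in> fib1"
  "cpt 1 0 0 1 \<notin> fib0" "cpt 0 1 1 0 \<notin> curveE" "cpt 0 1 0 1 \<notin> fib1" "cpt 1 0 1 0 \<notin> curveE" 
proof -
  have c: "cval 1 0 0 1" "cval 0 1 0 1" "cval 1 0 1 0" "cval 0 1 1 0" by (auto simp: cval_def)
  show "cpt 1 0 0 1 \<in> curveE" "cpt 0 1 0 1 \<in> curveE" "cpt 0 1 0 1 \<in> fib0" "cpt 0 1 1 0 \<in> fib0"
  "cpt 1 0 0 1 \<in> fib1" "cpt 1 0 1 0 \<in> fib1"
  "cpt 1 0 0 1 \<notin> fib0" "cpt 0 1 1 0 \<notin> curveE" "cpt 0 1 0 1 \<notin> fib1" "cpt 1 0 1 0 \<notin> curveE" 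
    using c by (simp_all add: cpt_curveE cpt_fib0 cpt_fib1)
  then show "curveE \<subset> F1pts" "fib0 \<subset> F1pts" "fib1 \<subset> F1pts" using locus_sub c cpt_F1 by blast+
qed

lemma preim_gF1_eqI:
  assumes "C \<subseteq> F1pts" "\<And>a b h s. cval a b h s \<Longrightarrow>
    cpt (a ^ 2) (b ^ 2) (h ^ 2) (s ^ 2 + (a * h) ^ 2) \<in> C \<longleftrightarrow> cpt a b h s \<in> C"
  shows "preim F1 gF1 C = C"
proof -
  have "gF1 q \<in> C \<longleftrightarrow> q \<in> C" if q: "q \<in> F1pts" for q
  proof -
    obtain a b h s where *: "cval a b h s" "q = cpt a b h s" using F1_cpt[OF q] by blast
    show ?thesis unfolding *(2) gF1_cpt[OF *(1)] by (rule assms(2)[OF *(1)])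
  qed
  then show ?thesis unfolding preim_def pts_F1 using assms(1) by blast
qed

lemma preim_curves: "preim F1 gF1 curveE = curveE" "preim F1 gF1 fib0 = fib0" "preim F1 gF1 fib1 = fib1"
  by (rule preim_gF1_eqI, rule locus_sub, simp add: cpt_curveE cpt_fib0 cpt_fib1 gF1_cval)+

lemma totally_periodicI: "preim F1 gF1 V = V \<Longrightarrow> totally_periodic F1 gF1 V"
  unfolding totally_periodic_def by (intro exI[of _ 1]) simp

text \<open>
  A curve outside the three invariant ones contains a section by \<open>saturated_contains_section\<close> and is
  equal to it for dimension reasons.
\<close>

lemma tot_per_curves: "tot_per_set F1 gF1 1 = {curveE, fib0, fib1}"
proof
  show "{curveE, fib0, fib1} \<subseteq> tot_per_set F1 gF1 1"
  proof -
    have ne: "curveE \<noteq> {cpt 1 0 0 1}" "fib0 \<noteq> {cpt 0 1 0 1}" "fib1 \<noteq> {cpt 1 0 0 1}"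
      using curves_facts(4-13) by (metis singletonD)+
    have "codimension F1 curveE = 1" "codimension F1 fib0 = 1" "codimension F1 fib1 = 1"
      by (rule codim_curve[OF irr_curveE curves_facts(4) ne(1) curves_facts(1)]
        codim_curve[OF irr_fib0 curves_facts(6) ne(2) curves_facts(2)]
        codim_curve[OF irr_fib1 curves_facts(8) ne(3) curves_facts(3)])+
    then show ?thesis unfolding tot_per_set_def
      using irr_curveE irr_fib0 irr_fib1 totally_periodicI preim_curves by (auto simp: one_enat_def)
  qed
  show "tot_per_set F1 gF1 1 \<subseteq> {curveE, fib0, fib1}"
  proof
    fix V assume "V \<in> tot_per_set F1 gF1 1"
    then obtain b where V: "irreducible_closed F1 V" "codimension F1 V = 1" and b: "b \<ge> 1" "preim F1 (gF1 ^^ b) V = V"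
      unfolding tot_per_set_def totally_periodic_def by (auto simp: one_enat_def)
    note max = codim_1_maximal[OF V]
    have cl: "closedin (zar F1) V" using V(1) unfolding irreducible_closed_def by blast
    show "V \<in> {curveE, fib0, fib1}"
    proof (cases "V \<subseteq> curveE \<union> (fib0 \<union> fib1)")
      case True
      have irrV: "V = A \<or> V = B" if "closedin (zar F1) A" "closedin (zar F1) B" "V = A \<union> B" for A B
        using V(1) that unfolding irreducible_closed_def by blast
      have c: "closedin (zar F1) curveE" "closedin (zar F1) fib0" "closedin (zar F1) fib1"
        using irr_curveE irr_fib0 irr_fib1 unfolding irreducible_closed_def by auto
      have "V = V \<inter> curveE \<or> V = V \<inter> (fib0 \<union> fib1)"
        by (rule irrV) (use c cl True in \<open>auto intro: closedin_Int closedin_Un\<close>)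
      moreover have "V = V \<inter> fib0 \<or> V = V \<inter> fib1" if "V = V \<inter> (fib0 \<union> fib1)"
        by (rule irrV) (use c cl that in \<open>auto intro: closedin_Int\<close>)
      ultimately have "V \<subseteq> curveE \<or> V \<subseteq> fib0 \<or> V \<subseteq> fib1" by blast
      then show ?thesis
        using max(2)[OF irr_curveE _ curves_facts(1)] max(2)[OF irr_fib0 _ curves_facts(2)]
          max(2)[OF irr_fib1 _ curves_facts(3)] by blast
    next
      case False
      then obtain p where p: "p \<in> V" "p \<notin> curveE" "p \<notin> fib0" "p \<notin> fib1" by blast
      then have "p \<in> F1pts" using irreducible_sub[OF V(1)] by blast
      then obtain x y h s where *: "cval x y h s" "p = cpt x y h s" using F1_cpt by blast
      then have nz: "x \<noteq> 0" "y \<noteq> 0" "h \<noteq> 0" using p cpt_curveE cpt_fib0 cpt_fib1 by auto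
      have "p = cpt 1 (y / x) 1 (s / (x * h))" using cpt_scale[of x h 1 "y / x" 1 "s / (x * h)"] nz * by simp
      then have pV: "cpt 1 (y / x) 1 (s / (x * h)) \<in> V" using p by simp
      have yx: "y / x \<noteq> 0" using nz by simp
      have W: "sectionW (s / (x * h)) \<subseteq> V" by (rule saturated_contains_section[OF cl b(2,1) pV yx])
      have cv: "cval 1 0 1 c" "cval 0 1 1 0" for c by (auto simp: cval_def)
      have w: "cpt 1 0 1 c \<in> sectionW c" "cpt 0 1 1 0 \<in> sectionW c" "cpt 1 0 1 c \<notin> fib0" for c
        using cpt_sectionW[OF cv(1)] cpt_sectionW[OF cv(2)] cpt_fib0[OF cv(1)] by auto
      have "sectionW (s / (x * h)) \<noteq> {cpt 1 0 1 (s / (x * h))}" 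
        using w(2)[of "s / (x * h)"] w(3)[of "s / (x * h)"] curves_facts(7) by (metis singletonD)
      then have "V = sectionW (s / (x * h))" using max(3)[OF irr_sectionW W w(1)] by blast
      then show ?thesis using section_not_periodic b by blast
    qed
  qed
qed

section \<open>Totally periodic points\<close>

lemma corner_E0: "cval a b h s \<Longrightarrow> cpt a b h s = cpt 0 1 0 1 \<longleftrightarrow> a = 0 \<and> h = 0"
proof
  assume c: "cval a b h s"
  have c': "cval 0 1 0 1" by (auto simp: cval_def)
  { assume "cpt a b h s = cpt 0 1 0 1"
    then show "a = 0 \<and> h = 0" using cpt_fib0 cpt_curveE c c' by metis }
  { assume "a = 0 \<and> h = 0"
    then show "cpt a b h s = cpt 0 1 0 1" using c cpt_scale[of b "s / b" 0 1 0 1] by (auto simp: cval_def) }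
qed

lemma corner_E1: "cval a b h s \<Longrightarrow> cpt a b h s = cpt 1 0 0 1 \<longleftrightarrow> b = 0 \<and> h = 0"
proof
  assume c: "cval a b h s"
  have c': "cval 1 0 0 1" by (auto simp: cval_def)
  { assume "cpt a b h s = cpt 1 0 0 1"
    then show "b = 0 \<and> h = 0" using cpt_fib1 cpt_curveE c c' by metis }
  { assume "b = 0 \<and> h = 0"
    then show "cpt a b h s = cpt 1 0 0 1" using c cpt_scale[of a "s / a" 1 0 0 1] by (auto simp: cval_def) }
qed

lemma cpt_sectionW0: "cval a b h s \<Longrightarrow> cpt a b h s \<in> sectionW 0 \<longleftrightarrow> s = 0"
  using cpt_sectionW by simp

lemma corner_W0: "cval a b h s \<Longrightarrow> cpt a b h s = cpt 0 1 1 0 \<longleftrightarrow> a = 0 \<and> s = 0"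
proof
  assume c: "cval a b h s"
  have c': "cval 0 1 1 0" by (auto simp: cval_def)
  { assume "cpt a b h s = cpt 0 1 1 0"
    then show "a = 0 \<and> s = 0" using cpt_fib0 cpt_sectionW0 c c' by metis }
  { assume "a = 0 \<and> s = 0"
    then show "cpt a b h s = cpt 0 1 1 0" using c cpt_scale[of b h 0 1 1 0] by (auto simp: cval_def) }
qed

lemma preim_corners: "preim F1 gF1 {cpt 0 1 0 1} = {cpt 0 1 0 1}"
  "preim F1 gF1 {cpt 1 0 0 1} = {cpt 1 0 0 1}" "preim F1 gF1 {cpt 0 1 1 0} = {cpt 0 1 1 0}"
proof -
  have c: "cpt 0 1 0 1 \<in> F1pts" "cpt 1 0 0 1 \<in> F1pts" "cpt 0 1 1 0 \<in> F1pts"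
    by (rule cpt_F1; simp add: cval_def)+
  show "preim F1 gF1 {cpt 0 1 0 1} = {cpt 0 1 0 1}"
    by (rule preim_gF1_eqI) (use c corner_E0 gF1_cval in auto)
  show "preim F1 gF1 {cpt 1 0 0 1} = {cpt 1 0 0 1}"
    by (rule preim_gF1_eqI) (use c corner_E1 gF1_cval in auto)
  show "preim F1 gF1 {cpt 0 1 1 0} = {cpt 0 1 1 0}"
    by (rule preim_gF1_eqI) (use c corner_W0 gF1_cval in auto)
qed

text \<open>
  The sign changes of \<open>b\<close> and of \<open>s\<close> are symmetries of all iterates, so a totally periodic point is fixed
  by them. This leaves the four points \<open>h = 0\<close> or \<open>s = 0\<close> on the two invariant fibres, and the orbit of the
  fourth, \<open>b = s = 0\<close>, does not return.
\<close>

lemma tot_per_points: "tot_per_set F1 gF1 2 = {{cpt 0 1 0 1}, {cpt 1 0 0 1}, {cpt 0 1 1 0}}"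
proof
  have ne: "curveE \<noteq> {cpt 0 1 0 1}" "curveE \<noteq> {cpt 1 0 0 1}" "fib0 \<noteq> {cpt 0 1 1 0}"
    using curves_facts(4-13) by (metis singletonD)+
  have "codimension F1 {cpt 0 1 0 1} = 2" "codimension F1 {cpt 1 0 0 1} = 2" "codimension F1 {cpt 0 1 1 0} = 2"
    using codim_point[OF irr_curveE curves_facts(5) ne(1) curves_facts(1)]
      codim_point[OF irr_curveE curves_facts(4) ne(2) curves_facts(1)]
      codim_point[OF irr_fib0 curves_facts(7) ne(3) curves_facts(2)] by blast+
  moreover have "cpt 0 1 0 1 \<in> F1pts" "cpt 1 0 0 1 \<in> F1pts" "cpt 0 1 1 0 \<in> F1pts"
    using curves_facts(5,4,7) locus_sub(1,2) by (metis subsetD)+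
  ultimately show "{{cpt 0 1 0 1}, {cpt 1 0 0 1}, {cpt 0 1 1 0}} \<subseteq> tot_per_set F1 gF1 2"
    unfolding tot_per_set_def using irr_point totally_periodicI preim_corners
    by (auto simp: numeral_eq_enat)
  show "tot_per_set F1 gF1 2 \<subseteq> {{cpt 0 1 0 1}, {cpt 1 0 0 1}, {cpt 0 1 1 0}}"
  proof
    fix V assume "V \<in> tot_per_set F1 gF1 2"
    then obtain m where V: "irreducible_closed F1 V" "codimension F1 V = 2" and m: "m \<ge> 1" "preim F1 (gF1 ^^ m) V = V"
      unfolding tot_per_set_def totally_periodic_def by (auto simp: numeral_eq_enat)
    obtain p where p: "p \<in> F1pts" "V = {p}" using codim_2_singleton[OF V] by blast
    obtain a b h s where *: "cval a b h s" "p = cpt a b h s" using F1_cpt p(1) by blast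
    have sat: "q = p" if "q \<in> F1pts" "(gF1 ^^ m) q = (gF1 ^^ m) p" for q
      using totally_periodic_saturated[OF m(2), of p q 1] that p by simp
    have fixp: "(gF1 ^^ m) p = p"
      using m(2) p unfolding preim_def by blast
    have ev: "(- x :: complex) ^ 2 ^ m = x ^ 2 ^ m" for x using m(1) by simp
    have cb: "cval a (- b) h s" using * by (auto simp: cval_def)
    have "cpt a (- b) h s = cpt a b h s"
      using sat[OF cpt_F1[OF cb]] unfolding *(2)
      by (simp add: gF1_funpow[OF cb, THEN conjunct2] gF1_funpow[OF *(1), THEN conjunct2] ev)
    moreover have "(\<lambda>v. b * snd v 0 - a * snd v 1) \<in> \<Union>BF"
      by (intro BF_I[OF biforms_diff[OF biforms_cmult[OF biforms_y] biforms_cmult[OF biforms_y]]]) auto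
    note D = D_cpt[OF this]
    ultimately have ab: "a = 0 \<or> b = 0" using D[OF *(1)] D[OF cb] by auto
    have cs: "cval a b h (- s)" using * by (auto simp: cval_def)
    have eqs: "cpt a b h (- s) = cpt a b h s"
      using sat[OF cpt_F1[OF cs]] unfolding *(2)
      by (simp add: gF1_funpow[OF cs, THEN conjunct2] gF1_funpow[OF *(1), THEN conjunct2] fibre_iter_even[OF m(1)])
    have hs: "h = 0 \<or> s = 0"
    proof (rule ccontr)
      assume hs: "\<not> (h = 0 \<or> s = 0)"
      define i :: nat where "i = (if a = 0 then 1 else 0)"
      have i: "i < 3" "fst (cox a b h s) i \<noteq> 0" "fst (cox a b h (- s)) i = fst (cox a b h s) i"
        using *(1) hs by (auto simp: i_def cval_def)
      let ?F = "\<lambda>v. s * fst v i - fst (cox a b h s) i * fst v 2"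
      have F: "?F \<in> \<Union>BF"
        by (intro BF_I[OF biforms_diff[OF biforms_cmult[OF biforms_x] biforms_cmult[OF biforms_x]]]) (use i in auto)
      have "?F (cox a b h (- s)) \<noteq> 0" "?F (cox a b h s) = 0" using i hs by (simp_all add: mult.commute)
      then show False using D_cpt[OF F *(1)] D_cpt[OF F cs] eqs by simp
    qed
    have "\<not> (b = 0 \<and> s = 0)"
    proof
      assume bs: "b = 0 \<and> s = 0"
      then have nz: "a \<noteq> 0" "h \<noteq> 0" using *(1) by (auto simp: cval_def)
      have c1: "cval 1 0 1 t" for t by (auto simp: cval_def)
      have "p = cpt 1 0 1 0" using cpt_scale[of a h 1 0 1 0] nz bs *(2) by simp
      have zero: "(0::complex) ^ 2 ^ m = 0" by (rule zero_power) simp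
      from \<open>p = cpt 1 0 1 0\<close> have "cpt 1 0 1 (fibre_iter m 1 0) = cpt 1 0 1 0"
        using fixp gF1_funpow[OF c1, of m 0, THEN conjunct2] by (simp add: zero)
      then have "fibre_iter m 1 0 = 0" using cpt_sectionW0[OF c1] by metis
      then show False using fibre_iter_pos[OF m(1)] by auto
    qed
    then show "V \<in> {{cpt 0 1 0 1}, {cpt 1 0 0 1}, {cpt 0 1 1 0}}"
      using ab hs corner_E0[OF *(1)] corner_E1[OF *(1)] corner_W0[OF *(1)] unfolding p(2) *(2) by auto
  qed
qed

lemma tot_per_poly_F1:
  "tot_per_poly F1 gF1 = [:1, 1:] ^ 3" "\<forall>r\<in>{1..var_dim F1}. finite (tot_per_set F1 gF1 r)"
proof -
  have n1: "curveE \<noteq> fib0" "curveE \<noteq> fib1" "fib0 \<noteq> fib1" using curves_facts(4-13) by metis+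
  then have c1: "card (tot_per_set F1 gF1 (Suc 0)) = 3" using tot_per_curves by simp
  have n2: "cpt 0 1 0 1 \<noteq> cpt 1 0 0 1" "cpt 0 1 0 1 \<noteq> cpt 0 1 1 0" "cpt 1 0 0 1 \<noteq> cpt 0 1 1 0"
    using curves_facts(4-13) by metis+
  then have c2: "card (tot_per_set F1 gF1 2) = 3" using tot_per_points by simp
  have I: "{1..2::nat} = {Suc 0, 2}" by auto
  show "\<forall>r\<in>{1..var_dim F1}. finite (tot_per_set F1 gF1 r)"
    unfolding var_dim_F1 I using tot_per_curves tot_per_points by simp
  show "tot_per_poly F1 gF1 = [:1, 1:] ^ 3"
    unfolding tot_per_poly_def var_dim_F1 I
    by (simp add: c1 c2 monom_altdef power3_eq_cube power2_eq_square one_pCons)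
qed

section \<open>The Segre embedding\<close>

interpretation pj: zcoord "proj_points n" "\<lambda>p. p" "range (forms (n + 1))" for n by (rule zcoord_proj)

lemma zsub_proj: "zsub (proj_points n) (\<lambda>p. p) (range (forms (n + 1))) (proj_space n) (proj_points n)"
  unfolding proj_space_def by (rule pj.zsub_space)

text \<open>
  The entry \<open>x_i y_j\<close> of the 3 by 2 matrix has index \<open>2 i + j\<close>.
\<close>

definition segre :: "cvec \<times> cvec \<Rightarrow> cvec" where
  "segre v = (\<lambda>k. if k < 6 then fst v (k div 2) * snd v (k mod 2) else 0)"

text \<open>
  The column and the row of the matrix through its entry \<open>k\<close>. For a matrix of rank one and a nonzero
  entry they are homogeneous coordinates of the two factors.
\<close>

definition unsegre :: "nat \<Rightarrow> cvec \<Rightarrow> cvec \<times> cvec" where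
  "unsegre k z = (\<lambda>i. if i < 3 then z (2 * i + k mod 2) else 0, \<lambda>j. if j < 2 then z (2 * (k div 2) + j) else 0)"

definition emb :: "ppoint \<times> ppoint \<Rightarrow> ppoint" where
  "emb q = proj_point (segre (SOME v. v \<in> crd21 q))"

lemma segre_scale: "segre ((\<lambda>i. a * fst v i), (\<lambda>i. b * snd v i)) = (\<lambda>k. (a * b) * segre v k)"
  by (auto simp: segre_def fun_eq_iff)

lemma emb_crd:
  assumes "q \<in> P21" "v \<in> crd21 q" shows "emb q = proj_point (segre v)"
  unfolding emb_def by (rule some_crd[OF assms]) (simp add: segre_scale proj_point_scale)

lemma segre_cspace: "segre v \<in> cspace (5 + 1)"
  by (auto simp: segre_def cspace_def)

lemma segre_nz: "bvec v \<Longrightarrow> \<exists>k<6. segre v k \<noteq> 0"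
proof -
  assume v: "bvec v"
  obtain i where i: "fst v i \<noteq> 0" using v unfolding bvec_def by auto
  obtain j where j: "snd v j \<noteq> 0" using v unfolding bvec_def by auto
  have "i < 3" "j < 2" using i j v unfolding bvec_def cspace_def by (auto simp: not_less[symmetric])
  then have k: "2 * i + j < 6" "(2 * i + j) div 2 = i" "(2 * i + j) mod 2 = j" by auto
  then have "segre v (2 * i + j) \<noteq> 0" using i j by (simp add: segre_def)
  then show ?thesis using k(1) by blast
qed

lemma segre_proj: "bvec v \<Longrightarrow> proj_point (segre v) \<in> proj_points 5"
  using segre_nz[of v] by (intro proj_point_in segre_cspace) (auto simp: fun_eq_iff)

lemma segre_biforms: "k < 6 \<Longrightarrow> (\<lambda>v. segre v k) \<in> biforms 3 2 1 1"
proof -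
  assume k: "k < 6"
  then have "k div 2 < 3" "k mod 2 < 2" by auto
  from biforms_mult[OF biforms_x[OF this(1), of 2] biforms_y[OF this(2), of 3]]
  show ?thesis using k by (simp add: segre_def)
qed

lemma segre_index: "k < 6 \<Longrightarrow> i < 2 \<Longrightarrow> 2 * (k div 2) + i < (6::nat)"
  by presburger

text \<open>
  Rank one, and the equation \<open>x0 y1 = x1 y0\<close> of the surface.
\<close>

definition segre_relations :: "cvec \<Rightarrow> bool" where
  "segre_relations z \<longleftrightarrow> (\<forall>k<6. \<forall>l<6. z k * z l = z (2 * (k div 2) + l mod 2) * z (2 * (l div 2) + k mod 2)) \<and> z 1 = z 2"

definition F1emb :: "ppoint set" where
  "F1emb = {p \<in> proj_points 5. \<forall>z\<in>p. segre_relations z}"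

lemma segre_relations_scale: "segre_relations z \<Longrightarrow> segre_relations (\<lambda>i. c * z i)"
proof -
  have m: "(c * a) * (c * b) = (c * c) * (a * b)" for a b by (simp add: mult_ac)
  assume "segre_relations z"
  then show ?thesis unfolding segre_relations_def m by simp
qed

lemma proj_F1emb: "proj_point z \<in> proj_points 5 \<Longrightarrow> segre_relations z \<Longrightarrow> proj_point z \<in> F1emb"
  unfolding F1emb_def proj_point_iff using segre_relations_scale by (auto simp: proj_point_iff)

lemma F1_bvec:
  assumes "q \<in> F1pts" "v \<in> crd21 q"
  shows "bvec v" "q = bpt v" "fst v 0 * snd v 1 = fst v 1 * snd v 0" "q \<in> P21"
proof -
  show q: "q \<in> P21" using assms F1pts_sub by blast
  show v: "bvec v" "q = bpt v" using crd21_bpt[OF q assms(2)] .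
  show "fst v 0 * snd v 1 = fst v 1 * snd v 0" using assms v bpt_F1 by simp
qed

lemma segre_relations_segre: "q \<in> F1pts \<Longrightarrow> v \<in> crd21 q \<Longrightarrow> segre_relations (segre v)"
proof -
  assume q: "q \<in> F1pts" and v: "v \<in> crd21 q"
  have "segre v 1 = segre v 2" using F1_bvec(3)[OF q v] by (simp add: segre_def)
  moreover have "segre v k * segre v l = segre v (2 * (k div 2) + l mod 2) * segre v (2 * (l div 2) + k mod 2)"
    if "k < 6" "l < 6" for k l
  proof -
    have "2 * (k div 2) + l mod 2 < 6" "2 * (l div 2) + k mod 2 < 6" using that by (simp_all add: segre_index)
    then show ?thesis using that by (simp add: segre_def)
  qed
  ultimately show ?thesis unfolding segre_relations_def by blast
qed

lemma emb_F1emb: "q \<in> F1pts \<Longrightarrow> emb q \<in> F1emb"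
proof -
  assume q: "q \<in> F1pts"
  then obtain v where v: "v \<in> crd21 q" using bi.crd_nonempty F1pts_sub by blast
  show ?thesis unfolding emb_crd[OF F1_bvec(4)[OF q v] v]
    by (rule proj_F1emb[OF segre_proj[OF F1_bvec(1)[OF q v]] segre_relations_segre[OF q v]])
qed

lemma unsegre_segre:
  assumes "bvec v" "k < 6" "segre v k \<noteq> 0"
  shows "bpt (unsegre k (segre v)) = bpt v"
proof -
  have nz: "fst v (k div 2) \<noteq> 0" "snd v (k mod 2) \<noteq> 0" using assms by (auto simp: segre_def)
  have "unsegre k (segre v) = ((\<lambda>i. snd v (k mod 2) * fst v i), (\<lambda>i. fst v (k div 2) * snd v i))"
  proof (rule prod_eqI; rule ext)
    fix i
    show "fst (unsegre k (segre v)) i = fst ((\<lambda>i. snd v (k mod 2) * fst v i), (\<lambda>i. fst v (k div 2) * snd v i)) i"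
    proof (cases "i < 3")
      case True
      then have "2 * i + k mod 2 < 6" by linarith
      then show ?thesis using True by (simp add: unsegre_def segre_def)
    next
      case False then show ?thesis using assms(1) by (auto simp: unsegre_def bvec_def cspace_def)
    qed
  next
    fix i
    show "snd (unsegre k (segre v)) i = snd ((\<lambda>i. snd v (k mod 2) * fst v i), (\<lambda>i. fst v (k div 2) * snd v i)) i"
    proof (cases "i < 2")
      case True
      then have "2 * (k div 2) + i < 6" "i mod 2 = i" using assms(2) by (simp_all add: segre_index)
      then show ?thesis using True by (simp add: unsegre_def segre_def)
    next
      case False then show ?thesis using assms(1) by (auto simp: unsegre_def bvec_def cspace_def)
    qed
  qed
  then show ?thesis using bpt_scale[OF nz(2,1)] by simp
qed

lemma segre_unsegre:
  assumes "segre_relations z" "z \<in> cspace 6" "k < 6" "z k \<noteq> 0"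
  shows "segre (unsegre k z) = (\<lambda>l. z k * z l)" "bvec (unsegre k z)" "bpt (unsegre k z) \<in> F1pts"
proof -
  show 1: "segre (unsegre k z) = (\<lambda>l. z k * z l)"
  proof
    fix l show "segre (unsegre k z) l = z k * z l"
    proof (cases "l < 6")
      case True
      then have "l div 2 < 3" by auto
      then show ?thesis using True assms(1,3) by (simp add: segre_def unsegre_def segre_relations_def mult.commute)
    next
      case False then show ?thesis using assms(2) by (simp add: segre_def cspace_def)
    qed
  qed
  have "segre (unsegre k z) k \<noteq> 0" using 1 assms(4) by simp
  then have nz: "fst (unsegre k z) (k div 2) \<noteq> 0" "snd (unsegre k z) (k mod 2) \<noteq> 0"
    using assms(3) by (auto simp: segre_def)
  have "fst (unsegre k z) \<in> cspace 3" "snd (unsegre k z) \<in> cspace 2"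
    by (simp_all add: cspace_def unsegre_def)
  then show 2: "bvec (unsegre k z)" unfolding bvec_def using nz by metis
  have "segre (unsegre k z) 1 = segre (unsegre k z) 2" using assms(1) unfolding 1 segre_relations_def by simp
  then show "bpt (unsegre k z) \<in> F1pts" unfolding bpt_F1[OF 2] by (simp add: segre_def)
qed

lemma F1emb_mem:
  assumes "p \<in> F1emb" "z \<in> p"
  shows "segre_relations z" "z \<in> cspace 6" "p = proj_point z" "\<exists>k<6. z k \<noteq> 0"
proof -
  have p: "p \<in> proj_points 5" using assms unfolding F1emb_def by blast
  show "segre_relations z" using assms unfolding F1emb_def by blast
  show z: "z \<in> cspace 6" "p = proj_point z" using proj_points_mem[OF p assms(2)] by auto
  obtain k where "z k \<noteq> 0" using proj_points_mem(2)[OF p assms(2)] by auto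
  moreover from this have "k < 6" using z(1) unfolding cspace_def by (auto simp: not_less[symmetric])
  ultimately show "\<exists>k<6. z k \<noteq> 0" by blast
qed

lemma emb_unsegre:
  assumes "p \<in> F1emb" "z \<in> p" "k < 6" "z k \<noteq> 0"
  shows "bpt (unsegre k z) \<in> F1pts" "emb (bpt (unsegre k z)) = p"
proof -
  note z = F1emb_mem[OF assms(1,2)]
  note u = segre_unsegre[OF z(1,2) assms(3,4)]
  show "bpt (unsegre k z) \<in> F1pts" by (rule u(3))
  have "emb (bpt (unsegre k z)) = proj_point (segre (unsegre k z))" by (rule emb_crd[OF bpt_P21[OF u(2)] bpt_crd])
  then show "emb (bpt (unsegre k z)) = p" unfolding u(1) z(3) using proj_point_scale[OF assms(4)] by simp
qed

definition unemb :: "ppoint \<Rightarrow> ppoint \<times> ppoint" where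
  "unemb p = (SOME q. q \<in> F1pts \<and> emb q = p)"

lemma emb_inj: "q \<in> F1pts \<Longrightarrow> q' \<in> F1pts \<Longrightarrow> emb q = emb q' \<Longrightarrow> q = q'"
proof -
  assume q: "q \<in> F1pts" "q' \<in> F1pts" "emb q = emb q'"
  then obtain v w where v: "v \<in> crd21 q" and w: "w \<in> crd21 q'" using bi.crd_nonempty F1pts_sub by blast
  note v' = F1_bvec[OF q(1) v] and w' = F1_bvec[OF q(2) w]
  obtain k where k: "k < 6" "segre v k \<noteq> 0" using segre_nz[OF v'(1)] by blast
  have "proj_point (segre v) = proj_point (segre w)"
    using q(3) emb_crd[OF v'(4) v] emb_crd[OF w'(4) w] by simp
  then have "segre w \<in> proj_point (segre v)" by simp
  then obtain c where c: "c \<noteq> 0" "segre w = (\<lambda>i. c * segre v i)" unfolding proj_point_iff by blast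
  have "unsegre k (segre w) = ((\<lambda>i. c * fst (unsegre k (segre v)) i), (\<lambda>i. c * snd (unsegre k (segre v)) i))"
    by (auto simp: unsegre_def c(2) fun_eq_iff)
  then have "bpt (unsegre k (segre w)) = bpt (unsegre k (segre v))" using bpt_scale[OF c(1,1)] by simp
  then show "q = q'" using unsegre_segre[OF v'(1) k] unsegre_segre[OF w'(1) k(1)] v'(2) w'(2) c k by simp
qed

lemma unemb_emb: "q \<in> F1pts \<Longrightarrow> unemb (emb q) = q"
  unfolding unemb_def by (rule some_equality) (auto intro: emb_inj)

lemma unemb_eq: "p \<in> F1emb \<Longrightarrow> z \<in> p \<Longrightarrow> k < 6 \<Longrightarrow> z k \<noteq> 0 \<Longrightarrow> unemb p = bpt (unsegre k z)"
  using emb_unsegre unemb_emb by metis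

lemma F1emb_ex: "p \<in> F1emb \<Longrightarrow> \<exists>z\<in>p. \<exists>k<6. z k \<noteq> 0"
proof -
  assume p: "p \<in> F1emb"
  then obtain z where z: "z \<in> p" unfolding F1emb_def using proj_point_ne by blast
  then show ?thesis using F1emb_mem(4)[OF p z] by blast
qed

lemma emb_unemb: "p \<in> F1emb \<Longrightarrow> emb (unemb p) = p \<and> unemb p \<in> F1pts"
  using F1emb_ex[of p] unemb_eq[of p] emb_unsegre[of p] by metis

lemma emb_image: "emb ` F1pts = F1emb"
  using emb_F1emb emb_unemb by (auto simp: image_iff) metis

lemma F1emb_sub: "F1emb \<subseteq> proj_points 5" by (auto simp: F1emb_def)

lemma closedin_F1emb: "closedin (zar (proj_space 5)) F1emb"
  unfolding pj.closedin_zsub[OF zsub_proj]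
proof (intro conjI ballI F1emb_sub)
  fix p assume p: "p \<in> proj_points 5 - F1emb"
  then obtain z where z: "z \<in> p" "\<not> segre_relations z" unfolding F1emb_def by blast
  have "\<exists>F d. F \<in> forms (5 + 1) d \<and> F z \<noteq> 0 \<and> (\<forall>w. segre_relations w \<longrightarrow> F w = 0)"
  proof (cases "z 1 = z 2")
    case True
    then obtain k l where kl: "k < 6" "l < 6"
      "z k * z l \<noteq> z (2 * (k div 2) + l mod 2) * z (2 * (l div 2) + k mod 2)"
      using z(2) unfolding segre_relations_def by blast
    let ?F = "\<lambda>z. z k * z l + (-1) * (z (2 * (k div 2) + l mod 2) * z (2 * (l div 2) + k mod 2))"
    have lt: "2 * (k div 2) + l mod 2 < 6" "2 * (l div 2) + k mod 2 < 6" using kl(1,2) by (simp_all add: segre_index)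
    have "?F \<in> forms (5 + 1) (1 + 1)"
      by (intro forms_add forms_cmult forms_mult forms_var) (use kl lt in auto)
    then show ?thesis using kl by (intro exI[of _ ?F] exI[of _ "1 + 1"]) (auto simp: segre_relations_def)
  next
    case False
    have "(\<lambda>z. z 1 + (-1) * z 2) \<in> forms (5 + 1) 1" by (intro forms_add forms_cmult forms_var) auto
    then show ?thesis using False
      by (intro exI[of _ "\<lambda>z. z 1 + (-1) * z 2"] exI[of _ 1]) (auto simp: segre_relations_def)
  qed
  then obtain F d where F: "F \<in> forms (5 + 1) d" "F z \<noteq> 0" "\<forall>w. segre_relations w \<longrightarrow> F w = 0" by blast
  have FU: "F \<in> \<Union>(range (forms (5 + 1)))" using F(1) by blast
  have "p \<in> pj.D 5 F" using pj.D_iff[OF FU _ z(1)] p F(2) by blast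
  moreover have "pj.D 5 F \<inter> F1emb = {}"
  proof -
    { fix r assume r: "r \<in> pj.D 5 F" "r \<in> F1emb"
      then obtain w where w: "w \<in> r" using F1emb_ex by blast
      have "F w = 0" using F(3) F1emb_mem(1)[OF r(2) w] by blast
      then have False using pj.D_iff[OF FU _ w] r F1emb_sub by blast }
    then show ?thesis by blast
  qed
  ultimately show "\<exists>F\<in>\<Union>(range (forms (5 + 1))). p \<in> pj.D 5 F \<and> pj.D 5 F \<inter> F1emb = {}"
    using FU by blast
qed

lemma emb_morphism:
  assumes Y: "zsub (proj_points 5) (\<lambda>p. p) (range (forms (5 + 1))) Y S" "F1emb \<subseteq> S"
  shows "morphism F1 Y emb"
proof (rule morphismI_global[OF bi.zcoord_axioms pj.zcoord_axioms zsub_F1 Y(1)])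
  show "emb q \<in> S" if "q \<in> F1pts" for q using emb_F1emb[OF that] Y(2) by blast
  show "lifts_to F1pts crd21 BF (\<lambda>p. p) (range (forms (5 + 1))) emb segre"
  proof (rule lifts_toI)
    show "segre v \<in> emb q" if "q \<in> F1pts" "v \<in> crd21 q" for q v
      using emb_crd[OF F1_bvec(4)[OF that] that(2)] by simp
    have "(\<lambda>v. F (segre v)) \<in> biforms 3 2 (d * 1) (d * 1)" if "F \<in> forms (5 + 1) d" for F d
      by (rule forms_comp_biforms[OF that]) (use segre_biforms in \<open>auto simp: segre_def\<close>)
    then show "\<exists>H\<in>BF. \<forall>F\<in>H'. (\<lambda>v. F (segre v)) \<in> H" if "H' \<in> range (forms (5 + 1))" for H'
      using that unfolding BF_def by blast
  qed
qed

lemma unemb_morphism: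
  assumes Y: "zsub (proj_points 5) (\<lambda>p. p) (range (forms (5 + 1))) Y F1emb"
  shows "morphism Y F1 unemb"
proof (rule morphismI[OF pj.zcoord_axioms bi.zcoord_axioms Y zsub_F1])
  show "unemb q \<in> F1pts" if "q \<in> F1emb" for q using emb_unemb[OF that] by blast
  fix p assume p: "p \<in> F1emb"
  obtain z k where z: "z \<in> p" "k < 6" "z k \<noteq> 0" using F1emb_ex[OF p] by blast
  let ?K = "\<lambda>z::cvec. z k"
  have "?K \<in> forms (5 + 1) 1" using z(2) by (intro forms_var) auto
  then have K: "?K \<in> \<Union>(range (forms (5 + 1)))" by blast
  have sb: "(\<lambda>v. F (unsegre k v)) \<in> forms (5 + 1) (d + e)" if "F \<in> biforms 3 2 d e" for F d e
  proof (rule biforms_comp_forms[OF that])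
    show "(\<lambda>w. fst (unsegre k w) i) \<in> forms (5 + 1) 1" if "i < 3" for i
    proof -
      have "2 * i + k mod 2 < 5 + 1" using that by linarith
      from forms_var[OF this] show ?thesis using that by (simp add: unsegre_def)
    qed
    show "(\<lambda>w. snd (unsegre k w) i) \<in> forms (5 + 1) 1" if "i < 2" for i
    proof -
      have "2 * (k div 2) + i < 5 + 1" using segre_index[OF z(2) that] by simp
      from forms_var[OF this] show ?thesis using that by (simp add: unsegre_def)
    qed
  qed (auto simp: unsegre_def)
  have "p \<in> pj.D 5 ?K" using pj.D_iff[OF K _ z(1)] p F1emb_sub z(3) by blast
  moreover have "lifts_to (F1emb \<inter> pj.D 5 ?K) (\<lambda>p. p) (range (forms (5 + 1))) crd21 BF unemb (unsegre k)"
  proof (rule lifts_toI)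
    fix q v assume q: "q \<in> F1emb \<inter> pj.D 5 ?K" and v: "v \<in> q"
    then have "v k \<noteq> 0" unfolding principal_open_def by blast
    then have "unemb q = bpt (unsegre k v)" using unemb_eq[OF _ v z(2)] q by blast
    then show "unsegre k v \<in> crd21 (unemb q)" using bpt_crd by simp
  next
    fix H' assume "H' \<in> BF"
    then obtain d e where "H' = biforms 3 2 d e" unfolding BF_def by blast
    then show "\<exists>H\<in>range (forms (5 + 1)). \<forall>F\<in>H'. (\<lambda>v. F (unsegre k v)) \<in> H" using sb[of _ d e] by blast
  qed
  ultimately show "\<exists>K\<in>\<Union>(range (forms (5 + 1))). \<exists>\<Phi>. p \<in> pj.D 5 K \<and>
      lifts_to (F1emb \<inter> pj.D 5 K) (\<lambda>p. p) (range (forms (5 + 1))) crd21 BF unemb \<Phi>"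
    using K by blast
qed

lemma emb_closed_immersion: "closed_immersion F1 (proj_space 5) emb"
proof -
  have Y: "zsub (proj_points 5) (\<lambda>p. p) (range (forms (5 + 1))) (subspace_of (proj_space 5) F1emb) F1emb"
    by (rule pj.zsub_subspace[OF zsub_proj F1emb_sub])
  have "isomorphism F1 (subspace_of (proj_space 5) F1emb) emb"
    unfolding isomorphism_def pts_F1 pj.zsub_pts[OF Y]
  proof (intro conjI exI[of _ unemb] ballI)
    show "morphism F1 (subspace_of (proj_space 5) F1emb) emb" by (rule emb_morphism[OF Y]) simp
    show "morphism (subspace_of (proj_space 5) F1emb) F1 unemb" by (rule unemb_morphism[OF Y])
  qed (simp_all add: unemb_emb emb_unemb)
  then show ?thesis unfolding closed_immersion_def pts_F1 emb_image using closedin_F1emb by blast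
qed

lemma projective_F1: "projective_variety F1"
  unfolding projective_variety_def pts_F1 using irr_F1 emb_closed_immersion by blast

section \<open>Polarization\<close>

lemma unit_quotient:
  assumes U: "openin (zar F1) U" and AB: "A \<in> biforms 3 2 d e" "B \<in> biforms 3 2 d e"
    and nz: "\<And>q v. q \<in> U \<Longrightarrow> v \<in> crd21 q \<Longrightarrow> A v \<noteq> 0 \<and> B v \<noteq> 0"
    and rs: "\<And>q v. q \<in> U \<Longrightarrow> q \<in> fst r \<Longrightarrow> q \<in> fst s \<Longrightarrow> v \<in> crd21 q \<Longrightarrow> snd r q = A v / B v * snd s q"
  shows "unit_ratio F1 U r s"
proof -
  have UP: "U \<subseteq> P21" using U F1pts_sub unfolding bi.openin_zsub[OF zsub_F1] by blast
  have H: "biforms 3 2 d e \<in> BF" unfolding BF_def by blast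
  define u where "u q = (let v = SOME v. v \<in> crd21 q in A v / B v)" for q
  have u: "u q = A v / B v" if "q \<in> U" "v \<in> crd21 q" for q v
  proof -
    let ?v = "SOME v. v \<in> crd21 q"
    have v: "?v \<in> crd21 q" using that(2) by (rule someI)
    have "q \<in> P21" using that(1) UP by blast
    from bi.ratio_indep[OF H AB this v that(2)] show ?thesis
      using nz[OF that] nz[OF that(1) v] by (simp add: u_def Let_def field_simps)
  qed
  have "reg F1 U u" unfolding reg_F1[OF U]
    by (rule bi.regular_on_quotient[OF UP H AB]) (use u nz in blast)
  moreover have "u q \<noteq> 0 \<and> (q \<in> fst r \<inter> fst s \<longrightarrow> snd r q = u q * snd s q)" if q: "q \<in> U" for q
  proof -
    obtain v where v: "v \<in> crd21 q" using bi.crd_nonempty q UP by blast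
    show ?thesis using u[OF q v] nz[OF q v] rs[OF q _ _ v] by auto
  qed
  ultimately show ?thesis unfolding unit_ratio_def by blast
qed

text \<open>
  The hyperplane \<open>z_0 = 0\<close> cuts out the divisor of \<open>x0 y0\<close>. It is described on the charts \<open>z_j \<noteq> 0\<close>.
\<close>

definition Uopen :: "nat \<Rightarrow> (ppoint \<times> ppoint) set" where
  "Uopen j = F1pts \<inter> bi.D (\<lambda>v. segre v j)"

definition Ueq :: "nat \<Rightarrow> ppoint \<times> ppoint \<Rightarrow> complex" where
  "Ueq j = (\<lambda>p. let x = (SOME x. x \<in> p) in x 0 / x j) \<circ> emb"

definition Hdiv :: "(ppoint \<times> ppoint) cartier_data" where
  "Hdiv = (\<lambda>j. (Uopen j, (Uopen j, Ueq j))) ` {..5}"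

lemma segre_BF: "j \<le> 5 \<Longrightarrow> (\<lambda>v. segre v j) \<in> \<Union>BF"
  using segre_biforms[of j] by (intro BF_I) auto

lemma Uopen_mem: "q \<in> Uopen j \<Longrightarrow> v \<in> crd21 q \<Longrightarrow> segre v j \<noteq> 0"
  unfolding Uopen_def principal_open_def by blast

lemma openin_Uopen: "j \<le> 5 \<Longrightarrow> openin (zar F1) (Uopen j)"
  unfolding bi.openin_zsub[OF zsub_F1]
  by (intro conjI ballI bexI[OF _ segre_BF[of j]]) (auto simp: Uopen_def)

lemma Ueq_eq:
  assumes "q \<in> F1pts" "v \<in> crd21 q" shows "Ueq j q = segre v 0 / segre v j"
proof -
  have q: "q \<in> P21" using assms F1pts_sub by blast
  have "(SOME x. x \<in> emb q) \<in> emb q" by (rule someI[of _ "segre v"]) (simp add: emb_crd[OF q assms(2)])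
  then obtain c where "c \<noteq> 0" "(SOME x. x \<in> emb q) = (\<lambda>i. c * segre v i)"
    unfolding emb_crd[OF q assms(2)] proj_point_iff by blast
  then show ?thesis by (simp add: Ueq_def Let_def)
qed

lemma preim_coord_chart: "preim F1 emb (coord_chart 5 j) = Uopen j"
proof -
  have "emb q \<in> coord_chart 5 j \<longleftrightarrow> q \<in> bi.D (\<lambda>v. segre v j)" if q: "q \<in> F1pts" for q
  proof -
    obtain v where v: "v \<in> crd21 q" using q bi.crd_nonempty F1pts_sub by blast
    note v' = F1_bvec[OF q v]
    have e: "emb q = proj_point (segre v)" by (rule emb_crd[OF v'(4) v])
    have "emb q \<in> coord_chart 5 j \<longleftrightarrow> segre v j \<noteq> 0"
      unfolding coord_chart_def principal_open_def e using segre_proj[OF v'(1)] by (auto simp: proj_point_iff)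
    also have "\<dots> \<longleftrightarrow> q \<in> bi.D (\<lambda>v. segre v j)"
    proof -
      have "\<forall>w\<in>crd21 q. segre w j \<noteq> 0" if "segre v j \<noteq> 0"
        using that crd21_scale[of _ v] v'(2) by (auto simp: segre_scale)
      then show ?thesis using v v'(4) unfolding principal_open_def by blast
    qed
    finally show ?thesis .
  qed
  then show ?thesis unfolding preim_def pts_F1 Uopen_def by blast
qed

lemma Hdiv_eq: "Hdiv = div_pullback F1 emb (hyperplane 5 (\<lambda>z. z 0))"
proof -
  have "hyperplane 5 (\<lambda>z. z 0) = (\<lambda>j. (coord_chart 5 j, (coord_chart 5 j, \<lambda>p. let x = (SOME x. x \<in> p) in x 0 / x j))) ` {..5}"
    unfolding hyperplane_def by blast
  then show ?thesis unfolding div_pullback_def Hdiv_def by (simp add: image_image preim_coord_chart Ueq_def)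
qed

lemma pt1: "cpt 1 1 1 1 \<in> Uopen j" if "j \<le> 5"
proof -
  have "cval 1 1 1 1" by (auto simp: cval_def)
  moreover have "segre (cox 1 1 1 1) j \<noteq> 0"
  proof -
    have "j div 2 < 3" "j mod 2 < 2" using that by auto
    then show ?thesis using that unfolding less_3_iff less_2_iff by (auto simp: segre_def)
  qed
  ultimately show ?thesis unfolding Uopen_def using cpt_F1 D_cpt[OF segre_BF[OF that]] by blast
qed

lemma Ueq_regular: "j \<le> 5 \<Longrightarrow> reg F1 (Uopen j) (Ueq j)"
proof -
  assume j: "j \<le> 5"
  have H: "biforms 3 2 1 1 \<in> BF" unfolding BF_def by blast
  have s: "(\<lambda>v. segre v 0) \<in> biforms 3 2 1 1" "(\<lambda>v. segre v j) \<in> biforms 3 2 1 1"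
    using segre_biforms j by auto
  have U: "Uopen j \<subseteq> P21" using F1pts_sub unfolding Uopen_def by blast
  have "segre v j \<noteq> 0 \<and> Ueq j q = segre v 0 / segre v j" if "q \<in> Uopen j" "v \<in> crd21 q" for q v
    using Uopen_mem[OF that] Ueq_eq[OF _ that(2)] that(1) unfolding Uopen_def by blast
  from bi.regular_on_quotient[OF U H s this] show ?thesis unfolding reg_F1[OF openin_Uopen[OF j]] .
qed

lemma Hdiv_unit: "i \<le> 5 \<Longrightarrow> j \<le> 5 \<Longrightarrow> fst r = Uopen i \<Longrightarrow> (\<And>q. q \<in> F1pts \<Longrightarrow> snd r q = Ueq i q) \<Longrightarrow>
  unit_ratio F1 (Uopen i \<inter> Uopen j) r (Uopen j, Ueq j)"
proof (rule unit_quotient[of _ "\<lambda>v. segre v j" 1 1 "\<lambda>v. segre v i"])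
  assume ij: "i \<le> 5" "j \<le> 5" and r: "\<And>q. q \<in> F1pts \<Longrightarrow> snd r q = Ueq i q"
  show "openin (zar F1) (Uopen i \<inter> Uopen j)" using openin_Uopen ij by blast
  show "(\<lambda>v. segre v j) \<in> biforms 3 2 1 1" "(\<lambda>v. segre v i) \<in> biforms 3 2 1 1" using segre_biforms ij by auto
  fix q v assume q: "q \<in> Uopen i \<inter> Uopen j" and v: "v \<in> crd21 q"
  then have nz: "segre v j \<noteq> 0" "segre v i \<noteq> 0" using Uopen_mem[OF _ v] by blast+
  then show "segre v j \<noteq> 0 \<and> segre v i \<noteq> 0" by blast
  have "q \<in> F1pts" using q unfolding Uopen_def by blast
  then show "snd r q = segre v j / segre v i * snd (Uopen j, Ueq j) q"
    using r Ueq_eq[OF _ v] nz by simp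
qed

lemma Hdiv_cartier: "cartier_divisor F1 Hdiv"
  unfolding cartier_divisor_def
proof (intro conjI)
  show "\<forall>(U, r)\<in>Hdiv. openin (zar F1) U \<and> nonzero_rational F1 r"
  proof -
    have "nonzero_rational F1 (Uopen j, Ueq j)" if j: "j \<le> 5" for j
    proof -
      have p: "cpt 1 1 1 1 \<in> Uopen j" "cpt 1 1 1 1 \<in> Uopen 0" using pt1 j by auto
      have "cpt 1 1 1 1 \<in> F1pts" using p unfolding Uopen_def by blast
      from Ueq_eq[OF this bpt_crd, of j] have "Ueq j (cpt 1 1 1 1) \<noteq> 0"
        using Uopen_mem[OF p(1) bpt_crd] Uopen_mem[OF p(2) bpt_crd] by simp
      then show ?thesis unfolding nonzero_rational_def using openin_Uopen[OF j] Ueq_regular[OF j] p(1) by auto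
    qed
    then show ?thesis unfolding Hdiv_def using openin_Uopen by auto
  qed
  show "(\<Union>(U, r)\<in>Hdiv. U) = pts F1"
  proof -
    have "\<exists>j\<le>5. q \<in> Uopen j" if q: "q \<in> F1pts" for q
    proof -
      obtain v where v: "v \<in> crd21 q" using q bi.crd_nonempty F1pts_sub by blast
      note v' = F1_bvec[OF q v]
      obtain k where k: "k < 6" "segre v k \<noteq> 0" using segre_nz[OF v'(1)] by blast
      have k5: "k \<le> 5" using k by auto
      have "q \<in> Uopen k" unfolding Uopen_def using q bi.D_iff[OF segre_BF[OF k5] v'(4) v] k by blast
      then show ?thesis using k5 by blast
    qed
    then show ?thesis unfolding Hdiv_def pts_F1 by (auto simp: Uopen_def)
  qed
  show "\<forall>(U, r)\<in>Hdiv. \<forall>(V, s)\<in>Hdiv. unit_ratio F1 (U \<inter> V) r s"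
    unfolding Hdiv_def using Hdiv_unit by auto
qed

lemma one_rational: "nonzero_rational F1 (F1pts, \<lambda>_. 1)"
proof -
  have "openin (zar F1) F1pts" using openin_topspace[of "zar F1"] pts_F1 by simp
  moreover have "regular_on P21 crd21 BF F1pts (\<lambda>_. 1)"
    by (rule bi.regular_on_quotient[of _ "biforms 3 2 0 0" "\<lambda>_. 1" "\<lambda>_. 1"])
       (use F1pts_sub biforms_const in \<open>auto simp: BF_def\<close>)
  moreover have "F1pts \<noteq> {}" using irr_F1 unfolding irreducible_closed_def by blast
  ultimately show ?thesis unfolding nonzero_rational_def using reg_F1 by auto
qed

lemma Hdiv_ample: "ample F1 Hdiv"
proof -
  have "div_multiple 1 Hdiv = Hdiv" unfolding div_multiple_def rat_power_def by (simp add: case_prod_beta)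
  moreover have "very_ample F1 Hdiv" unfolding very_ample_def
  proof (intro exI[of _ 5] exI[of _ emb] exI[of _ "\<lambda>z. z 0"] conjI emb_closed_immersion)
    show "(\<lambda>z. z 0) \<in> forms (5 + 1) 1" by (rule forms_var) simp
    have U: "cpt 1 1 1 1 \<in> Uopen 0" using pt1 by simp
    then have p: "cpt 1 1 1 1 \<in> F1pts" unfolding Uopen_def by blast
    have "segre (cox 1 1 1 1) 0 \<noteq> 0" by (rule Uopen_mem[OF U bpt_crd])
    then have "\<forall>x\<in>emb (cpt 1 1 1 1). x 0 \<noteq> 0"
      using emb_crd[OF F1_bvec(4)[OF p bpt_crd] bpt_crd] by (auto simp: proj_point_iff)
    then show "\<exists>p\<in>pts F1. \<forall>x\<in>emb p. x 0 \<noteq> 0" using p pts_F1 by blast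
    show "linearly_equivalent F1 Hdiv (div_pullback F1 emb (hyperplane 5 (\<lambda>z. z 0)))"
      unfolding Hdiv_eq[symmetric] linearly_equivalent_def
    proof (intro exI[of _ "(F1pts, \<lambda>_. 1)"] conjI one_rational)
      have "fst (rat_mult (F1pts, \<lambda>_. 1) (Uopen i, Ueq i)) = Uopen i" for i
        by (auto simp: rat_mult_def Uopen_def)
      then show "\<forall>(U, r)\<in>Hdiv. \<forall>(V, s)\<in>Hdiv. unit_ratio F1 (U \<inter> V) (rat_mult (F1pts, \<lambda>_. 1) r) s"
        unfolding Hdiv_def using Hdiv_unit by (auto simp: rat_mult_def)
    qed
  qed
  ultimately show ?thesis unfolding ample_def by (intro exI[of _ 1]) simp
qed

text \<open>
  The endomorphism pulls \<open>x0 y0\<close> back to its square, so the two divisors agree up to units and the constant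
  rational function 1 witnesses linear equivalence.
\<close>

lemma gF1_pullback: "linearly_equivalent F1 (div_pullback F1 gF1 Hdiv) (div_multiple 2 Hdiv)"
  unfolding linearly_equivalent_def
proof (intro exI[of _ "(F1pts, \<lambda>_. 1)"] conjI one_rational)
  have "unit_ratio F1 (preim F1 gF1 (Uopen i) \<inter> Uopen j)
      (rat_mult (F1pts, \<lambda>_. 1) (preim F1 gF1 (Uopen i), Ueq i \<circ> gF1)) (rat_power (Uopen j, Ueq j) 2)"
    if ij: "i \<le> 5" "j \<le> 5" for i j
  proof (rule unit_quotient[of _ "\<lambda>v. segre v j ^ 2" 2 2 "\<lambda>v. segre (gvec v) i"])
    have "openin (zar F1) (preim F1 gF1 (Uopen i))"
      using gF1_morphism openin_Uopen[OF ij(1)] unfolding morphism_def continuous_map_def preim_def by blast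
    then show "openin (zar F1) (preim F1 gF1 (Uopen i) \<inter> Uopen j)" using openin_Uopen[OF ij(2)] by blast
    show "(\<lambda>v. segre v j ^ 2) \<in> biforms 3 2 2 2"
      using biforms_power[OF segre_biforms[of j], of 2] ij by simp
    show "(\<lambda>v. segre (gvec v) i) \<in> biforms 3 2 2 2"
      using gvec_biforms[OF segre_biforms[of i]] ij by (simp add: numeral_2_eq_2)
    fix q v assume q: "q \<in> preim F1 gF1 (Uopen i) \<inter> Uopen j" and v: "v \<in> crd21 q"
    then have qF: "q \<in> F1pts" and gq: "gF1 q \<in> Uopen i" unfolding preim_def pts_F1 by auto
    have nz: "segre (gvec v) i \<noteq> 0" "segre v j \<noteq> 0"
      using Uopen_mem[OF gq gvec_crd[OF qF v]] Uopen_mem[of q j v] q v by auto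
    then show "segre v j ^ 2 \<noteq> 0 \<and> segre (gvec v) i \<noteq> 0" by simp
    have "segre (gvec v) 0 = segre v 0 ^ 2" by (simp add: segre_def gvec_def power_mult_distrib)
    then show "snd (rat_mult (F1pts, \<lambda>_. 1) (preim F1 gF1 (Uopen i), Ueq i \<circ> gF1)) q =
        segre v j ^ 2 / segre (gvec v) i * snd (rat_power (Uopen j, Ueq j) 2) q"
      using nz Ueq_eq[OF gF1_in[OF qF] gvec_crd[OF qF v]] Ueq_eq[OF qF v]
      by (simp add: rat_mult_def rat_power_def power_divide)
  qed
  then show "\<forall>(U, r)\<in>div_pullback F1 gF1 Hdiv. \<forall>(V, s)\<in>div_multiple 2 Hdiv.
      unit_ratio F1 (U \<inter> V) (rat_mult (F1pts, \<lambda>_. 1) r) s"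
    unfolding div_pullback_def div_multiple_def Hdiv_def by auto
qed

lemma gF1_polarized: "polarized_endo F1 gF1"
  unfolding polarized_endo_def pts_F1
  using gF1_morphism gF1_surj Hdiv_cartier Hdiv_ample gF1_pullback
  by (intro conjI exI[of _ Hdiv] exI[of _ 2]) simp_all

section \<open>Forms in two and three variables\<close>

lemma poly_eq_0_off_0:
  fixes p :: "complex poly"
  assumes "\<And>t. t \<noteq> 0 \<Longrightarrow> poly p t = 0" shows "p = 0"
proof -
  have "poly ([:0, 1:] * p) t = 0" for t using assms[of t] by auto
  then have "[:0, 1:] * p = 0" using poly_all_0_iff_0 by blast
  then show ?thesis by simp
qed

text \<open>
  Cancelling \<open>D\<close> gives homogeneity for nonzero scalars, and the scalar 0 follows by continuity, here
  in the form of an identity of polynomials.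
\<close>

lemma form_cofactor:
  assumes D: "D \<in> forms n k" "D z \<noteq> 0" and F: "F \<in> polys n" and DF: "(\<lambda>x. D x * F x) \<in> forms n d" and kd: "k \<le> d"
  shows "F \<in> forms n (d - k)"
proof (rule formsI[OF F])
  have nz: "F (\<lambda>i. c * x i) = c ^ (d - k) * F x" if c: "c \<noteq> 0" for c x
  proof -
    have eq: "D x * (c ^ k * F (\<lambda>i. c * x i)) = D x * (c ^ d * F x)" for x
      using formsD(2)[OF DF, of c x] formsD(2)[OF D(1), of c x] by (simp add: mult_ac)
    have p: "(\<lambda>x. c ^ k * F (\<lambda>i. c * x i)) \<in> polys n" "(\<lambda>x. c ^ d * F x) \<in> polys n"
      by (intro polys_mult polys_const polys_comp[OF F, where \<Phi> = "\<lambda>x i. c * x i"] polys_var F; assumption)+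
    have "c ^ k * F (\<lambda>i. c * x i) = c ^ d * F x"
      by (rule polys_cancel[OF formsD(1)[OF D(1)] p eq D(2)])
    moreover have "c ^ d = c ^ k * c ^ (d - k)" using kd by (simp flip: power_add)
    ultimately show ?thesis using c by simp
  qed
  fix c x
  obtain p where p: "\<And>t. F (\<lambda>i. 0 + t * x i) = poly p t"
    using polys_line[OF F, of "\<lambda>_. 0" x] by blast
  have "p - monom (F x) (d - k) = 0"
  proof (rule poly_eq_0_off_0)
    fix t :: complex assume "t \<noteq> 0"
    then show "poly (p - monom (F x) (d - k)) t = 0" using nz[of t x] by (simp add: poly_monom mult.commute flip: p)
  qed
  then have "p = monom (F x) (d - k)" by simp
  then show "F (\<lambda>i. c * x i) = c ^ (d - k) * F x" using p[of c] by (simp add: poly_monom mult.commute)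
qed

lemma form_deg_0: "F \<in> forms n 0 \<Longrightarrow> F x = F y"
  using formsD(2)[of F n 0 0 x] formsD(2)[of F n 0 0 y] by simp

text \<open>
  The origin represents no point of projective space, so identities obtained from points miss it; the
  factor \<open>y 0\<close> in the proof excludes it without losing density.
\<close>

lemma polys_cancel_cspace:
  assumes n: "n \<ge> 1" and F: "F \<in> polys n" "F x0 \<noteq> 0" and GG: "G \<in> polys n" "G' \<in> polys n"
    and eq: "\<And>y. y \<in> cspace n \<Longrightarrow> y \<noteq> (\<lambda>_. 0) \<Longrightarrow> F y \<noteq> 0 \<Longrightarrow> G y = G' y"
  shows "G x = G' x"
proof -
  have v: "(\<lambda>x. x 0) \<in> polys n" using n by (intro polys_var) simp
  have p: "(\<lambda>x. x 0 * F x) \<in> polys n" by (intro polys_mult v F)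
  have "\<exists>x1. x1 0 * F x1 \<noteq> 0"
  proof (rule ccontr)
    assume "\<not> ?thesis"
    then have "x 0 * F x = 0" for x by blast
    from polys_integral[OF v F(1) this] F(2) have "\<forall>x::cvec. x 0 = 0" by blast
    moreover have "vec2 1 0 0 \<noteq> 0" by simp
    ultimately show False by blast
  qed
  then obtain x1 where x1: "x1 0 * F x1 \<noteq> 0" by blast
  have "y 0 * F y * G y = y 0 * F y * G' y" for y
  proof (cases "y 0 = 0 \<or> F y = 0")
    case False
    let ?y = "\<lambda>i. if i < n then y i else 0"
    have tr: "P ?y = P y" if "P \<in> polys n" for P by (rule polys_cong[OF that]) simp
    have "?y 0 \<noteq> 0" using n False by simp
    then have "?y \<noteq> (\<lambda>_. 0)" by metis
    moreover have "?y \<in> cspace n" by (simp add: cspace_def)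
    ultimately have "G ?y = G' ?y" using eq False tr[OF F(1)] by simp
    then show ?thesis using tr[OF GG(1)] tr[OF GG(2)] by simp
  qed auto
  from polys_cancel[OF p GG this x1] show ?thesis .
qed

lemmas polys2_cancel = polys_cancel_cspace[of 2, simplified]
lemmas polys3_cancel = polys_cancel_cspace[of 3, simplified]

lemma bvec_y_nz: "bvec v \<Longrightarrow> snd v 0 \<noteq> 0 \<or> snd v 1 \<noteq> 0"
  unfolding bvec_def using cspace2_eq[of "snd v"] vec2_zero by (metis One_nat_def)

lemma to_plane: "morphism F1 (proj_space 2) \<phi> \<Longrightarrow> q \<in> F1pts \<Longrightarrow> \<phi> q \<in> proj_points 2"
  using morphism_maps[of F1 "proj_space 2"] pj.zsub_pts[OF zsub_proj, of 2] pts_F1 by simp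

lemma from_plane: "morphism (proj_space 2) F1 \<psi> \<Longrightarrow> p \<in> proj_points 2 \<Longrightarrow> \<psi> p \<in> F1pts"
  using morphism_maps[of "proj_space 2" F1] pj.zsub_pts[OF zsub_proj, of 2] pts_F1 by simp

text \<open>
  The linear form that vanishes at \<open>\<beta>\<close>.
\<close>

definition lin2 :: "cvec \<Rightarrow> cvec \<Rightarrow> complex" where
  "lin2 \<beta> x = \<beta> 1 * x 0 - \<beta> 0 * x 1"

lemma lin2_form: "lin2 \<beta> \<in> forms 2 1"
  unfolding lin2_def[abs_def] by (rule formsI) (auto intro!: polys_intros simp: algebra_simps)

text \<open>
  Polynomials respect congruence modulo \<open>lin2 \<beta>\<close>.
\<close>

lemma polys_shift_dvd:
  assumes "F \<in> polys 2"
  shows "\<exists>Q\<in>polys 2. \<forall>x. F x - F (\<lambda>i. x i - lin2 \<beta> x * w i) = lin2 \<beta> x * Q x"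
  using assms unfolding polys_def
proof (induction rule: gen_algebra.induct)
  case (const c) show ?case unfolding polys_def[symmetric] by (rule bexI[of _ "\<lambda>_. 0"]) auto
next
  case (gen b)
  then obtain i where "b = (\<lambda>x. x i)" by auto
  then show ?case unfolding polys_def[symmetric] by (intro bexI[of _ "\<lambda>_. w i"]) auto
next
  case (add F G)
  from add.IH obtain Q R where QR: "Q \<in> polys 2" "R \<in> polys 2"
    "\<forall>x. F x - F (\<lambda>i. x i - lin2 \<beta> x * w i) = lin2 \<beta> x * Q x"
    "\<forall>x. G x - G (\<lambda>i. x i - lin2 \<beta> x * w i) = lin2 \<beta> x * R x"
    unfolding polys_def[symmetric] by (elim bexE) (rule that)
  show ?case unfolding polys_def[symmetric]
  proof (intro bexI[of _ "\<lambda>x. Q x + R x"] allI polys_add QR)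
    fix x
    show "F x + G x - (F (\<lambda>i. x i - lin2 \<beta> x * w i) + G (\<lambda>i. x i - lin2 \<beta> x * w i)) = lin2 \<beta> x * (Q x + R x)"
      using QR(3)[THEN spec[of _ x]] QR(4)[THEN spec[of _ x]] by (simp only: add_diff_add distrib_left)
  qed
next
  case (mult F G)
  from mult.IH obtain Q R where QR: "Q \<in> polys 2" "R \<in> polys 2"
    "\<forall>x. F x - F (\<lambda>i. x i - lin2 \<beta> x * w i) = lin2 \<beta> x * Q x"
    "\<forall>x. G x - G (\<lambda>i. x i - lin2 \<beta> x * w i) = lin2 \<beta> x * R x"
    unfolding polys_def[symmetric] by (elim bexE) (rule that)
  have p: "F \<in> polys 2" "G \<in> polys 2" using mult unfolding polys_def by auto
  have sh: "(\<lambda>x. G (\<lambda>i. x i - lin2 \<beta> x * w i)) \<in> polys 2"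
    by (rule polys_comp[OF p(2)]) (intro polys_diff polys_mult polys_var polys_const formsD(1)[OF lin2_form])
  show ?case unfolding polys_def[symmetric]
  proof (intro bexI[of _ "\<lambda>x. F x * R x + Q x * G (\<lambda>i. x i - lin2 \<beta> x * w i)"] allI polys_add polys_mult QR p sh)
    fix x
    have 1: "F x = F (\<lambda>i. x i - lin2 \<beta> x * w i) + lin2 \<beta> x * Q x"
      "G x = G (\<lambda>i. x i - lin2 \<beta> x * w i) + lin2 \<beta> x * R x"
      using QR(3)[THEN spec[of _ x]] QR(4)[THEN spec[of _ x]] by (simp_all add: algebra_simps)
    show "F x * G x - F (\<lambda>i. x i - lin2 \<beta> x * w i) * G (\<lambda>i. x i - lin2 \<beta> x * w i) =
        lin2 \<beta> x * (F x * R x + Q x * G (\<lambda>i. x i - lin2 \<beta> x * w i))"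
      unfolding 1 by (simp add: algebra_simps)
  qed
qed

text \<open>
  Every vector is congruent modulo \<open>lin2 \<beta>\<close> to a multiple of \<open>\<beta>\<close>, where the form vanishes.
\<close>

lemma binary_form_root:
  assumes F: "F \<in> forms 2 n" "n \<ge> 1" and \<beta>: "\<beta> \<in> cspace 2" "\<beta> \<noteq> (\<lambda>_. 0)" "F \<beta> = 0"
  shows "\<exists>Q\<in>forms 2 (n - 1). \<forall>x. F x = lin2 \<beta> x * Q x"
proof -
  have b: "\<beta> 0 \<noteq> 0 \<or> \<beta> 1 \<noteq> 0" using \<beta>(2) cspace2_eq[OF \<beta>(1)] vec2_zero by (metis One_nat_def)
  define w where "w = (if \<beta> 1 \<noteq> 0 then vec2 (1 / \<beta> 1) 0 else vec2 0 (- 1 / \<beta> 0))"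
  define u where "u = (if \<beta> 1 \<noteq> 0 then vec2 0 (1 / \<beta> 1) else vec2 (1 / \<beta> 0) 0)"
  obtain Q where Q: "Q \<in> polys 2" "\<forall>x. F x - F (\<lambda>i. x i - lin2 \<beta> x * w i) = lin2 \<beta> x * Q x"
    using polys_shift_dvd[OF formsD(1)[OF F(1)], of \<beta> w] by (elim bexE) (rule that)
  have "F (\<lambda>i. x i - lin2 \<beta> x * w i) = 0" for x
  proof -
    have "F (\<lambda>i. x i - lin2 \<beta> x * w i) = F (\<lambda>i. (x 0 * u 0 + x 1 * u 1) * \<beta> i)"
      by (rule polys_cong[OF formsD(1)[OF F(1)]])
         (use b in \<open>auto simp: less_2_iff w_def u_def lin2_def field_simps\<close>)
    then show ?thesis using formsD(2)[OF F(1)] \<beta>(3) by simp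
  qed
  then have eq: "F x = lin2 \<beta> x * Q x" for x using Q(2) by simp
  have "(\<lambda>x. lin2 \<beta> x * Q x) \<in> forms 2 n" using F(1) eq by (simp flip: eq)
  moreover have "lin2 \<beta> (vec2 (cnj (\<beta> 1)) (- cnj (\<beta> 0))) \<noteq> 0"
  proof -
    have "lin2 \<beta> (vec2 (cnj (\<beta> 1)) (- cnj (\<beta> 0))) = of_real (cmod (\<beta> 1) ^ 2 + cmod (\<beta> 0) ^ 2)"
      by (simp only: of_real_add complex_norm_square) (simp add: lin2_def)
    moreover have "cmod (\<beta> 1) ^ 2 + cmod (\<beta> 0) ^ 2 \<noteq> 0" using b by (auto simp: sum_power2_eq_zero_iff)
    ultimately show ?thesis by (metis of_real_eq_0_iff)
  qed
  ultimately have "Q \<in> forms 2 (n - 1)" using form_cofactor[OF lin2_form _ Q(1)] F(2) by blast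
  then show ?thesis using eq by blast
qed

text \<open>
  Without zeros, \<open>F (t, 1)\<close> is a constant \<open>c\<close> by the fundamental theorem of algebra. Then \<open>F (1, t) = c t^n\<close>
  vanishes at 0.
\<close>

lemma binary_form_zero:
  assumes F: "F \<in> forms 2 n" "n \<ge> 1"
  shows "\<exists>z\<in>cspace 2. z \<noteq> (\<lambda>_. 0) \<and> F z = 0"
proof (rule ccontr)
  assume no: "\<not> ?thesis"
  have nz: "F (vec2 a b) \<noteq> 0" if "a \<noteq> 0 \<or> b \<noteq> 0" for a b
    using no that vec2_zero[of a b] vec2_cspace[of a b] by blast
  have P: "F \<in> polys 2" using formsD(1)[OF F(1)] .
  obtain p where p: "\<And>t. F (\<lambda>i. vec2 0 1 i + t * vec2 1 0 i) = poly p t" using polys_line[OF P] by blast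
  obtain r where r: "\<And>t. F (\<lambda>i. vec2 1 0 i + t * vec2 0 1 i) = poly r t" using polys_line[OF P] by blast
  have "(\<lambda>i. vec2 0 1 i + t * vec2 1 0 i) = vec2 t 1" "(\<lambda>i. vec2 1 0 i + t * vec2 0 1 i) = vec2 1 t" for t
    by (auto simp: vec2_def fun_eq_iff)
  then have p': "F (vec2 t 1) = poly p t" and r': "F (vec2 1 t) = poly r t" for t using p r by auto
  have "poly p t \<noteq> 0" for t using nz by (simp flip: p')
  then have "constant (poly p)" using fundamental_theorem_of_algebra by blast
  then have const: "poly p t = poly p 0" for t unfolding constant_def by blast
  have "r - monom (poly p 0) n = 0"
  proof (rule poly_eq_0_off_0)
    fix t :: complex assume t: "t \<noteq> 0"
    have "F (\<lambda>i. t * vec2 (1 / t) 1 i) = t ^ n * F (vec2 (1 / t) 1)" by (rule formsD(2)[OF F(1)])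
    then have "poly r t = t ^ n * poly p (1 / t)" using t by (simp add: vec2_scale p' r')
    then show "poly (r - monom (poly p 0) n) t = 0" using const[of "1 / t"] by (simp add: poly_monom)
  qed
  then have "r = monom (poly p 0) n" by simp
  then have "F (vec2 1 0) = 0" using r'[of 0] F(2) by (simp add: poly_monom)
  then show False using nz[of 1 0] by simp
qed

text \<open>
  Expansion to first order at the origin, along each line through it.
\<close>

lemma polys_taylor:
  assumes "F \<in> polys n"
  shows "\<exists>a l. \<forall>x. \<exists>r::complex poly. \<forall>c. F (\<lambda>i. c * x i) = a + c * (\<Sum>i<n. l i * x i) + c ^ 2 * poly r c"
  using assms unfolding polys_def
proof (induction rule: gen_algebra.induct)
  case (const k)
  show ?case by (rule exI[of _ k], rule exI[of _ "\<lambda>_. 0"], rule allI, rule exI[of _ 0]) simp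
next
  case (gen b)
  then obtain j where j: "j < n" "b = (\<lambda>x. x j)" by auto
  have "(\<Sum>i<n. (if i = j then 1 else 0) * x i) = x j" for x :: cvec
    using j(1) by (simp add: if_distrib[of "\<lambda>a. a * _"] cong: if_cong)
  then show ?case
    by (intro exI[of _ 0] exI[of _ "\<lambda>i. if i = j then 1 else 0"] allI exI[of _ "0::complex poly"]) (simp add: j(2))
next
  case (add F G)
  then obtain a l a' l' where IH: "\<forall>x. \<exists>r::complex poly. \<forall>c. F (\<lambda>i. c * x i) = a + c * (\<Sum>i<n. l i * x i) + c ^ 2 * poly r c"
    "\<forall>x. \<exists>r::complex poly. \<forall>c. G (\<lambda>i. c * x i) = a' + c * (\<Sum>i<n. l' i * x i) + c ^ 2 * poly r c" by (elim exE) (rule that)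
  show ?case
  proof (rule exI[of _ "a + a'"], rule exI[of _ "\<lambda>i. l i + l' i"], rule allI)
    fix x
    obtain r r' :: "complex poly" where "\<forall>c. F (\<lambda>i. c * x i) = a + c * (\<Sum>i<n. l i * x i) + c ^ 2 * poly r c"
      "\<forall>c. G (\<lambda>i. c * x i) = a' + c * (\<Sum>i<n. l' i * x i) + c ^ 2 * poly r' c"
      using IH[THEN spec[of _ x]] by (elim exE) (rule that)
    then show "\<exists>r::complex poly. \<forall>c. F (\<lambda>i. c * x i) + G (\<lambda>i. c * x i) =
        a + a' + c * (\<Sum>i<n. (l i + l' i) * x i) + c ^ 2 * poly r c"
      by (intro exI[of _ "r + r'"]) (simp add: algebra_simps sum.distrib)
  qed
next
  case (mult F G)
  then obtain a l a' l' where IH: "\<forall>x. \<exists>r::complex poly. \<forall>c. F (\<lambda>i. c * x i) = a + c * (\<Sum>i<n. l i * x i) + c ^ 2 * poly r c"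
    "\<forall>x. \<exists>r::complex poly. \<forall>c. G (\<lambda>i. c * x i) = a' + c * (\<Sum>i<n. l' i * x i) + c ^ 2 * poly r c" by (elim exE) (rule that)
  show ?case
  proof (rule exI[of _ "a * a'"], rule exI[of _ "\<lambda>i. a * l' i + a' * l i"], rule allI)
    fix x
    obtain r r' :: "complex poly" where r: "\<forall>c. F (\<lambda>i. c * x i) = a + c * (\<Sum>i<n. l i * x i) + c ^ 2 * poly r c"
      "\<forall>c. G (\<lambda>i. c * x i) = a' + c * (\<Sum>i<n. l' i * x i) + c ^ 2 * poly r' c"
      using IH[THEN spec[of _ x]] by (elim exE) (rule that)
    let ?L = "\<Sum>i<n. l i * x i" and ?L' = "\<Sum>i<n. l' i * x i"
    have s: "(\<Sum>i<n. (a * l' i + a' * l i) * x i) = a * ?L' + a' * ?L"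
      by (simp add: algebra_simps sum.distrib sum_distrib_left)
    show "\<exists>r::complex poly. \<forall>c. F (\<lambda>i. c * x i) * G (\<lambda>i. c * x i) =
        a * a' + c * (\<Sum>i<n. (a * l' i + a' * l i) * x i) + c ^ 2 * poly r c"
      unfolding s
      by (rule exI[of _ "smult a r' + smult a' r + [:?L * ?L':] + [:0, ?L:] * r' + [:0, ?L':] * r + [:0, 0, 1:] * r * r'"])
         (simp add: r algebra_simps power2_eq_square)
  qed
qed

lemma linear_form:
  assumes F: "F \<in> forms n 1"
  shows "\<exists>l. \<forall>x. F x = (\<Sum>i<n. l i * x i)"
proof -
  obtain a l where al: "\<forall>x. \<exists>r::complex poly. \<forall>c. F (\<lambda>i. c * x i) = a + c * (\<Sum>i<n. l i * x i) + c ^ 2 * poly r c"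
    using polys_taylor[OF formsD(1)[OF F]] by (elim exE) (rule that)
  have "F x = (\<Sum>i<n. l i * x i)" for x
  proof -
    obtain r :: "complex poly" where r: "\<forall>c. F (\<lambda>i. c * x i) = a + c * (\<Sum>i<n. l i * x i) + c ^ 2 * poly r c"
      using al[THEN spec[of _ x]] by (elim exE) (rule that)
    have r': "c * F x = a + c * (\<Sum>i<n. l i * x i) + c ^ 2 * poly r c" for c
      using r[THEN spec[of _ c]] formsD(2)[OF F, of c x] by simp
    have a: "a = 0" using r'[of 0] by simp
    have "[:F x - (\<Sum>i<n. l i * x i):] - [:0, 1:] * r = 0"
    proof (rule poly_eq_0_off_0)
      fix t :: complex assume t: "t \<noteq> 0"
      have "t * (F x - (\<Sum>i<n. l i * x i) - t * poly r t) = 0"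
        using r'[of t] a by (simp only: power2_eq_square right_diff_distrib mult.assoc) simp
      then show "poly ([:F x - (\<Sum>i<n. l i * x i):] - [:0, 1:] * r) t = 0" using t by simp
    qed
    then have "poly ([:F x - (\<Sum>i<n. l i * x i):] - [:0, 1:] * r) 0 = 0" by simp
    then show ?thesis by simp
  qed
  then show ?thesis by blast
qed

text \<open>
  The cross product of the coefficient vectors is a common zero; if it vanishes, the forms are
  proportional and a zero of one of them will do.
\<close>

lemma linear_forms_common_zero:
  assumes "F \<in> forms 3 1" "G \<in> forms 3 1"
  shows "\<exists>x\<in>cspace 3. x \<noteq> (\<lambda>_. 0) \<and> F x = 0 \<and> G x = 0"
proof -
  obtain f g where f: "\<And>x. F x = (\<Sum>i<3. f i * x i)" and g: "\<And>x. G x = (\<Sum>i<3. g i * x i)"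
    using linear_form[OF assms(1)] linear_form[OF assms(2)] by blast
  have s3: "(\<Sum>i<3. h i) = h 0 + h 1 + h 2" for h :: "nat \<Rightarrow> complex" by (simp add: eval_nat_numeral)
  have F: "F (vec3 a b c) = f 0 * a + f 1 * b + f 2 * c" for a b c unfolding f s3 by simp
  have G: "G (vec3 a b c) = g 0 * a + g 1 * b + g 2 * c" for a b c unfolding g s3 by simp
  let ?P = "\<lambda>a b c. (a \<noteq> 0 \<or> b \<noteq> 0 \<or> c \<noteq> 0) \<and> F (vec3 a b c) = 0 \<and> G (vec3 a b c) = 0"
  have "\<exists>a b c. ?P a b c"
  proof (rule ccontr)
    assume no: "\<not> ?thesis"
    have c: "f 1 * g 2 = f 2 * g 1" "f 2 * g 0 = f 0 * g 2" "f 0 * g 1 = f 1 * g 0"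
      using no[unfolded not_ex, THEN spec, THEN spec, THEN spec, of "f 1 * g 2 - f 2 * g 1" "f 2 * g 0 - f 0 * g 2" "f 0 * g 1 - f 1 * g 0"]
      by (auto simp: F G algebra_simps)
    have P: "\<not> ?P (f 1) (- f 0) 0" "\<not> ?P (f 2) 0 (- f 0)" "\<not> ?P (g 1) (- g 0) 0" "\<not> ?P (g 2) 0 (- g 0)"
      "\<not> ?P 1 0 0" using no by blast+
    have "f 0 = 0" using P(1) c by (auto simp: F G mult.commute)
    moreover have "f 1 = 0" using P(1) c by (auto simp: F G mult.commute)
    moreover have "f 2 = 0" using P(2) c by (auto simp: F G mult.commute)
    moreover have "g 0 = 0" using P(3) c by (auto simp: F G mult.commute)
    ultimately show False using P(5) by (auto simp: F G)
  qed
  then obtain a b c where "?P a b c" by blast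
  then show ?thesis by (intro bexI[of _ "vec3 a b c"]) (auto simp: vec3_zero)
qed

section \<open>The ruling seen from the projective plane\<close>

lemma BF_y: "(\<lambda>v. snd v 0) \<in> biforms 3 2 0 1" "(\<lambda>v. snd v 1) \<in> biforms 3 2 0 1"
  by (rule biforms_y; simp)+

lemma ruling_regular:
  assumes "j < 2" "k < 2"
  defines "f \<equiv> \<lambda>q. let v = SOME v. v \<in> crd21 q in snd v k / snd v j"
  defines "U \<equiv> F1pts \<inter> bi.D (\<lambda>v. snd v j)"
  shows "openin (zar F1) U" "reg F1 U f" "\<And>q v. q \<in> U \<Longrightarrow> v \<in> crd21 q \<Longrightarrow> snd v j \<noteq> 0 \<and> f q = snd v k / snd v j"
proof -
  have H: "biforms 3 2 0 1 \<in> BF" unfolding BF_def by blast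
  have b: "(\<lambda>v. snd v k) \<in> biforms 3 2 0 1" "(\<lambda>v. snd v j) \<in> biforms 3 2 0 1" by (rule biforms_y; fact)+
  show U: "openin (zar F1) U" unfolding bi.openin_zsub[OF zsub_F1] U_def
    by (intro conjI ballI bexI[OF _ BF_I[OF b(2)]]) auto
  have UP: "U \<subseteq> P21" using F1pts_sub unfolding U_def by blast
  show f: "snd v j \<noteq> 0 \<and> f q = snd v k / snd v j" if "q \<in> U" "v \<in> crd21 q" for q v
  proof -
    let ?v = "SOME v. v \<in> crd21 q"
    have v: "?v \<in> crd21 q" using that(2) by (rule someI)
    have nz: "snd v j \<noteq> 0" "snd ?v j \<noteq> 0" using that v unfolding U_def principal_open_def by blast+
    have "q \<in> P21" using that(1) UP by blast
    from bi.ratio_indep[OF H b this v that(2)] show ?thesis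
      using nz by (simp add: f_def Let_def field_simps)
  qed
  show "reg F1 U f" unfolding reg_F1[OF U]
    by (rule bi.regular_on_quotient[OF UP H b]) (use f in blast)
qed

text \<open>
  At the point \<open>x\<close> of the plane, \<open>[G:F]\<close> is defined and is the image of \<open>\<psi> x\<close> under the ruling
  \<open>y\<close> of the surface.
\<close>

definition ruling_at :: "(ppoint \<Rightarrow> ppoint \<times> ppoint) \<Rightarrow> (cvec \<Rightarrow> complex) \<Rightarrow> (cvec \<Rightarrow> complex) \<Rightarrow> cvec \<Rightarrow> bool" where
  "ruling_at \<psi> F G x \<longleftrightarrow> (F x \<noteq> 0 \<or> G x \<noteq> 0) \<and> (\<forall>v\<in>crd21 (\<psi> (proj_point x)). snd v 1 * G x = snd v 0 * F x)"

text \<open>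
  Around each point one of \<open>y1 / y0\<close> and \<open>y0 / y1\<close> is regular and pulls back to a quotient of forms.
\<close>

lemma ruling_local:
  assumes \<psi>: "morphism (proj_space 2) F1 \<psi>" and x: "x \<in> cspace 3" "x \<noteq> (\<lambda>_. 0)"
  shows "\<exists>d F G K. F \<in> forms 3 d \<and> G \<in> forms 3 d \<and> K \<in> polys 3 \<and> K x \<noteq> 0 \<and>
    (\<forall>z\<in>cspace 3. z \<noteq> (\<lambda>_. 0) \<longrightarrow> K z \<noteq> 0 \<longrightarrow> ruling_at \<psi> F G z)"
proof -
  have pp: "proj_point z \<in> proj_points 2" if "z \<in> cspace 3" "z \<noteq> (\<lambda>_. 0)" for z
    using proj_point_in[of z 2] that by simp
  let ?p = "proj_point x"
  have gen: "\<exists>d F G K. F \<in> forms 3 d \<and> G \<in> forms 3 d \<and> K \<in> polys 3 \<and> K x \<noteq> 0 \<and>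
      (\<forall>z\<in>cspace 3. z \<noteq> (\<lambda>_. 0) \<longrightarrow> K z \<noteq> 0 \<longrightarrow> G z \<noteq> 0 \<and> (\<forall>v\<in>crd21 (\<psi> (proj_point z)). snd v k * G z = snd v j * F z))"
    if jk: "j < 2" "k < 2" and pU: "\<psi> ?p \<in> bi.D (\<lambda>v. snd v j)" for j k
  proof -
    define f where "f = (\<lambda>q. let v = SOME v. v \<in> crd21 q in snd v k / snd v j)"
    define U where "U = F1pts \<inter> bi.D (\<lambda>v. snd v j)"
    note r = ruling_regular[OF jk, folded f_def, folded U_def]
    let ?V = "preim (proj_space 2) \<psi> U"
    have V: "openin (zar (proj_space 2)) ?V" by (rule morphism_open[OF \<psi> r(1)])
    have pV: "?p \<in> ?V" unfolding preim_def pj.zsub_pts[OF zsub_proj] U_def using pp[OF x] pU from_plane[OF \<psi>] by blast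
    have "reg (proj_space 2) ?V (f \<circ> \<psi>)" by (rule morphism_reg[OF \<psi> r(1,2)])
    then have "regular_on (proj_points 2) (\<lambda>p. p) (range (forms (2 + 1))) ?V (f \<circ> \<psi>)"
      using zsub_proj[of 2] V unfolding zsub_def by blast
    then obtain H F G K where h: "H \<in> range (forms (2 + 1))" "F \<in> H" "G \<in> H" "K \<in> \<Union>(range (forms (2 + 1)))" "?p \<in> pj.D 2 K"
      "\<forall>q\<in>?V \<inter> pj.D 2 K. \<forall>v\<in>q. G v \<noteq> 0 \<and> (f \<circ> \<psi>) q = F v / G v"
      using pV unfolding regular_on_def by metis
    obtain L where L: "L \<in> \<Union>(range (forms (2 + 1)))" "?p \<in> pj.D 2 L" "pj.D 2 L \<inter> proj_points 2 \<subseteq> ?V"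
      using V pV unfolding pj.openin_zsub[OF zsub_proj] by meson
    have t: "2 + 1 = (3::nat)" by simp
    obtain d where d: "F \<in> forms 3 d" "G \<in> forms 3 d" using h(1-3) unfolding t by auto
    have K: "K \<in> polys 3" "L \<in> polys 3" using h(4) L(1) formsD(1) unfolding t by blast+
    have loc: "G z \<noteq> 0 \<and> (\<forall>v\<in>crd21 (\<psi> (proj_point z)). snd v k * G z = snd v j * F z)"
      if z: "z \<in> cspace 3" "z \<noteq> (\<lambda>_. 0)" "K z * L z \<noteq> 0" for z
    proof -
      note zp = pp[OF z(1,2)]
      have "proj_point z \<in> pj.D 2 K" "proj_point z \<in> pj.D 2 L"
        using pj.D_iff[OF h(4) zp proj_point_self] pj.D_iff[OF L(1) zp proj_point_self] z(3) by auto
      then have qV: "proj_point z \<in> ?V \<inter> pj.D 2 K" using L(3) zp by blast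
      have fq: "G z \<noteq> 0" "f (\<psi> (proj_point z)) = F z / G z"
        using h(6)[THEN bspec, OF qV, THEN bspec, OF proj_point_self] by auto
      have "\<psi> (proj_point z) \<in> U" using qV unfolding preim_def by blast
      then have "snd v j \<noteq> 0" "f (\<psi> (proj_point z)) = snd v k / snd v j" if "v \<in> crd21 (\<psi> (proj_point z))" for v
        using r(3)[OF _ that] by (simp_all add: f_def)
      then show ?thesis using fq by (auto simp: field_simps)
    qed
    have nz: "K x * L x \<noteq> 0" using h(5) L(2) unfolding principal_open_def by simp
    show ?thesis
      by (rule exI[of _ d], rule exI[of _ F], rule exI[of _ G], rule exI[of _ "\<lambda>z. K z * L z"])
         (intro conjI[OF d(1)] conjI[OF d(2)] conjI[OF polys_mult[OF K]] conjI[OF nz] ballI impI loc)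
  qed
  have p1: "\<psi> ?p \<in> P21" using from_plane[OF \<psi> pp[OF x]] F1pts_sub by blast
  then obtain v where v: "v \<in> crd21 (\<psi> ?p)" using bi.crd_nonempty by blast
  have lt: "0 < (2::nat)" "1 < (2::nat)" by auto
  have "snd v 0 \<noteq> 0 \<or> snd v 1 \<noteq> 0" using bvec_y_nz[OF crd21_bpt(1)[OF p1 v]] .
  then consider "\<psi> ?p \<in> bi.D (\<lambda>v. snd v 0)" | "\<psi> ?p \<in> bi.D (\<lambda>v. snd v 1)"
    using bi.D_iff[OF BF_I[OF BF_y(1)] p1 v] bi.D_iff[OF BF_I[OF BF_y(2)] p1 v] by blast
  then show ?thesis
  proof cases
    case 1
    obtain d F G K where r: "F \<in> forms 3 d" "G \<in> forms 3 d" "K \<in> polys 3" "K x \<noteq> 0"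
      "\<forall>z\<in>cspace 3. z \<noteq> (\<lambda>_. 0) \<longrightarrow> K z \<noteq> 0 \<longrightarrow> G z \<noteq> 0 \<and> (\<forall>v\<in>crd21 (\<psi> (proj_point z)). snd v 1 * G z = snd v 0 * F z)"
      using gen[OF lt(1,2) 1] by (elim exE conjE) (rule that)
    show ?thesis unfolding ruling_at_def
      by (rule exI[of _ d], rule exI[of _ F], rule exI[of _ G], rule exI[of _ K]) (use r in simp)
  next
    case 2
    obtain d F G K where r: "F \<in> forms 3 d" "G \<in> forms 3 d" "K \<in> polys 3" "K x \<noteq> 0"
      "\<forall>z\<in>cspace 3. z \<noteq> (\<lambda>_. 0) \<longrightarrow> K z \<noteq> 0 \<longrightarrow> G z \<noteq> 0 \<and> (\<forall>v\<in>crd21 (\<psi> (proj_point z)). snd v 0 * G z = snd v 1 * F z)"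
      using gen[OF lt(2,1) 2] by (elim exE conjE) (rule that)
    show ?thesis unfolding ruling_at_def
      by (rule exI[of _ d], rule exI[of _ G], rule exI[of _ F], rule exI[of _ K]) (use r in simp)
  qed
qed

text \<open>
  The local representations define the same rational function, so each of them is a multiple of the one
  in lowest terms, which therefore has no common zero anywhere.
\<close>

lemma ruling_global:
  assumes \<psi>: "morphism (proj_space 2) F1 \<psi>"
  shows "\<exists>d F G. F \<in> forms 3 d \<and> G \<in> forms 3 d \<and> (\<forall>x\<in>cspace 3. x \<noteq> (\<lambda>_. 0) \<longrightarrow> ruling_at \<psi> F G x)"
proof -
  define e1 where "e1 = vec3 1 0 0"
  have e1: "e1 \<in> cspace 3" "e1 \<noteq> (\<lambda>_. 0)" by (auto simp: e1_def vec3_zero)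
  obtain d0 F0 G0 K0 where l0: "F0 \<in> forms 3 d0" "G0 \<in> forms 3 d0" "K0 \<in> polys 3" "K0 e1 \<noteq> 0"
    "\<forall>z\<in>cspace 3. z \<noteq> (\<lambda>_. 0) \<longrightarrow> K0 z \<noteq> 0 \<longrightarrow> ruling_at \<psi> F0 G0 z"
    using ruling_local[OF \<psi> e1] by (elim exE conjE) (rule that)
  have crd: "\<exists>v. v \<in> crd21 (\<psi> (proj_point x)) \<and> (snd v 0 \<noteq> 0 \<or> snd v 1 \<noteq> 0)" if "x \<in> cspace 3" "x \<noteq> (\<lambda>_. 0)" for x
  proof -
    have "proj_point x \<in> proj_points 2" using proj_point_in[of x 2] that by simp
    then have q: "\<psi> (proj_point x) \<in> P21" using from_plane[OF \<psi>] F1pts_sub by blast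
    then obtain v where v: "v \<in> crd21 (\<psi> (proj_point x))" using bi.crd_nonempty by blast
    then show ?thesis using bvec_y_nz[OF crd21_bpt(1)[OF q v]] by blast
  qed
  have P0: "F0 \<in> polys 3" "G0 \<in> polys 3" using formsD(1) l0(1,2) by auto
  have nz0: "F0 e1 \<noteq> 0 \<or> G0 e1 \<noteq> 0" using l0(4,5) e1 unfolding ruling_at_def by blast
  then have ex: "\<exists>x. F0 x \<noteq> 0 \<or> G0 x \<noteq> 0" by blast
  obtain D F G where c: "D \<in> polys 3" "lowest_terms F G" "\<forall>x. F0 x = D x * F x" "\<forall>x. G0 x = D x * G x"
    using polys3_cofactors[OF P0 ex] by (elim bexE exE conjE) (rule that)
  have FG: "F \<in> polys 3" "G \<in> polys 3" using c(2) unfolding lowest_terms_def by auto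
  have DF: "(\<lambda>x. D x * F x) \<in> forms 3 d0" using l0(1) c(3) by (simp flip: c(3))
  have DG: "(\<lambda>x. D x * G x) \<in> forms 3 d0" using l0(2) c(4) by (simp flip: c(4))
  have De: "D e1 \<noteq> 0" using nz0 c(3,4) by auto
  have "\<exists>k\<le>d0. D \<in> forms 3 k"
  proof -
    have *: "\<exists>k\<le>d0. D \<in> forms 3 k" if A: "A \<in> polys 3" "(\<lambda>x. D x * A x) \<in> forms 3 d0" "D e1 * A e1 \<noteq> 0" for A
    proof -
      obtain k where k: "D \<in> forms 3 k" using form_factor[OF c(1) A] by blast
      have "(\<lambda>x. A x * D x) \<in> forms 3 d0" using A(2) by (simp add: mult.commute)
      then obtain m where m: "A \<in> forms 3 m" using form_factor[OF A(1) c(1), of d0 e1] A(3) by (auto simp: mult.commute)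
      have "2 ^ d0 * (D e1 * A e1) = (2 ^ (k + m)) * (D e1 * A e1)"
        using formsD(2)[OF A(2), of 2 e1] formsD(2)[OF k, of 2 e1] formsD(2)[OF m, of 2 e1] by (auto simp: power_add mult_ac)
      then have "(2::complex) ^ d0 = 2 ^ (k + m)" using A(3) by simp
      then have "cmod (2 ^ d0) = cmod (2 ^ (k + m))" by simp
      then have "(2::real) ^ d0 = 2 ^ (k + m)" by (simp only: norm_power norm_numeral)
      then have "d0 = k + m" by simp
      then show ?thesis using k by (intro exI[of _ k]) simp
    qed
    show ?thesis using nz0 *[OF FG(1) DF] *[OF FG(2) DG] c(3,4) by auto
  qed
  then obtain k where k: "k \<le> d0" "D \<in> forms 3 k" by blast
  have forms: "F \<in> forms 3 (d0 - k)" "G \<in> forms 3 (d0 - k)"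
    using form_cofactor[OF k(2) De FG(1) DF k(1)] form_cofactor[OF k(2) De FG(2) DG k(1)] by auto
  have "ruling_at \<psi> F G x" if x: "x \<in> cspace 3" "x \<noteq> (\<lambda>_. 0)" for x
  proof -
    obtain d1 F1 G1 K1 where l1: "F1 \<in> forms 3 d1" "G1 \<in> forms 3 d1" "K1 \<in> polys 3" "K1 x \<noteq> 0"
      "\<forall>z\<in>cspace 3. z \<noteq> (\<lambda>_. 0) \<longrightarrow> K1 z \<noteq> 0 \<longrightarrow> ruling_at \<psi> F1 G1 z"
      using ruling_local[OF \<psi> x] by (elim exE conjE) (rule that)
    have P1: "F1 \<in> polys 3" "G1 \<in> polys 3" using formsD(1) l1(1,2) by auto
    have KK: "(\<lambda>x. K0 x * K1 x) \<in> polys 3" by (intro polys_mult l0 l1)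
    have "\<exists>z. K0 z * K1 z \<noteq> 0" using polys_integral[OF l0(3) l1(3)] l0(4) l1(4) by blast
    then obtain z0 where z0: "K0 z0 * K1 z0 \<noteq> 0" by blast
    have cross: "F0 z * G1 z = G0 z * F1 z" for z
    proof (rule polys3_cancel[OF KK z0 polys_mult[OF P0(1) P1(2)] polys_mult[OF P0(2) P1(1)]])
      fix y assume y: "y \<in> cspace 3" "y \<noteq> (\<lambda>_. 0)" "K0 y * K1 y \<noteq> 0"
      obtain v where v: "v \<in> crd21 (\<psi> (proj_point y))" "snd v 0 \<noteq> 0 \<or> snd v 1 \<noteq> 0" using crd[OF y(1,2)] by blast
      have "ruling_at \<psi> F0 G0 y" "ruling_at \<psi> F1 G1 y" using l0(5) l1(5) y by auto
      then have "snd v 1 * G0 y = snd v 0 * F0 y" "snd v 1 * G1 y = snd v 0 * F1 y"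
        using v(1) unfolding ruling_at_def by blast+
      then have "snd v 0 * (F0 y * G1 y) = snd v 0 * (G0 y * F1 y)" "snd v 1 * (F0 y * G1 y) = snd v 1 * (G0 y * F1 y)"
        by algebra+
      then show "F0 y * G1 y = G0 y * F1 y" using v(2) by auto
    qed
    have "D z * (F z * G1 z) = D z * (G z * F1 z)" for z using cross[of z] c(3,4) by (simp add: mult.assoc)
    from polys_cancel[OF c(1) polys_mult[OF FG(1) P1(2)] polys_mult[OF FG(2) P1(1)] this De]
    have "\<forall>z. F z * G1 z = G z * F1 z" by blast
    then obtain C where C: "\<forall>z. G1 z = G z * C z \<and> F1 z = F z * C z"
      using c(2) P1 unfolding lowest_terms_def by blast
    have r: "ruling_at \<psi> F1 G1 x" using l1(4,5) x by blast
    have n: "F1 x \<noteq> 0 \<or> G1 x \<noteq> 0" using r unfolding ruling_at_def by blast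
    then have "C x \<noteq> 0" using C by auto
    have "snd v 1 * G x = snd v 0 * F x" if v: "v \<in> crd21 (\<psi> (proj_point x))" for v
    proof -
      have "snd v 1 * G1 x = snd v 0 * F1 x" using r v unfolding ruling_at_def by blast
      then have "C x * (snd v 1 * G x) = C x * (snd v 0 * F x)" using C by (simp add: mult_ac)
      then show ?thesis using \<open>C x \<noteq> 0\<close> by simp
    qed
    then show ?thesis using n C unfolding ruling_at_def by auto
  qed
  then show ?thesis using forms by blast
qed

section \<open>The exceptional curve as a plane curve\<close>

text \<open>
  The exceptional curve, parametrized by the projective line.
\<close>

definition epoint :: "cvec \<Rightarrow> ppoint \<times> ppoint" where
  "epoint y = bpt (vec3 0 0 1, y)"

lemma epoint:
  assumes "y \<in> cspace 2" "y \<noteq> (\<lambda>_. 0)"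
  shows "bvec (vec3 0 0 1, y)" "epoint y \<in> F1pts" "(vec3 0 0 1, y) \<in> crd21 (epoint y)"
proof -
  show 1: "bvec (vec3 0 0 1, y)" using assms by (auto simp: bvec_def vec3_zero)
  show "epoint y \<in> F1pts" unfolding epoint_def bpt_F1[OF 1] by simp
  show "(vec3 0 0 1, y) \<in> crd21 (epoint y)" unfolding epoint_def by (rule bpt_crd)
qed

lemma epoint_form: "F \<in> biforms 3 2 d e \<Longrightarrow> (\<lambda>y. F (vec3 0 0 1, y)) \<in> forms 2 e"
proof (rule formsI)
  assume F: "F \<in> biforms 3 2 d e"
  show "(\<lambda>y. F (vec3 0 0 1, y)) \<in> polys 2"
    by (rule biforms_comp_polys[OF F]) (auto intro: polys_var)
  show "F (vec3 0 0 1, \<lambda>i. c * y i) = c ^ e * F (vec3 0 0 1, y)" for c y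
    using biformsD(2)[OF F, of 1 "vec3 0 0 1" c y] by simp
qed

lemma coordinate_ratio_pullback:
  assumes \<phi>: "morphism F1 (proj_space 2) \<phi>" and y: "y \<in> cspace 2" "y \<noteq> (\<lambda>_. 0)"
    and lk: "l < 3" "k < 3" and nz: "\<forall>x\<in>\<phi> (epoint y). x l \<noteq> 0"
  shows "\<exists>e. \<exists>a\<in>forms 2 e. \<exists>b\<in>forms 2 e. \<exists>\<kappa>\<in>polys 2. \<kappa> y \<noteq> 0 \<and>
    (\<forall>z\<in>cspace 2. z \<noteq> (\<lambda>_. 0) \<longrightarrow> \<kappa> z \<noteq> 0 \<longrightarrow> b z \<noteq> 0 \<and> (\<forall>x\<in>\<phi> (epoint z). x l \<noteq> 0 \<and> x k * b z = a z * x l))"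
proof -
  note \<phi>in = to_plane[OF \<phi>]
  have t: "2 + 1 = (3::nat)" by simp
  have fl: "(\<lambda>x. x l) \<in> forms (2 + 1) 1" "(\<lambda>x. x k) \<in> forms (2 + 1) 1" unfolding t by (intro forms_var lk)+
  have flU: "(\<lambda>x. x l) \<in> \<Union>(range (forms (2 + 1)))" using fl by blast
  have FH: "forms (2 + 1) 1 \<in> range (forms (2 + 1))" by blast
  define V where "V = proj_points 2 \<inter> pj.D 2 (\<lambda>x. x l)"
  define f where "f p = (let x = (SOME x. x \<in> p) in x k / x l)" for p :: ppoint
  have V: "openin (zar (proj_space 2)) V" unfolding V_def pj.openin_zsub[OF zsub_proj]
    by (intro conjI ballI bexI[OF _ flU]) auto
  have fV: "x l \<noteq> 0 \<and> f p = x k / x l" if "p \<in> V" "x \<in> p" for p x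
  proof -
    let ?x = "SOME x. x \<in> p"
    have x: "?x \<in> p" by (rule someI[where P = "\<lambda>x. x \<in> p", OF that(2)])
    have n: "x l \<noteq> 0" "?x l \<noteq> 0" using that x unfolding V_def principal_open_def by blast+
    have "p \<in> proj_points 2" using that(1) unfolding V_def by blast
    from pj.ratio_indep[OF FH fl(2) fl(1) this x that(2)] show ?thesis
      using n by (simp add: f_def Let_def field_simps)
  qed
  have VP: "V \<subseteq> proj_points 2" unfolding V_def by blast
  have "regular_on (proj_points 2) (\<lambda>p. p) (range (forms (2 + 1))) V f"
    by (rule pj.regular_on_quotient[OF VP FH fl(2,1)]) (use fV in blast)
  then have rf: "reg (proj_space 2) V f" using zsub_proj[of 2] V unfolding zsub_def by blast
  let ?U = "preim F1 \<phi> V"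
  have U: "openin (zar F1) ?U" by (rule morphism_open[OF \<phi> V])
  have "reg F1 ?U (f \<circ> \<phi>)" by (rule morphism_reg[OF \<phi> V rf])
  then have rU: "regular_on P21 crd21 BF ?U (f \<circ> \<phi>)" unfolding reg_F1[OF U] .
  note e = epoint[OF y]
  have "\<phi> (epoint y) \<in> V" using \<phi>in[OF e(2)] nz unfolding V_def principal_open_def by blast
  then have eU: "epoint y \<in> ?U" using e(2) unfolding preim_def pts_F1 by blast
  obtain H F G K where h: "H \<in> BF" "F \<in> H" "G \<in> H" "K \<in> \<Union>BF" "epoint y \<in> bi.D K"
      "\<forall>q\<in>?U \<inter> bi.D K. \<forall>v\<in>crd21 q. G v \<noteq> 0 \<and> (f \<circ> \<phi>) q = F v / G v"
    using rU eU unfolding regular_on_def by metis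
  obtain L where L: "L \<in> \<Union>BF" "epoint y \<in> bi.D L" "bi.D L \<inter> F1pts \<subseteq> ?U"
    using U eU unfolding bi.openin_zsub[OF zsub_F1] by meson
  obtain d m where dm: "F \<in> biforms 3 2 d m" "G \<in> biforms 3 2 d m" using h(1-3) unfolding BF_def by blast
  let ?r = "\<lambda>F y. F (vec3 0 0 1, y)"
  have KL: "?r K \<in> polys 2" "?r L \<in> polys 2" using h(4) L(1) epoint_form formsD(1) unfolding BF_iff by blast+
  show ?thesis
  proof (rule exI[of _ m], rule bexI[OF _ epoint_form[OF dm(1)]], rule bexI[OF _ epoint_form[OF dm(2)]],
      rule bexI[OF _ polys_mult[OF KL]], rule conjI)
    show "?r K y * ?r L y \<noteq> 0"
      using h(5) L(2) D_bpt[OF h(4) e(1)] D_bpt[OF L(1) e(1)] unfolding epoint_def by simp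
    show "\<forall>z\<in>cspace 2. z \<noteq> (\<lambda>_. 0) \<longrightarrow> ?r K z * ?r L z \<noteq> 0 \<longrightarrow>
        ?r G z \<noteq> 0 \<and> (\<forall>x\<in>\<phi> (epoint z). x l \<noteq> 0 \<and> x k * ?r G z = ?r F z * x l)"
    proof (intro ballI impI)
      fix z assume z: "z \<in> cspace 2" "z \<noteq> (\<lambda>_. 0)" "?r K z * ?r L z \<noteq> 0"
      note ez = epoint[OF z(1,2)]
      have "epoint z \<in> bi.D K" "epoint z \<in> bi.D L"
        using z(3) D_bpt[OF h(4) ez(1)] D_bpt[OF L(1) ez(1)] unfolding epoint_def by simp_all
      then have q: "epoint z \<in> ?U \<inter> bi.D K" using L(3) ez(2) by blast
      have G: "?r G z \<noteq> 0" "f (\<phi> (epoint z)) = ?r F z / ?r G z"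
        using h(6)[THEN bspec, OF q, THEN bspec, OF ez(3)] by auto
      have "\<phi> (epoint z) \<in> V" using q unfolding preim_def by blast
      then show "?r G z \<noteq> 0 \<and> (\<forall>x\<in>\<phi> (epoint z). x l \<noteq> 0 \<and> x k * ?r G z = ?r F z * x l)"
        using G fV by (auto simp: field_simps)
    qed
  qed
qed

text \<open>
  The binary forms \<open>\<alpha>\<close> of degree \<open>m\<close> describe the image of the exceptional curve in the plane, at least
  where \<open>\<kappa>\<close> does not vanish.
\<close>

definition curve_rep :: "(ppoint \<times> ppoint \<Rightarrow> ppoint) \<Rightarrow> nat \<Rightarrow> (nat \<Rightarrow> cvec \<Rightarrow> complex) \<Rightarrow> (cvec \<Rightarrow> complex) \<Rightarrow> bool" where
  "curve_rep \<phi> m \<alpha> \<kappa> \<longleftrightarrow> (\<forall>i. \<alpha> i \<in> forms 2 m) \<and> \<kappa> \<in> polys 2 \<and>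
    (\<forall>z\<in>cspace 2. z \<noteq> (\<lambda>_. 0) \<longrightarrow> \<kappa> z \<noteq> 0 \<longrightarrow> vec3 (\<alpha> 0 z) (\<alpha> 1 z) (\<alpha> 2 z) \<in> \<phi> (epoint z))"

text \<open>
  The ratios of the plane coordinates are quotients of binary forms; the three denominators are cleared
  simultaneously.
\<close>

lemma curve_rep_local:
  assumes \<phi>: "morphism F1 (proj_space 2) \<phi>" and y: "y \<in> cspace 2" "y \<noteq> (\<lambda>_. 0)"
  shows "\<exists>m \<alpha> \<kappa>. curve_rep \<phi> m \<alpha> \<kappa> \<and> \<kappa> y \<noteq> 0"
proof -
  note \<phi>in = to_plane[OF \<phi>]
  have py: "\<phi> (epoint y) \<in> proj_points 2" using \<phi>in epoint(2)[OF y] by blast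
  obtain x where x: "x \<in> \<phi> (epoint y)" "x \<in> cspace 3" "x \<noteq> (\<lambda>_. 0)" "\<phi> (epoint y) = proj_point x"
    using proj_points_ex[OF py] by auto
  obtain l where l0: "x l \<noteq> 0" using x(3) by auto
  then have l: "l < 3" using x(2) by (auto simp: cspace_def not_less[symmetric])
  have nz: "\<forall>x\<in>\<phi> (epoint y). x l \<noteq> 0" unfolding x(4) using l0 by (auto simp: proj_point_iff)
  define Q where "Q k e a b \<kappa> \<longleftrightarrow> a \<in> forms 2 e \<and> b \<in> forms 2 e \<and> \<kappa> \<in> polys 2 \<and> \<kappa> y \<noteq> 0 \<and>
    (\<forall>z\<in>cspace 2. z \<noteq> (\<lambda>_. 0) \<longrightarrow> \<kappa> z \<noteq> 0 \<longrightarrow> b z \<noteq> 0 \<and> (\<forall>x\<in>\<phi> (epoint z). x l \<noteq> 0 \<and> x k * b z = a z * x l))"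
    for k e a b \<kappa>
  have ex: "\<exists>e a b \<kappa>. Q k e a b \<kappa>" if "k < 3" for k
    using coordinate_ratio_pullback[OF \<phi> y l that nz] unfolding Q_def
    by (elim exE bexE) (intro exI conjI, assumption+, (elim conjE, assumption)+)
  obtain e0 a0 b0 \<kappa>0 where q0: "Q 0 e0 a0 b0 \<kappa>0" using ex[of 0] by auto
  obtain e1 a1 b1 \<kappa>1 where q1: "Q 1 e1 a1 b1 \<kappa>1" using ex[of 1] by auto
  obtain e2 a2 b2 \<kappa>2 where q2: "Q 2 e2 a2 b2 \<kappa>2" using ex[of 2] by auto
  define \<alpha> where "\<alpha> i z = (if i = 0 then a0 z * (b1 z * b2 z) else if i = 1 then b0 z * (a1 z * b2 z)
      else b0 z * (b1 z * a2 z))" for i :: nat and z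
  have "\<alpha> i \<in> forms 2 (e0 + (e1 + e2))" for i
    unfolding \<alpha>_def[abs_def] using q0 q1 q2 unfolding Q_def by (cases "i = 0"; cases "i = 1") (auto intro!: forms_mult)
  moreover have "(\<lambda>z. \<kappa>0 z * (\<kappa>1 z * \<kappa>2 z)) \<in> polys 2"
    using q0 q1 q2 unfolding Q_def by (intro polys_mult) auto
  moreover have "vec3 (\<alpha> 0 z) (\<alpha> 1 z) (\<alpha> 2 z) \<in> \<phi> (epoint z)"
    if z: "z \<in> cspace 2" "z \<noteq> (\<lambda>_. 0)" "\<kappa>0 z * (\<kappa>1 z * \<kappa>2 z) \<noteq> 0" for z
  proof -
    have pz: "\<phi> (epoint z) \<in> proj_points 2" using \<phi>in epoint(2)[OF z(1,2)] by blast
    obtain u where u: "u \<in> \<phi> (epoint z)" "u \<in> cspace 3" "u \<noteq> (\<lambda>_. 0)" "\<phi> (epoint z) = proj_point u"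
      using proj_points_ex[OF pz] by auto
    have r: "b0 z \<noteq> 0" "b1 z \<noteq> 0" "b2 z \<noteq> 0" "u l \<noteq> 0"
      "u 0 * b0 z = a0 z * u l" "u 1 * b1 z = a1 z * u l" "u 2 * b2 z = a2 z * u l"
      using q0 q1 q2 z u(1) unfolding Q_def by auto
    have a: "a0 z = u 0 * b0 z / u l" "a1 z = u 1 * b1 z / u l" "a2 z = u 2 * b2 z / u l"
      using r by (auto simp: field_simps)
    let ?c = "b0 z * b1 z * b2 z / u l"
    have "vec3 (\<alpha> 0 z) (\<alpha> 1 z) (\<alpha> 2 z) = (\<lambda>i. ?c * vec3 (u 0) (u 1) (u 2) i)"
      unfolding vec3_scale vec3_eq_iff \<alpha>_def a by (simp add: mult_ac)
    also have "vec3 (u 0) (u 1) (u 2) = u" using cspace3_eq[OF u(2)] by simp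
    finally show ?thesis unfolding u(4) proj_point_iff using r by (intro exI[of _ ?c]) simp
  qed
  ultimately have "curve_rep \<phi> (e0 + (e1 + e2)) \<alpha> (\<lambda>z. \<kappa>0 z * (\<kappa>1 z * \<kappa>2 z))" unfolding curve_rep_def by blast
  moreover have "\<kappa>0 y * (\<kappa>1 y * \<kappa>2 y) \<noteq> 0" using q0 q1 q2 unfolding Q_def by auto
  ultimately show ?thesis by (intro exI conjI)
qed

lemma curve_rep_nz:
  assumes "p \<in> proj_points 2" "vec3 a b c \<in> p" shows "\<not> (a = 0 \<and> b = 0 \<and> c = 0)"
  using proj_points_mem(2)[OF assms] vec3_zero by blast

text \<open>
  A representation of minimal degree has no common zero, as a common zero would be a common linear
  factor. Hence it describes the curve at every point.
\<close>

lemma curve_rep_global: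
  assumes \<phi>: "morphism F1 (proj_space 2) \<phi>"
  shows "\<exists>m \<alpha>. curve_rep \<phi> m \<alpha> (\<lambda>_. 1)"
proof -
  note \<phi>in = to_plane[OF \<phi>]
  define good where "good m \<longleftrightarrow> (\<exists>\<alpha> \<kappa> y. curve_rep \<phi> m \<alpha> \<kappa> \<and> \<kappa> y \<noteq> 0)" for m
  have v1: "vec2 1 0 \<in> cspace 2" "vec2 1 0 \<noteq> (\<lambda>_. 0)" by (auto simp: vec2_zero)
  have "\<exists>m. good m" using curve_rep_local[OF \<phi> v1] unfolding good_def by blast
  then have good: "good (LEAST m. good m)" by (rule LeastI_ex)
  define m where "m = (LEAST m. good m)"
  have least: "m \<le> n" if "good n" for n using that unfolding m_def by (rule Least_le)
  obtain \<alpha> \<kappa> y0 where a: "curve_rep \<phi> m \<alpha> \<kappa>" "\<kappa> y0 \<noteq> 0" using good unfolding good_def m_def by blast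
  have al: "\<alpha> i \<in> forms 2 m" for i using a(1) unfolding curve_rep_def by blast
  have kp: "\<kappa> \<in> polys 2" using a(1) unfolding curve_rep_def by blast
  have rep: "vec3 (\<alpha> 0 z) (\<alpha> 1 z) (\<alpha> 2 z) \<in> \<phi> (epoint z)" if "z \<in> cspace 2" "z \<noteq> (\<lambda>_. 0)" "\<kappa> z \<noteq> 0" for z
    using a(1) that unfolding curve_rep_def by blast
  have nozero: "\<exists>i<3. \<alpha> i y \<noteq> 0" if y: "y \<in> cspace 2" "y \<noteq> (\<lambda>_. 0)" for y
  proof (rule ccontr)
    assume "\<not> ?thesis"
    then have z: "\<alpha> 0 y = 0" "\<alpha> 1 y = 0" "\<alpha> 2 y = 0" by auto
    show False
    proof (cases "m = 0")
      case True
      then have "\<alpha> i x = \<alpha> i y" for i x using form_deg_0 al by metis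
      then have zz: "\<alpha> 0 x = 0" "\<alpha> 1 x = 0" "\<alpha> 2 x = 0" for x using z by metis+
      have "(\<lambda>_. 0) = (\<lambda>x. 1 :: complex)" if "\<forall>z\<in>cspace 2. z \<noteq> (\<lambda>_. 0) \<longrightarrow> \<kappa> z = 0"
      proof
        fix x :: cvec
        show "0 = (1::complex)"
          by (rule polys2_cancel[OF kp a(2), of "\<lambda>_. 0" "\<lambda>_. 1"]) (use that in auto)
      qed
      then obtain z where zc: "z \<in> cspace 2" "z \<noteq> (\<lambda>_. 0)" "\<kappa> z \<noteq> 0" by (metis zero_neq_one)
      show False using curve_rep_nz[OF \<phi>in[OF epoint(2)[OF zc(1,2)]] rep[OF zc]] zz by blast
    next
      case False
      then have m1: "m \<ge> 1" by simp
      obtain \<beta>0 \<beta>1 \<beta>2 where b: "\<beta>0 \<in> forms 2 (m - 1)" "\<beta>1 \<in> forms 2 (m - 1)" "\<beta>2 \<in> forms 2 (m - 1)"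
        "\<forall>x. \<alpha> 0 x = lin2 y x * \<beta>0 x" "\<forall>x. \<alpha> 1 x = lin2 y x * \<beta>1 x" "\<forall>x. \<alpha> 2 x = lin2 y x * \<beta>2 x"
        using binary_form_root[OF al m1 y z(1)] binary_form_root[OF al m1 y z(2)] binary_form_root[OF al m1 y z(3)]
        by (elim bexE) (rule that)
      define \<beta> where "\<beta> i = (if i = 0 then \<beta>0 else if i = 1 then \<beta>1 else \<beta>2)" for i :: nat
      have lp: "lin2 y \<in> polys 2" using formsD(1)[OF lin2_form] .
      have "curve_rep \<phi> (m - 1) \<beta> (\<lambda>x. \<kappa> x * lin2 y x)"
        unfolding curve_rep_def
      proof (intro conjI ballI impI allI polys_mult kp lp)
        show "\<beta> i \<in> forms 2 (m - 1)" for i using b by (simp add: \<beta>_def)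
        fix x assume x: "x \<in> cspace 2" "x \<noteq> (\<lambda>_. 0)" "\<kappa> x * lin2 y x \<noteq> 0"
        then have l: "\<kappa> x \<noteq> 0" "lin2 y x \<noteq> 0" by auto
        have p: "\<phi> (epoint x) \<in> proj_points 2" using \<phi>in epoint(2)[OF x(1,2)] by blast
        have e: "vec3 (\<alpha> 0 x) (\<alpha> 1 x) (\<alpha> 2 x) = (\<lambda>i. lin2 y x * vec3 (\<beta> 0 x) (\<beta> 1 x) (\<beta> 2 x) i)"
          unfolding vec3_scale vec3_eq_iff using b(4-6) by (simp add: \<beta>_def)
        have "\<phi> (epoint x) = proj_point (vec3 (\<alpha> 0 x) (\<alpha> 1 x) (\<alpha> 2 x))"
          by (rule proj_points_mem(3)[OF p rep[OF x(1,2) l(1)]])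
        then show "vec3 (\<beta> 0 x) (\<beta> 1 x) (\<beta> 2 x) \<in> \<phi> (epoint x)"
          unfolding e proj_point_scale[OF l(2)] by simp
      qed
      moreover have "\<exists>x. \<kappa> x * lin2 y x \<noteq> 0"
      proof (rule ccontr)
        assume "\<not> ?thesis"
        then have "\<kappa> x * lin2 y x = 0" for x by blast
        from polys_integral[OF kp lp this] a(2) have l0: "lin2 y x = 0" for x by blast
        have "y 0 = 0" "y 1 = 0" using l0[of "vec2 0 1"] l0[of "vec2 1 0"] by (auto simp: lin2_def)
        then show False using y cspace2_eq[OF y(1)] vec2_zero by (metis One_nat_def)
      qed
      ultimately have "good (m - 1)" unfolding good_def by blast
      then show False using least m1 by fastforce
    qed
  qed
  have "vec3 (\<alpha> 0 y) (\<alpha> 1 y) (\<alpha> 2 y) \<in> \<phi> (epoint y)" if y: "y \<in> cspace 2" "y \<noteq> (\<lambda>_. 0)" for y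
  proof -
    obtain m' \<alpha>' \<kappa>' where l: "curve_rep \<phi> m' \<alpha>' \<kappa>'" "\<kappa>' y \<noteq> 0" using curve_rep_local[OF \<phi> y] by blast
    have al': "\<alpha>' i \<in> forms 2 m'" for i using l(1) unfolding curve_rep_def by blast
    have kp': "\<kappa>' \<in> polys 2" using l(1) unfolding curve_rep_def by blast
    have rep': "vec3 (\<alpha>' 0 z) (\<alpha>' 1 z) (\<alpha>' 2 z) \<in> \<phi> (epoint z)" if "z \<in> cspace 2" "z \<noteq> (\<lambda>_. 0)" "\<kappa>' z \<noteq> 0" for z
      using l(1) that unfolding curve_rep_def by blast
    have py: "\<phi> (epoint y) \<in> proj_points 2" using \<phi>in epoint(2)[OF y] by blast
    have kk: "(\<lambda>x. \<kappa> x * \<kappa>' x) \<in> polys 2" by (intro polys_mult kp kp')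
    have "\<exists>x. \<kappa> x * \<kappa>' x \<noteq> 0" using polys_integral[OF kp kp'] a(2) l(2) by blast
    then obtain z0 where z0: "\<kappa> z0 * \<kappa>' z0 \<noteq> 0" by blast
    have cross: "\<alpha> i x * \<alpha>' j x = \<alpha> j x * \<alpha>' i x" if ij: "i < 3" "j < 3" for i j x
    proof (rule polys2_cancel[OF kk z0 polys_mult[OF formsD(1)[OF al] formsD(1)[OF al']] polys_mult[OF formsD(1)[OF al] formsD(1)[OF al']]])
      fix z assume z: "z \<in> cspace 2" "z \<noteq> (\<lambda>_. 0)" "\<kappa> z * \<kappa>' z \<noteq> 0"
      have pz: "\<phi> (epoint z) \<in> proj_points 2" using \<phi>in epoint(2)[OF z(1,2)] by blast
      have n: "\<kappa> z \<noteq> 0" "\<kappa>' z \<noteq> 0" using z(3) by auto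
      have "vec3 (\<alpha> 0 z) (\<alpha> 1 z) (\<alpha> 2 z) \<in> proj_point (vec3 (\<alpha>' 0 z) (\<alpha>' 1 z) (\<alpha>' 2 z))"
        using rep[OF z(1,2) n(1)] proj_points_mem(3)[OF pz rep'[OF z(1,2) n(2)]] by simp
      then obtain c where "vec3 (\<alpha> 0 z) (\<alpha> 1 z) (\<alpha> 2 z) = (\<lambda>i. c * vec3 (\<alpha>' 0 z) (\<alpha>' 1 z) (\<alpha>' 2 z) i)"
        unfolding proj_point_iff by blast
      then have c: "\<alpha> 0 z = c * \<alpha>' 0 z" "\<alpha> 1 z = c * \<alpha>' 1 z" "\<alpha> 2 z = c * \<alpha>' 2 z"
        unfolding vec3_scale vec3_eq_iff by auto
      then have "\<alpha> i z = c * \<alpha>' i z" if "i < 3" for i using that unfolding less_3_iff by auto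
      then show "\<alpha> i z * \<alpha>' j z = \<alpha> j z * \<alpha>' i z" using ij by simp
    qed
    let ?v = "vec3 (\<alpha> 0 y) (\<alpha> 1 y) (\<alpha> 2 y)" and ?w = "vec3 (\<alpha>' 0 y) (\<alpha>' 1 y) (\<alpha>' 2 y)"
    have w: "?w \<in> \<phi> (epoint y)" by (rule rep'[OF y l(2)])
    have "?v \<noteq> (\<lambda>_. 0)" using nozero[OF y] unfolding vec3_zero less_3_iff by auto
    moreover have "?w \<noteq> (\<lambda>_. 0)" using proj_points_mem(2)[OF py w] .
    moreover have "?v i * ?w j = ?v j * ?w i" if "i < 3" "j < 3" for i j
      using that cross[of 0 1] cross[of 0 2] cross[of 1 2] cross[of 1 0] cross[of 2 0] cross[of 2 1]
      unfolding less_3_iff by auto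
    ultimately obtain c where "c \<noteq> 0" "?v = (\<lambda>i. c * ?w i)"
      using proportional[of ?v 3 ?w] vec3_cspace by blast
    then have "?v \<in> proj_point ?w" unfolding proj_point_iff by blast
    then show ?thesis using proj_points_mem(3)[OF py w] by simp
  qed
  then have "curve_rep \<phi> m \<alpha> (\<lambda>_. 1)" unfolding curve_rep_def using al by simp
  then show ?thesis by blast
qed

text \<open>
  The ruling of the surface, seen from the plane, is given by forms \<open>F\<close> and \<open>G\<close> of degree \<open>d\<close> without common
  zero; the exceptional curve is a section of the ruling given by binary forms of degree \<open>m\<close>. The
  composite is the identity of the projective line, of degree \<open>d m\<close>, so \<open>d = 1\<close>; but two linear forms in
  three variables have a common zero.
\<close>

lemma F1_not_plane: "\<not> isomorphic F1 (proj_space 2)"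
proof
  assume "isomorphic F1 (proj_space 2)"
  then obtain \<phi> \<psi> where \<phi>: "morphism F1 (proj_space 2) \<phi>" and \<psi>: "morphism (proj_space 2) F1 \<psi>"
    and inv: "\<And>q. q \<in> F1pts \<Longrightarrow> \<psi> (\<phi> q) = q"
    unfolding isomorphic_def isomorphism_def pts_F1 by blast
  note \<phi>in = to_plane[OF \<phi>]
  obtain d F G where FG: "F \<in> forms 3 d" "G \<in> forms 3 d"
    "\<forall>x\<in>cspace 3. x \<noteq> (\<lambda>_. 0) \<longrightarrow> ruling_at \<psi> F G x"
    using ruling_global[OF \<psi>] by (elim exE conjE) (rule that)
  obtain m \<alpha> where "curve_rep \<phi> m \<alpha> (\<lambda>_. 1)" using curve_rep_global[OF \<phi>] by blast
  then have al: "\<And>i. \<alpha> i \<in> forms 2 m" and rep: "\<And>z. z \<in> cspace 2 \<Longrightarrow> z \<noteq> (\<lambda>_. 0) \<Longrightarrow>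
      vec3 (\<alpha> 0 z) (\<alpha> 1 z) (\<alpha> 2 z) \<in> \<phi> (epoint z)" unfolding curve_rep_def by auto
  let ?a = "\<lambda>y. vec3 (\<alpha> 0 y) (\<alpha> 1 y) (\<alpha> 2 y)"
  let ?F = "\<lambda>y. F (?a y)" and ?G = "\<lambda>y. G (?a y)"
  have va: "(\<lambda>w. ?a w i) \<in> forms 2 m" if "i < 3" for i using that al unfolding less_3_iff by auto
  have fF: "?F \<in> forms 2 (d * m)" by (rule forms_comp_forms[OF FG(1) va]) auto
  have fG: "?G \<in> forms 2 (d * m)" by (rule forms_comp_forms[OF FG(2) va]) auto
  have main: "(?F y \<noteq> 0 \<or> ?G y \<noteq> 0) \<and> y 1 * ?G y = y 0 * ?F y" if y: "y \<in> cspace 2" "y \<noteq> (\<lambda>_. 0)" for y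
  proof -
    have p: "\<phi> (epoint y) \<in> proj_points 2" using \<phi>in epoint(2)[OF y] by blast
    have n: "?a y \<noteq> (\<lambda>_. 0)" by (rule proj_points_mem(2)[OF p rep[OF y]])
    have "\<phi> (epoint y) = proj_point (?a y)" by (rule proj_points_mem(3)[OF p rep[OF y]])
    then have "\<psi> (proj_point (?a y)) = epoint y" using inv[OF epoint(2)[OF y]] by simp
    then have "(vec3 0 0 1, y) \<in> crd21 (\<psi> (proj_point (?a y)))" using epoint(3)[OF y] by simp
    then show ?thesis 
      using FG(3)[THEN bspec, OF vec3_cspace, THEN mp, OF n] unfolding ruling_at_def by fastforce
  qed
  have v01: "vec2 0 1 \<in> cspace 2" "vec2 0 1 \<noteq> (\<lambda>_. 0)" and v10: "vec2 1 0 \<in> cspace 2" "vec2 1 0 \<noteq> (\<lambda>_. 0)"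
    by (auto simp: vec2_zero)
  have G01: "?G (vec2 0 1) = 0" using main[OF v01] by simp
  have G10: "?G (vec2 1 0) \<noteq> 0" using main[OF v10] by simp
  have dm1: "d * m \<ge> 1"
  proof (rule ccontr)
    assume "\<not> d * m \<ge> 1"
    then have "d * m = 0" by linarith
    then have "?G \<in> forms 2 0" using fG by metis
    then have "?G (vec2 0 1) = ?G (vec2 1 0)" by (rule form_deg_0)
    then show False using G01 G10 by simp
  qed
  obtain H where H: "H \<in> forms 2 (d * m - 1)" "\<forall>x. ?G x = lin2 (vec2 0 1) x * H x"
    using binary_form_root[OF fG dm1 v01 G01] by (elim bexE) (rule that)
  have GH: "?G x = x 0 * H x" for x using H(2) by (simp add: lin2_def)
  have FH: "?F x = x 1 * H x" for x
  proof (rule polys2_cancel[of "\<lambda>x. x 0" "vec2 1 0" ?F "\<lambda>x. x 1 * H x"])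
    show "?F \<in> polys 2" using formsD(1)[OF fF] .
    show "(\<lambda>x. x 1 * H x) \<in> polys 2" by (intro polys_mult polys_var formsD(1)[OF H(1)]) simp
    fix y :: cvec assume y: "y \<in> cspace 2" "y \<noteq> (\<lambda>_. 0)" "y 0 \<noteq> 0"
    have "y 1 * (y 0 * H y) = y 0 * ?F y" using main[OF y(1,2)] GH[of y] by metis
    then show "?F y = y 1 * H y" using y(3) by (metis mult.left_commute mult_cancel_left)
  qed (auto intro: polys_var)
  have "d * m = 1"
  proof (rule ccontr)
    assume "d * m \<noteq> 1"
    then have "d * m - 1 \<ge> 1" using dm1 by linarith
    then obtain z where z: "z \<in> cspace 2" "z \<noteq> (\<lambda>_. 0)" "H z = 0" using binary_form_zero[OF H(1)] by blast
    have "?F z = 0" "?G z = 0" using FH[of z] GH[of z] z(3) by simp_all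
    then show False using main[OF z(1,2)] by blast
  qed
  then have "d = 1" by simp
  then obtain x where "x \<in> cspace 3" "x \<noteq> (\<lambda>_. 0)" "F x = 0" "G x = 0"
    using linear_forms_common_zero FG(1,2) by blast
  then show False using FG(3) unfolding ruling_at_def by blast
qed

theorem mainTheorem7:
  shows "(\<exists>g. polarized_endo F1 g \<and> has_tot_per_poly F1 g \<and> tot_per_poly F1 g = [:1, 1:] ^ 3) \<and>
    \<not> isomorphic F1 (proj_space 2) \<and>
    \<not> (\<forall>(X :: (ppoint \<times> ppoint) fspace) f.
          has_tot_per_poly X f \<and> tot_per_poly X f = [:1, 1:] ^ (var_dim X + 1) \<longrightarrow>
          isomorphic X (proj_space (var_dim X)))"
proof (intro conjI)
  have per: "has_tot_per_poly F1 gF1"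
    unfolding has_tot_per_poly_def
    using projective_F1 gF1_finite_surjective tot_per_poly_F1(2) by blast
  show "\<exists>g. polarized_endo F1 g \<and> has_tot_per_poly F1 g \<and> tot_per_poly F1 g = [:1, 1:] ^ 3"
    using gF1_polarized per tot_per_poly_F1(1) by blast
  show "\<not> isomorphic F1 (proj_space 2)" by (rule F1_not_plane)
  have "tot_per_poly F1 gF1 = [:1, 1:] ^ (var_dim F1 + 1)"
    using tot_per_poly_F1(1) by (simp add: var_dim_F1)
  then show "\<not> (\<forall>(X :: (ppoint \<times> ppoint) fspace) f.
          has_tot_per_poly X f \<and> tot_per_poly X f = [:1, 1:] ^ (var_dim X + 1) \<longrightarrow>
          isomorphic X (proj_space (var_dim X)))"
    using per F1_not_plane var_dim_F1 by metis
qed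

end
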